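(* Let $K$ be a field, let $S$ be either $K[[x_1,\ldots,x_n]]$ or $K[x_1,\ldots,x_n]$, and let $I\subset S$ be a proper ideal (graded if $S$ is the polynomial ring) such that $d_\sigma(I)^2\subset I$ for some permutation $\sigma$ of $\{1,\ldots,n\}$. Then $I$ is a Golod ideal.
   Context: $\mathfrak{n}=(x_1,\ldots,x_n)\subset S$. For $f\in\mathfrak{n}$ and $1\le r\le n$ define $$d^r(f)=\frac{f(0,\ldots,0,x_r,\ldots,x_n)-f(0,\ldots,0,x_{r+1},\ldots,x_n)}{x_r}\in S.$$ For a permutation $\sigma$ of $\{1,\ldots,n\}$, let $\sigma$ also denote the $K$-algebra automorphism of $S$ with $x_i\mapsto x_{\sigma(i)}$, and set $d^i_\sigma(f)=\sigma\bigl(d^i(f(x_{\sigma^{-1}(1)},\ldots,x_{\sigma^{-1}(n)}))\bigr)$, i.e. $d^i_\sigma=\sigma\circ d^i\circ\sigma^{-1}$. If $I=(f_1,\ldots,f_m)$, then $d_\sigma(I)$ is the ideal of $S$ generated by all $d^i_\sigma(f_j)$, $1\le i\le n$, $1\le j\le m$ (independent of the choice of generators). Golod: for $R=S/I$ put $P^R_K(t)=\sum_{i\ge0}\dim_K\operatorname{Tor}^R_i(K,K)\,t^i$ and $P^S_R(t)=\sum_{i\ge0}\dim_K\operatorname{Tor}^S_i(K,R)\,t^i$. The ideal $I$ (or the ring $R$) is called Golod if $$P^R_K(t)=\frac{(1+t)^n}{1-t\,(P^S_R(t)-1)}.$$ *)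

theory Defs
  imports
    "HOL-Computational_Algebra.Formal_Power_Series"
    "HOL-Combinatorics.Permutations"
    "HOL-Algebra.Ideal_Product"
    "HOL-Algebra.QuotRing"
    "Jordan_Normal_Form.VS_Connect"
begin

section \<open>Power series and polynomials in finitely many variables\<close>

text \<open>
  A monomial is the multiset of its variables (as in \<open>HOL-Algebra.Indexed_Polynomials\<close>), and a
  power series in \<open>x\<^sub>1, \<dots>, x\<^sub>n\<close> is its coefficient function, supported on the monomials in the
  variables with index in \<open>{1..n}\<close>.  The coefficient field is a type of class \<^class>\<open>field\<close>;
  as a HOL-Algebra ring it is \<open>class_ring\<close>.
\<close>

definition mps_mult :: "(nat multiset \<Rightarrow> 'k) \<Rightarrow> (nat multiset \<Rightarrow> 'k) \<Rightarrow> nat multiset \<Rightarrow> 'k::field"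
  where "mps_mult f g = (\<lambda>m. \<Sum>a | a \<subseteq># m. f a * g (m - a))"

definition const :: "'k \<Rightarrow> nat multiset \<Rightarrow> 'k::field"
  where "const c = (\<lambda>m. if m = {#} then c else 0)"

definition var :: "nat \<Rightarrow> nat multiset \<Rightarrow> 'k::field"
  where "var i = (\<lambda>m. if m = {#i#} then 1 else 0)"

lemma finite_submset: "finite {a. a \<subseteq># (m :: 'a multiset)}"
proof (rule finite_subset)
  show "{a. a \<subseteq># m} \<subseteq> mset ` {xs. set xs \<subseteq> set_mset m \<and> length xs \<le> size m}"
  proof
    fix a assume "a \<in> {a. a \<subseteq># m}"
    then have a: "a \<subseteq># m" by simp
    obtain xs where xs: "mset xs = a" using ex_mset by blast
    have "set xs \<subseteq> set_mset m" "length xs \<le> size m"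
      using a xs set_mset_mono[OF a] size_mset_mono[OF a] by (metis set_mset_mset, metis size_mset)
    then show "a \<in> mset ` {xs. set xs \<subseteq> set_mset m \<and> length xs \<le> size m}"
      using xs by blast
  qed
  show "finite (mset ` {xs. set xs \<subseteq> set_mset m \<and> length xs \<le> size m})"
    by (intro finite_imageI finite_lists_length_le) simp
qed

lemma mps_mult_commute: "mps_mult f g = mps_mult g f"
proof
  fix m
  show "mps_mult f g m = mps_mult g f m"
    unfolding mps_mult_def
    by (rule sum.reindex_bij_witness[of _ "\<lambda>a. m - a" "\<lambda>a. m - a"])
       (auto simp: mult.commute double_diff subset_mset.diff_diff_right)
qed

lemma mps_mult_assoc: "mps_mult (mps_mult f g) h = mps_mult f (mps_mult g h)"
proof
  fix m
  have "mps_mult (mps_mult f g) h m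
      = (\<Sum>(a, b)\<in>(SIGMA a:{a. a \<subseteq># m}. {b. b \<subseteq># a}). f b * g (a - b) * h (m - a))"
    unfolding mps_mult_def by (simp add: sum.Sigma finite_submset sum_distrib_right)
  also have "\<dots> = (\<Sum>(b, c)\<in>(SIGMA b:{b. b \<subseteq># m}. {c. c \<subseteq># m - b}). f b * (g c * h (m - b - c)))"
  proof (rule sum.reindex_bij_witness[of _ "\<lambda>(b, c). (b + c, b)" "\<lambda>(a, b). (b, a - b)"], goal_cases)
    case (1 x)
    then show ?case by auto
  next
    case (2 x)
    then obtain a b where x: "x = (a, b)" "a \<subseteq># m" "b \<subseteq># a" by auto
    then have "b \<subseteq># m" using subset_mset.order_trans by blast
    moreover have "a - b \<subseteq># m - b"
      using x by (simp add: subseteq_mset_def diff_le_mono)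
    ultimately show ?case using x by simp
  next
    case (3 x)
    then show ?case by auto
  next
    case (4 x)
    then obtain b c where x: "x = (b, c)" "b \<subseteq># m" "c \<subseteq># m - b" by auto
    then have "b + c \<subseteq># m"
      by (metis subset_mset.add_diff_inverse subset_mset.add_le_cancel_left)
    then show ?case using x by simp
  next
    case (5 x)
    then show ?case by (auto simp: mult.assoc)
  qed
  also have "\<dots> = mps_mult f (mps_mult g h) m"
    unfolding mps_mult_def by (simp add: sum.Sigma finite_submset sum_distrib_left)
  finally show "mps_mult (mps_mult f g) h m = mps_mult f (mps_mult g h) m" .
qed

lemma mps_mult_const: "mps_mult (const c) f m = c * f m"
proof -
  have "mps_mult (const c) f m = (\<Sum>a\<in>{a. a \<subseteq># m}. if a = {#} then c * f m else 0)"
    unfolding mps_mult_def const_def by (intro sum.cong) auto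
  then show ?thesis by (simp add: finite_submset)
qed

lemma mps_mult_one: "mps_mult (const 1) f = f"
  by (rule ext) (simp add: mps_mult_const)

lemma mps_mult_add: "mps_mult f (\<lambda>m. g m + h m) = (\<lambda>m. mps_mult f g m + mps_mult f h m)"
  by (rule ext) (simp add: mps_mult_def distrib_left sum.distrib)

lemma mps_mult_diff: "mps_mult f (\<lambda>m. g m - h m) = (\<lambda>m. mps_mult f g m - mps_mult f h m)"
  by (rule ext) (simp add: mps_mult_def right_diff_distrib sum_subtractf)

lemma mps_mult_nonzero:
  assumes "mps_mult f g m \<noteq> 0"
  obtains a b where "m = a + b" "f a \<noteq> 0" "g b \<noteq> 0"
proof -
  obtain a where "a \<in> {a. a \<subseteq># m}" "f a * g (m - a) \<noteq> 0"
    using assms unfolding mps_mult_def by (rule sum.not_neutral_contains_not_neutral)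
  then show ?thesis using that[of a "m - a"] by auto
qed

lemma mps_mult_var: "mps_mult (var r) f m = (if r \<in># m then f (m - {#r#}) else 0)"
proof -
  have "mps_mult (var r) f m = (\<Sum>a\<in>{a. a \<subseteq># m}. if a = {#r#} then f (m - {#r#}) else 0)"
    unfolding mps_mult_def var_def by (intro sum.cong) auto
  then show ?thesis by (simp add: finite_submset)
qed

definition power_series_ring :: "nat \<Rightarrow> (nat multiset \<Rightarrow> 'k::field) ring"
  where "power_series_ring n =
    \<lparr>carrier = {f. \<forall>m. f m \<noteq> 0 \<longrightarrow> set_mset m \<subseteq> {1..n}},
     mult = mps_mult, one = const 1, zero = const 0, add = (\<lambda>f g m. f m + g m)\<rparr>"

definition polynomial_ring :: "nat \<Rightarrow> (nat multiset \<Rightarrow> 'k::field) ring"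
  where "polynomial_ring n = (power_series_ring n)
    \<lparr>carrier := {f \<in> carrier (power_series_ring n). finite {m. f m \<noteq> 0}}\<rparr>"

lemma power_series_ring_simps [simp]:
  "mult (power_series_ring n) = mps_mult" "one (power_series_ring n) = const 1"
  "zero (power_series_ring n) = const 0" "add (power_series_ring n) = (\<lambda>f g m. f m + g m)"
  by (simp_all add: power_series_ring_def)

lemma polynomial_ring_simps [simp]:
  "mult (polynomial_ring n) = mps_mult" "one (polynomial_ring n) = const 1"
  "zero (polynomial_ring n) = const 0" "add (polynomial_ring n) = (\<lambda>f g m. f m + g m)"
  by (simp_all add: polynomial_ring_def)

lemma carrier_power_series_ring:
  "f \<in> carrier (power_series_ring n) \<longleftrightarrow> (\<forall>m. f m \<noteq> 0 \<longrightarrow> set_mset m \<subseteq> {1..n})"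
  by (simp add: power_series_ring_def)

lemma carrier_polynomial_ring:
  "f \<in> carrier (polynomial_ring n) \<longleftrightarrow>
    (\<forall>m. f m \<noteq> 0 \<longrightarrow> set_mset m \<subseteq> {1..n}) \<and> finite {m. f m \<noteq> 0}"
  by (simp add: polynomial_ring_def carrier_power_series_ring)

lemma mps_mult_closed:
  "f \<in> carrier (power_series_ring n) \<Longrightarrow> g \<in> carrier (power_series_ring n) \<Longrightarrow>
    mps_mult f g \<in> carrier (power_series_ring n)"
  unfolding carrier_power_series_ring by (metis mps_mult_nonzero set_mset_union Un_least)

lemma cring_power_series_ring: "cring (power_series_ring n :: (nat multiset \<Rightarrow> 'k::field) ring)"
proof (rule cringI)
  show "abelian_group (power_series_ring n :: (nat multiset \<Rightarrow> 'k) ring)"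
  proof (rule abelian_groupI)
    fix f :: "nat multiset \<Rightarrow> 'k" assume f: "f \<in> carrier (power_series_ring n)"
    show "\<exists>g\<in>carrier (power_series_ring n). g \<oplus>\<^bsub>power_series_ring n\<^esub> f = \<zero>\<^bsub>power_series_ring n\<^esub>"
      using f by (intro bexI[of _ "\<lambda>m. - f m"]) (auto simp: const_def carrier_power_series_ring)
    show "\<zero>\<^bsub>power_series_ring n\<^esub> \<oplus>\<^bsub>power_series_ring n\<^esub> f = f"
      by (auto simp: const_def)
  next
    fix f g :: "nat multiset \<Rightarrow> 'k"
    assume "f \<in> carrier (power_series_ring n)" "g \<in> carrier (power_series_ring n)"
    then show "f \<oplus>\<^bsub>power_series_ring n\<^esub> g \<in> carrier (power_series_ring n)"
      by (simp add: carrier_power_series_ring) (metis add.right_neutral)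
  qed (auto simp: carrier_power_series_ring const_def algebra_simps)
  show "Group.comm_monoid (power_series_ring n :: (nat multiset \<Rightarrow> 'k) ring)"
  proof (rule Group.comm_monoidI)
    show "\<one>\<^bsub>power_series_ring n\<^esub> \<in> carrier (power_series_ring n)"
      by (simp add: carrier_power_series_ring const_def)
  qed (simp_all add: mps_mult_closed mps_mult_one mps_mult_assoc, rule mps_mult_commute)
qed (simp add: mps_mult_add mps_mult_commute[of _ h for h])

lemma cring_polynomial_ring: "cring (polynomial_ring n :: (nat multiset \<Rightarrow> 'k::field) ring)"
proof (rule cringI)
  show "abelian_group (polynomial_ring n :: (nat multiset \<Rightarrow> 'k) ring)"
  proof (rule abelian_groupI)
    fix f :: "nat multiset \<Rightarrow> 'k" assume f: "f \<in> carrier (polynomial_ring n)"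
    show "\<exists>g\<in>carrier (polynomial_ring n). g \<oplus>\<^bsub>polynomial_ring n\<^esub> f = \<zero>\<^bsub>polynomial_ring n\<^esub>"
      using f by (intro bexI[of _ "\<lambda>m. - f m"]) (auto simp: const_def carrier_polynomial_ring)
    show "\<zero>\<^bsub>polynomial_ring n\<^esub> \<oplus>\<^bsub>polynomial_ring n\<^esub> f = f"
      by (auto simp: const_def)
  next
    fix f g :: "nat multiset \<Rightarrow> 'k"
    assume fg: "f \<in> carrier (polynomial_ring n)" "g \<in> carrier (polynomial_ring n)"
    have "finite {m. f m + g m \<noteq> 0}"
      by (rule finite_subset[of _ "{m. f m \<noteq> 0} \<union> {m. g m \<noteq> 0}"])
         (use fg in \<open>auto simp: carrier_polynomial_ring\<close>)
    then show "f \<oplus>\<^bsub>polynomial_ring n\<^esub> g \<in> carrier (polynomial_ring n)"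
      using fg by (simp add: carrier_polynomial_ring) (metis add.right_neutral)
  qed (auto simp: carrier_polynomial_ring const_def algebra_simps)
  have closed: "mps_mult f g \<in> carrier (polynomial_ring n)"
    if "f \<in> carrier (polynomial_ring n)" "g \<in> carrier (polynomial_ring n)"
    for f g :: "nat multiset \<Rightarrow> 'k"
  proof -
    have "{m. mps_mult f g m \<noteq> 0} \<subseteq> (\<lambda>(a, b). a + b) ` ({m. f m \<noteq> 0} \<times> {m. g m \<noteq> 0})"
      by (auto elim!: mps_mult_nonzero)
    then have "finite {m. mps_mult f g m \<noteq> 0}"
      by (rule finite_subset) (use that in \<open>simp add: carrier_polynomial_ring\<close>)
    then show ?thesis
      using that mps_mult_closed[of f n g]
      by (simp add: carrier_polynomial_ring carrier_power_series_ring)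
  qed
  show "Group.comm_monoid (polynomial_ring n :: (nat multiset \<Rightarrow> 'k) ring)"
  proof (rule Group.comm_monoidI)
    show "\<one>\<^bsub>polynomial_ring n\<^esub> \<in> carrier (polynomial_ring n)"
      by (simp add: carrier_polynomial_ring const_def)
  qed (simp_all add: closed mps_mult_one mps_mult_assoc, rule mps_mult_commute)
qed (simp add: mps_mult_add mps_mult_commute[of _ h for h])

text \<open>Graded with respect to the standard grading, \<open>deg x\<^sub>i = 1\<close>.\<close>

definition hom_component :: "nat \<Rightarrow> (nat multiset \<Rightarrow> 'k) \<Rightarrow> nat multiset \<Rightarrow> 'k::field"
  where "hom_component d f = (\<lambda>m. if size m = d then f m else 0)"

definition graded_ideal :: "(nat multiset \<Rightarrow> 'k::field) set \<Rightarrow> bool"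
  where "graded_ideal I \<longleftrightarrow> (\<forall>f\<in>I. \<forall>d. hom_component d f \<in> I)"


section \<open>The operators \<open>d\<^sup>r\<close>, \<open>d\<^sup>r\<^sub>\<sigma>\<close> and the ideal \<open>d\<^sub>\<sigma>(I)\<close>\<close>

text \<open>\<open>kill_below r f\<close> is \<open>f(0, \<dots>, 0, x\<^sub>r, \<dots>, x\<^sub>n)\<close>.\<close>

definition kill_below :: "nat \<Rightarrow> (nat multiset \<Rightarrow> 'k) \<Rightarrow> nat multiset \<Rightarrow> 'k::field"
  where "kill_below r f = (\<lambda>m. if set_mset m \<subseteq> {r..} then f m else 0)"

text \<open>Division by \<open>x\<^sub>r\<close>; only meaningful for multiples of \<open>x\<^sub>r\<close>, see \<open>var_mult_dd\<close> below.\<close>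

definition div_var :: "nat \<Rightarrow> (nat multiset \<Rightarrow> 'k) \<Rightarrow> nat multiset \<Rightarrow> 'k::field"
  where "div_var r f = (\<lambda>m. f (add_mset r m))"

definition dd :: "nat \<Rightarrow> (nat multiset \<Rightarrow> 'k) \<Rightarrow> nat multiset \<Rightarrow> 'k::field"
  where "dd r f = div_var r (\<lambda>m. kill_below r f m - kill_below (Suc r) f m)"

text \<open>The automorphism \<open>x\<^sub>i \<mapsto> x\<^bsub>\<sigma>(i)\<^esub>\<close>, on coefficients (\<open>\<sigma>\<close> is a permutation).\<close>

definition act :: "(nat \<Rightarrow> nat) \<Rightarrow> (nat multiset \<Rightarrow> 'k) \<Rightarrow> nat multiset \<Rightarrow> 'k::field"
  where "act \<sigma> f = (\<lambda>m. f (image_mset (inv_into UNIV \<sigma>) m))"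

definition dd_perm :: "(nat \<Rightarrow> nat) \<Rightarrow> nat \<Rightarrow> (nat multiset \<Rightarrow> 'k) \<Rightarrow> nat multiset \<Rightarrow> 'k::field"
  where "dd_perm \<sigma> i f = act \<sigma> (dd i (act (inv_into UNIV \<sigma>) f))"

lemma div_var_mult: "div_var r (mps_mult (var r) f) = f"
  by (rule ext) (simp add: div_var_def mps_mult_var)

lemma var_mult_dd:
  "mps_mult (var r) (dd r f) = (\<lambda>m. kill_below r f m - kill_below (Suc r) f m)"
proof
  fix m
  show "mps_mult (var r) (dd r f) m = kill_below r f m - kill_below (Suc r) f m"
  proof (cases "r \<in># m")
    case True
    then have "mps_mult (var r) (dd r f) m = dd r f (m - {#r#})" by (simp add: mps_mult_var)
    then show ?thesis unfolding dd_def div_var_def insert_DiffM[OF True] .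
  next
    case False
    then have "set_mset m \<subseteq> {r..} \<longleftrightarrow> set_mset m \<subseteq> {Suc r..}"
      by (auto simp: subset_eq Suc_le_eq le_less)
    with False show ?thesis by (simp add: mps_mult_var kill_below_def)
  qed
qed

lemma kill_below_mult: "kill_below r (mps_mult f g) = mps_mult (kill_below r f) (kill_below r g)"
proof
  fix m
  show "kill_below r (mps_mult f g) m = mps_mult (kill_below r f) (kill_below r g) m"
  proof (cases "set_mset m \<subseteq> {r..}")
    case True
    have "kill_below r f a = f a \<and> kill_below r g (m - a) = g (m - a)" if "a \<subseteq># m" for a
      using that True by (auto simp: kill_below_def dest: mset_subset_eqD in_diffD)
    then have "mps_mult (kill_below r f) (kill_below r g) m = mps_mult f g m"
      unfolding mps_mult_def by (intro sum.cong) auto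
    moreover have "kill_below r (mps_mult f g) m = mps_mult f g m"
      using True by (simp add: kill_below_def)
    ultimately show ?thesis by simp
  next
    case False
    have "kill_below r f a * kill_below r g (m - a) = 0" if "a \<subseteq># m" for a
    proof (rule ccontr)
      assume "\<not> ?thesis"
      then have "set_mset (a + (m - a)) \<subseteq> {r..}"
        by (auto simp: kill_below_def split: if_splits)
      with that False show False by simp
    qed
    then have "mps_mult (kill_below r f) (kill_below r g) m = 0"
      unfolding mps_mult_def by (intro sum.neutral) auto
    moreover have "kill_below r (mps_mult f g) m = 0"
      using False by (simp add: kill_below_def)
    ultimately show ?thesis by simp
  qed
qed

lemma dd_mult:
  "dd r (mps_mult f g) =
    (\<lambda>m. mps_mult (kill_below r f) (dd r g) m + mps_mult (dd r f) (kill_below (Suc r) g) m)"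
  (is "_ = ?rhs")
proof -
  have "mps_mult (var r) ?rhs = (\<lambda>m. kill_below r (mps_mult f g) m - kill_below (Suc r) (mps_mult f g) m)"
  proof -
    have 1: "mps_mult (var r) (mps_mult (kill_below r f) (dd r g))
        = mps_mult (kill_below r f) (\<lambda>m. kill_below r g m - kill_below (Suc r) g m)"
      unfolding var_mult_dd[symmetric] by (metis mps_mult_assoc mps_mult_commute)
    have 2: "mps_mult (var r) (mps_mult (dd r f) (kill_below (Suc r) g))
        = mps_mult (kill_below (Suc r) g) (\<lambda>m. kill_below r f m - kill_below (Suc r) f m)"
      unfolding var_mult_dd[symmetric] by (metis mps_mult_assoc mps_mult_commute)
    show ?thesis
      unfolding mps_mult_add 1 2 mps_mult_diff kill_below_mult
      by (simp add: mps_mult_commute)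
  qed
  then show ?thesis
    by (metis dd_def div_var_mult)
qed

lemma act_mult:
  assumes "bij \<sigma>"
  shows "act \<sigma> (mps_mult f g) = mps_mult (act \<sigma> f) (act \<sigma> g)"
proof
  fix m
  define \<tau> where "\<tau> = inv_into UNIV \<sigma>"
  have inv: "\<sigma> (\<tau> i) = i" "\<tau> (\<sigma> i) = i" for i
    using assms by (simp_all add: \<tau>_def bij_is_surj surj_f_inv_f bij_is_inj)
  have inv': "image_mset \<sigma> (image_mset \<tau> a) = a" "image_mset \<tau> (image_mset \<sigma> a) = a" for a
    by (simp_all add: multiset.map_comp comp_def inv)
  show "act \<sigma> (mps_mult f g) m = mps_mult (act \<sigma> f) (act \<sigma> g) m"
    unfolding act_def mps_mult_def \<tau>_def[symmetric]
  proof (rule sum.reindex_bij_witness[of _ "image_mset \<tau>" "image_mset \<sigma>"])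
    fix a assume "a \<in> {a. a \<subseteq># image_mset \<tau> m}"
    then have a: "a \<subseteq># image_mset \<tau> m" by simp
    then show "image_mset \<sigma> a \<in> {a. a \<subseteq># m}"
      using image_mset_subseteq_mono[OF a, of \<sigma>] by (simp add: inv')
    show "f (image_mset \<tau> (image_mset \<sigma> a)) * g (image_mset \<tau> (m - image_mset \<sigma> a))
        = f a * g (image_mset \<tau> m - a)"
      using image_mset_subseteq_mono[OF a, of \<sigma>] by (simp add: inv' image_mset_Diff)
  qed (auto simp: inv' image_mset_subseteq_mono)
qed

lemma act_var:
  assumes "bij \<sigma>"
  shows "act \<sigma> (var i) = var (\<sigma> i)"
proof
  fix m
  have "image_mset (inv_into UNIV \<sigma>) m = {#i#} \<longleftrightarrow> m = {#\<sigma> i#}"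
  proof
    assume "image_mset (inv_into UNIV \<sigma>) m = {#i#}"
    then have "image_mset \<sigma> (image_mset (inv_into UNIV \<sigma>) m) = {#\<sigma> i#}" by simp
    then show "m = {#\<sigma> i#}"
      using assms by (simp add: multiset.map_comp comp_def bij_is_surj surj_f_inv_f)
  qed (use assms in \<open>simp add: bij_is_inj\<close>)
  then show "act \<sigma> (var i) m = var (\<sigma> i) m" by (simp add: act_def var_def)
qed

lemma act_closed:
  assumes S: "S = power_series_ring n \<or> S = polynomial_ring n"
    and \<sigma>: "\<sigma> permutes {1..n}" and f: "f \<in> carrier S"
  shows "act \<sigma> f \<in> carrier S"
proof -
  define \<tau> where "\<tau> = inv_into UNIV \<sigma>"
  have inj: "inj \<tau>" using permutes_inv[OF \<sigma>] permutes_inj \<tau>_def by blast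
  have supp: "set_mset m \<subseteq> {1..n}" if "set_mset (image_mset \<tau> m) \<subseteq> {1..n}" for m
  proof
    fix i assume "i \<in># m"
    then have "\<tau> i \<in> {1..n}" using that by auto
    then show "i \<in> {1..n}" using permutes_in_image[OF permutes_inv[OF \<sigma>]] \<tau>_def by metis
  qed
  have "finite {m. f (image_mset \<tau> m) \<noteq> 0}" if "finite {m. f m \<noteq> 0}"
    using finite_vimageI[OF that, of "image_mset \<tau>"] inj by (simp add: vimage_def multiset.inj_map)
  with S f supp show ?thesis
    unfolding act_def \<tau>_def[symmetric]
    by (auto simp: carrier_power_series_ring carrier_polynomial_ring simp del: set_image_mset)
qed

lemma carrier_supp:
  assumes "S = power_series_ring n \<or> S = polynomial_ring n" and "f \<in> carrier S" and "f m \<noteq> 0"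
  shows "set_mset m \<subseteq> {1..n}"
  using assms(1)
proof
  assume "S = power_series_ring n"
  with assms(2) have "f \<in> carrier (power_series_ring n)" by simp
  with assms(3) show ?thesis unfolding carrier_power_series_ring by blast
next
  assume "S = polynomial_ring n"
  with assms(2) have "f \<in> carrier (polynomial_ring n)" by simp
  with assms(3) show ?thesis unfolding carrier_polynomial_ring by blast
qed

lemma kill_below_closed:
  assumes S: "S = power_series_ring n \<or> S = polynomial_ring n" and f: "f \<in> carrier S"
  shows "kill_below r f \<in> carrier S"
proof -
  have nz: "f m \<noteq> 0" if "kill_below r f m \<noteq> 0" for m
    using that by (auto simp: kill_below_def split: if_splits)
  then have "{m. kill_below r f m \<noteq> 0} \<subseteq> {m. f m \<noteq> 0}" by blast
  then have fin: "finite {m. kill_below r f m \<noteq> 0}" if "finite {m. f m \<noteq> 0}"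
    using that finite_subset by blast
  have supp: "\<forall>m. kill_below r f m \<noteq> 0 \<longrightarrow> set_mset m \<subseteq> {1..n}"
    using carrier_supp[OF S f] nz by blast
  from S show ?thesis
  proof
    assume "S = power_series_ring n"
    with supp show ?thesis by (simp only: carrier_power_series_ring)
  next
    assume "S = polynomial_ring n"
    with supp fin f show ?thesis by (simp only: carrier_polynomial_ring simp_thms)
  qed
qed

lemma dd_closed:
  assumes S: "S = power_series_ring n \<or> S = polynomial_ring n" and f: "f \<in> carrier S"
  shows "dd r f \<in> carrier S"
proof -
  have nz: "f (add_mset r m) \<noteq> 0" if "dd r f m \<noteq> 0" for m
    using that by (auto simp: dd_def div_var_def kill_below_def split: if_splits)
  have "finite {m. dd r f m \<noteq> 0}" if "finite {m. f m \<noteq> 0}"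
  proof (rule finite_subset)
    show "{m. dd r f m \<noteq> 0} \<subseteq> add_mset r -` {m. f m \<noteq> 0}" using nz by auto
    show "finite (add_mset r -` {m. f m \<noteq> 0})"
      by (rule finite_vimageI[OF that]) (simp add: inj_on_def)
  qed
  moreover have "set_mset m \<subseteq> {1..n}"
    if "\<forall>m. f m \<noteq> 0 \<longrightarrow> set_mset m \<subseteq> {1..n}" "dd r f m \<noteq> 0" for m
    using that(1)[rule_format, OF nz[OF that(2)]] by simp
  ultimately show ?thesis
    using S f by (auto simp: carrier_power_series_ring carrier_polynomial_ring)
qed

lemma var_closed:
  assumes "S = power_series_ring n \<or> S = polynomial_ring n" and "i \<in> {1..n}"
  shows "var i \<in> carrier S"
  using assms by (auto simp: var_def carrier_power_series_ring carrier_polynomial_ring)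

text \<open>
  By \<open>d_ideal_genideal\<close> below, \<open>d_ideal S n \<sigma> F\<close> only depends on the ideal generated by \<open>F\<close>
  (for \<open>F \<subseteq> (x\<^sub>1, \<dots>, x\<^sub>n)\<close>), so that \<open>d_ideal S n \<sigma> I\<close> is the ideal \<open>d\<^sub>\<sigma>(I)\<close>
  computed from any set of generators of \<open>I\<close>.
\<close>

definition d_ideal ::
    "(nat multiset \<Rightarrow> 'k::field) ring \<Rightarrow> nat \<Rightarrow> (nat \<Rightarrow> nat) \<Rightarrow> (nat multiset \<Rightarrow> 'k) set
      \<Rightarrow> (nat multiset \<Rightarrow> 'k) set"
  where "d_ideal S n \<sigma> F = Idl\<^bsub>S\<^esub> {dd_perm \<sigma> i f | i f. i \<in> {1..n} \<and> f \<in> F}"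

theorem d_ideal_genideal:
  fixes S :: "(nat multiset \<Rightarrow> 'a::field) ring"
  assumes S: "S = power_series_ring n \<or> S = polynomial_ring n"
    and \<sigma>: "\<sigma> permutes {1..n}"
    and F: "F \<subseteq> carrier S" "\<And>f. f \<in> F \<Longrightarrow> f {#} = 0"
  shows "d_ideal S n \<sigma> (Idl\<^bsub>S\<^esub> F) = d_ideal S n \<sigma> F"
proof -
  interpret cring S
    using S cring_power_series_ring cring_polynomial_ring by blast
  have S_simps [simp]: "mult S = mps_mult" "zero S = const 0" "add S = (\<lambda>f g m. f m + g m)"
    using S by auto
  define D where "D = d_ideal S n \<sigma> F"
  have \<sigma>': "inv_into UNIV \<sigma> permutes {1..n}" using permutes_inv[OF \<sigma>] .
  have bij: "bij \<sigma>" "bij (inv_into UNIV \<sigma>)" using \<sigma> \<sigma>' permutes_bij by blast+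
  have closed: "dd_perm \<sigma> i f \<in> carrier S" if "f \<in> carrier S" for i f
    using that act_closed[OF S \<sigma>] act_closed[OF S \<sigma>'] dd_closed[OF S] by (simp add: dd_perm_def)
  have gen: "{dd_perm \<sigma> i f | i f. i \<in> {1..n} \<and> f \<in> F} \<subseteq> carrier S"
    using F closed by auto
  have idD: "ideal D S" unfolding D_def d_ideal_def by (rule genideal_ideal[OF gen])
  interpret D: ideal D S by (rule idD)
  have D_add: "(\<lambda>m. a m + b m) \<in> D" if "a \<in> D" "b \<in> D" for a b
    using D.a_closed[OF that] by simp
  have D_mult: "mps_mult a b \<in> D" if "a \<in> carrier S" "b \<in> D" for a b
    using D.I_l_closed[OF that(2,1)] by simp
  have D_zero: "const 0 \<in> D" using D.zero_closed by simp
  define T where "T = {f \<in> carrier S. f {#} = 0 \<and> (\<forall>i\<in>{1..n}. dd_perm \<sigma> i f \<in> D)}"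
  have FT: "F \<subseteq> T"
    unfolding T_def D_def d_ideal_def using F genideal_self[OF gen] by blast
  have kill: "act \<sigma> (kill_below r (act (inv_into UNIV \<sigma>) g)) \<in> D"
    if g: "g \<in> T" and r: "r \<le> Suc n" "1 \<le> r" for g r
    using r
  proof (induction r rule: inc_induct)
    case base
    let ?g = "act (inv_into UNIV \<sigma>) g"
    have "?g \<in> carrier S" using g act_closed[OF S \<sigma>'] by (simp add: T_def)
    then have supp: "set_mset m \<subseteq> {1..n}" if "?g m \<noteq> 0" for m
      using carrier_supp[OF S] that by blast
    have "kill_below (Suc n) ?g m = 0" for m
    proof (rule ccontr)
      assume "kill_below (Suc n) ?g m \<noteq> 0"
      then have m: "set_mset m \<subseteq> {Suc n..}" "?g m \<noteq> 0"
        by (auto simp: kill_below_def split: if_splits)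
      with supp[OF m(2)] have "set_mset m = {}" by fastforce
      with m(2) g show False by (simp add: T_def act_def)
    qed
    then have "act \<sigma> (kill_below (Suc n) ?g) = const 0" by (auto simp: act_def const_def)
    with D_zero show ?case by simp
  next
    case (step r)
    let ?g = "act (inv_into UNIV \<sigma>) g"
    have "kill_below r ?g = (\<lambda>m. mps_mult (var r) (dd r ?g) m + kill_below (Suc r) ?g m)"
      by (simp add: var_mult_dd)
    then have "act \<sigma> (kill_below r ?g) =
        (\<lambda>m. act \<sigma> (mps_mult (var r) (dd r ?g)) m + act \<sigma> (kill_below (Suc r) ?g) m)"
      by (simp add: act_def)
    also have "\<dots> = (\<lambda>m. mps_mult (var (\<sigma> r)) (dd_perm \<sigma> r g) m + act \<sigma> (kill_below (Suc r) ?g) m)"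
      by (simp add: act_mult act_var bij dd_perm_def)
    finally have eq: "act \<sigma> (kill_below r ?g) =
        (\<lambda>m. mps_mult (var (\<sigma> r)) (dd_perm \<sigma> r g) m + act \<sigma> (kill_below (Suc r) ?g) m)" .
    have r: "r \<in> {1..n}" using step by auto
    then have "\<sigma> r \<in> {1..n}" using permutes_in_image[OF \<sigma>] by blast
    then have "mps_mult (var (\<sigma> r)) (dd_perm \<sigma> r g) \<in> D"
      using g r by (intro D_mult var_closed[OF S]) (auto simp: T_def)
    moreover have "act \<sigma> (kill_below (Suc r) ?g) \<in> D" using step by simp
    ultimately show ?case unfolding eq by (rule D_add)
  qed
  have T_mult: "mps_mult f g \<in> T" if f: "f \<in> carrier S" and g: "g \<in> T" for f g
  proof -
    let ?f = "act (inv_into UNIV \<sigma>) f" and ?g = "act (inv_into UNIV \<sigma>) g"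
    have f': "?f \<in> carrier S" using f act_closed[OF S \<sigma>'] by blast
    have gS: "g \<in> carrier S" "g {#} = 0" using g by (auto simp: T_def)
    have "dd_perm \<sigma> i (mps_mult f g) \<in> D" if i: "i \<in> {1..n}" for i
    proof -
      have "dd_perm \<sigma> i (mps_mult f g) = act \<sigma> (\<lambda>m. mps_mult (kill_below i ?f) (dd i ?g) m
            + mps_mult (dd i ?f) (kill_below (Suc i) ?g) m)"
        by (simp add: dd_perm_def act_mult bij dd_mult)
      also have "\<dots> = (\<lambda>m. act \<sigma> (mps_mult (kill_below i ?f) (dd i ?g)) m
            + act \<sigma> (mps_mult (dd i ?f) (kill_below (Suc i) ?g)) m)"
        by (simp add: act_def)
      also have "\<dots> = (\<lambda>m. mps_mult (act \<sigma> (kill_below i ?f)) (dd_perm \<sigma> i g) m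
            + mps_mult (act \<sigma> (dd i ?f)) (act \<sigma> (kill_below (Suc i) ?g)) m)"
        by (simp add: act_mult bij dd_perm_def)
      finally have eq: "dd_perm \<sigma> i (mps_mult f g) = \<dots>" .
      show ?thesis unfolding eq
      proof (intro D_add D_mult)
        show "act \<sigma> (kill_below (Suc i) ?g) \<in> D" using kill[OF g, of "Suc i"] i by simp
        show "dd_perm \<sigma> i g \<in> D" using g i by (simp add: T_def)
      qed (use f' act_closed[OF S \<sigma>] kill_below_closed[OF S] dd_closed[OF S] in auto)
    qed
    moreover have "mps_mult f g {#} = 0" using gS by (simp add: mps_mult_def)
    moreover have "mps_mult f g \<in> carrier S" using m_closed[OF f gS(1)] by simp
    ultimately show ?thesis by (simp add: T_def)
  qed
  have T_add: "(\<lambda>m. f m + g m) \<in> T" if f: "f \<in> T" and g: "g \<in> T" for f g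
  proof -
    have fg: "f \<in> carrier S" "g \<in> carrier S" using f g by (auto simp: T_def)
    have "dd_perm \<sigma> i (\<lambda>m. f m + g m) = (\<lambda>m. dd_perm \<sigma> i f m + dd_perm \<sigma> i g m)" for i
      by (auto simp: dd_perm_def act_def dd_def div_var_def kill_below_def)
    then show ?thesis
      using f g D_add a_closed[OF fg] by (simp add: T_def)
  qed
  have T_zero: "const 0 \<in> T"
  proof -
    have z: "dd_perm \<sigma> i (const 0) = const 0" for i
      by (auto simp: dd_perm_def act_def dd_def div_var_def kill_below_def const_def)
    have "const 0 \<in> carrier S" using zero_closed by simp
    moreover have "const 0 {#} = (0 :: 'a)" by (simp add: const_def)
    ultimately show ?thesis using D_zero by (simp add: T_def z)
  qed
  have "ideal T S"
  proof (rule idealI)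
    show "ring S" by (rule ring_axioms)
    show "subgroup T (add_monoid S)"
    proof (rule add.subgroupI)
      show "T \<subseteq> carrier S" by (auto simp: T_def)
      show "T \<noteq> {}" using T_zero by blast
      fix f g assume f: "f \<in> T"
      then have "f \<in> carrier S" by (simp add: T_def)
      then have "\<ominus>\<^bsub>S\<^esub> f = (\<ominus>\<^bsub>S\<^esub> \<one>\<^bsub>S\<^esub>) \<otimes>\<^bsub>S\<^esub> f" using l_minus[of "\<one>\<^bsub>S\<^esub>" f] by (simp del: S_simps)
      then show "\<ominus>\<^bsub>S\<^esub> f \<in> T" using T_mult[OF _ f, of "\<ominus>\<^bsub>S\<^esub> \<one>\<^bsub>S\<^esub>"] by simp
      assume "g \<in> T"
      with f show "f \<oplus>\<^bsub>S\<^esub> g \<in> T" using T_add by simp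
    qed
    fix f g assume "f \<in> T" "g \<in> carrier S"
    then show "g \<otimes>\<^bsub>S\<^esub> f \<in> T" "f \<otimes>\<^bsub>S\<^esub> g \<in> T"
      using T_mult by (simp_all add: mps_mult_commute[of f])
  qed
  then have IT: "Idl\<^bsub>S\<^esub> F \<subseteq> T" using FT by (rule genideal_minimal)
  show ?thesis
  proof
    have "{dd_perm \<sigma> i f | i f. i \<in> {1..n} \<and> f \<in> Idl\<^bsub>S\<^esub> F} \<subseteq> D"
      using IT by (auto simp: T_def)
    then show "d_ideal S n \<sigma> (Idl\<^bsub>S\<^esub> F) \<subseteq> d_ideal S n \<sigma> F"
      unfolding D_def[symmetric] d_ideal_def[of S n \<sigma> "Idl\<^bsub>S\<^esub> F"]
      by (rule genideal_minimal[OF idD])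
    have "{dd_perm \<sigma> i f | i f. i \<in> {1..n} \<and> f \<in> F}
        \<subseteq> {dd_perm \<sigma> i f | i f. i \<in> {1..n} \<and> f \<in> Idl\<^bsub>S\<^esub> F}"
      using genideal_self[OF F(1)] by blast
    moreover have I': "Idl\<^bsub>S\<^esub> F \<subseteq> carrier S"
      using IT by (auto simp: T_def)
    then have gen': "{dd_perm \<sigma> i f | i f. i \<in> {1..n} \<and> f \<in> Idl\<^bsub>S\<^esub> F} \<subseteq> carrier S"
      using closed by auto
    ultimately show "d_ideal S n \<sigma> F \<subseteq> d_ideal S n \<sigma> (Idl\<^bsub>S\<^esub> F)"
      unfolding d_ideal_def
      by (intro genideal_minimal genideal_ideal[OF gen'] subset_trans[OF _ genideal_self[OF gen']])
  qed
qed


section \<open>Tor and Poincar\'e series\<close>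

text \<open>The direct power \<open>M\<^sup>b\<close>; the multiplicative fields of a module record are irrelevant.\<close>

definition power_module :: "('r, 'm) module \<Rightarrow> nat \<Rightarrow> ('r, nat \<Rightarrow> 'm) module"
  where "power_module M b =
    \<lparr>carrier = {..<b} \<rightarrow>\<^sub>E carrier M, mult = undefined, one = undefined,
     zero = (\<lambda>i\<in>{..<b}. \<zero>\<^bsub>M\<^esub>), add = (\<lambda>u v. \<lambda>i\<in>{..<b}. u i \<oplus>\<^bsub>M\<^esub> v i),
     smult = (\<lambda>r v. \<lambda>i\<in>{..<b}. r \<odot>\<^bsub>M\<^esub> v i)\<rparr>"

definition quot_module :: "('r, 'm) module \<Rightarrow> 'm set \<Rightarrow> ('r, 'm set) module"
  where "quot_module M U =
    \<lparr>carrier = a_rcosets\<^bsub>M\<^esub> U, mult = undefined, one = undefined,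
     zero = U, add = set_add M, smult = (\<lambda>r X. \<Union>x\<in>X. U +>\<^bsub>M\<^esub> (r \<odot>\<^bsub>M\<^esub> x))\<rparr>"

text \<open>The ring \<open>A\<close> as a module along a ring homomorphism \<open>\<phi>\<close> into \<open>A\<close>.\<close>

definition ring_module :: "('r \<Rightarrow> 'a) \<Rightarrow> ('a, 'x) ring_scheme \<Rightarrow> ('r, 'a) module"
  where "ring_module \<phi> A =
    \<lparr>carrier = carrier A, mult = mult A, one = one A, zero = zero A, add = add A,
     smult = (\<lambda>r a. \<phi> r \<otimes>\<^bsub>A\<^esub> a)\<rparr>"

definition restrict_scalars :: "('k \<Rightarrow> 'r) \<Rightarrow> ('r, 'm) module \<Rightarrow> ('k, 'm) module"
  where "restrict_scalars \<iota> M =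
    \<lparr>carrier = carrier M, mult = mult M, one = one M, zero = zero M, add = add M,
     smult = (\<lambda>c x. \<iota> c \<odot>\<^bsub>M\<^esub> x)\<rparr>"

text \<open>
  The map \<open>N\<^sup>q \<rightarrow> N\<^sup>p\<close> given by a \<open>p \<times> q\<close> matrix over the base ring \<open>R\<close>.  Under the identification
  \<open>R\<^sup>b \<otimes> N = N\<^sup>b\<close>, it is the tensor product with \<open>N\<close> of the map \<open>R\<^sup>q \<rightarrow> R\<^sup>p\<close> given by the same matrix.
\<close>

definition mat_map ::
    "('r, 'm) module \<Rightarrow> nat \<Rightarrow> nat \<Rightarrow> (nat \<Rightarrow> nat \<Rightarrow> 'r) \<Rightarrow> (nat \<Rightarrow> 'm) \<Rightarrow> nat \<Rightarrow> 'm"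
  where "mat_map N p q A v = (\<lambda>i\<in>{..<p}. \<Oplus>\<^bsub>N\<^esub>j\<in>{..<q}. A i j \<odot>\<^bsub>N\<^esub> v j)"

definition mat_image :: "('r, 'm) module \<Rightarrow> nat \<Rightarrow> nat \<Rightarrow> (nat \<Rightarrow> nat \<Rightarrow> 'r) \<Rightarrow> (nat \<Rightarrow> 'm) set"
  where "mat_image N p q A = mat_map N p q A ` carrier (power_module N q)"

definition mat_kernel :: "('r, 'm) module \<Rightarrow> nat \<Rightarrow> nat \<Rightarrow> (nat \<Rightarrow> nat \<Rightarrow> 'r) \<Rightarrow> (nat \<Rightarrow> 'm) set"
  where "mat_kernel N p q A =
    {v \<in> carrier (power_module N q). mat_map N p q A v = \<zero>\<^bsub>power_module N p\<^esub>}"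

text \<open>
  A resolution of \<open>M\<close> by free \<open>R\<close>-modules of finite rank (every finitely generated module over a
  noetherian ring has one)
  \<open>\<dots> \<rightarrow> R\<^bsup>b 2\<^esup> \<rightarrow> R\<^bsup>b 1\<^esup> \<rightarrow> R\<^bsup>b 0\<^esup> \<rightarrow> M \<rightarrow> 0\<close>:
  the differential \<open>R\<^bsup>b (i+1)\<^esup> \<rightarrow> R\<^bsup>b i\<^esup>\<close> has the matrix \<open>d i\<close>, and the
  augmentation sends the \<open>j\<close>-th unit vector to \<open>g j\<close>.
\<close>

definition free_resolution ::
    "('r, 'x) ring_scheme \<Rightarrow> ('r, 'm) module
      \<Rightarrow> (nat \<Rightarrow> nat) \<times> (nat \<Rightarrow> nat \<Rightarrow> nat \<Rightarrow> 'r) \<times> (nat \<Rightarrow> 'm) \<Rightarrow> bool"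
  where "free_resolution R M = (\<lambda>(b, d, g).
    let F = ring_module (\<lambda>r. r) R;
        aug = (\<lambda>v. \<Oplus>\<^bsub>M\<^esub>j\<in>{..<b 0}. v j \<odot>\<^bsub>M\<^esub> g j)
    in (\<forall>i. \<forall>p<b i. \<forall>q<b (Suc i). d i p q \<in> carrier R) \<and>
       (\<forall>j<b 0. g j \<in> carrier M) \<and>
       aug ` carrier (power_module F (b 0)) = carrier M \<and>
       mat_image F (b 0) (b 1) (d 0) = {v \<in> carrier (power_module F (b 0)). aug v = \<zero>\<^bsub>M\<^esub>} \<and>
       (\<forall>i. mat_image F (b (Suc i)) (b (Suc (Suc i))) (d (Suc i))
            = mat_kernel F (b i) (b (Suc i)) (d i)))"

text \<open>
  \<open>Tor\<^sup>R\<^sub>i(M, N)\<close>: the homology in degree \<open>i\<close> of \<open>F \<otimes> N\<close>, for a free resolution \<open>F\<close> of \<open>M\<close>;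
  its isomorphism class is independent of the chosen resolution.
\<close>

definition tor ::
    "('r, 'x) ring_scheme \<Rightarrow> ('r, 'm) module \<Rightarrow> ('r, 'n) module \<Rightarrow> nat \<Rightarrow> ('r, (nat \<Rightarrow> 'n) set) module"
  where "tor R M N i =
    (let (b, d, g) = (SOME F. free_resolution R M F);
         Z = (case i of 0 \<Rightarrow> carrier (power_module N (b 0))
              | Suc j \<Rightarrow> mat_kernel N (b j) (b (Suc j)) (d j));
         B = mat_image N (b i) (b (Suc i)) (d i)
     in quot_module ((power_module N (b i))\<lparr>carrier := Z\<rparr>) B)"

text \<open>
  The series \<open>\<Sum>\<^sub>i dim\<^sub>K Tor\<^sup>R\<^sub>i(M, N) t\<^sup>i\<close>, for a \<open>K\<close>-algebra \<open>R\<close> with structure map \<open>\<iota>\<close>.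
\<close>

definition poincare_series ::
    "('k::field \<Rightarrow> 'r) \<Rightarrow> ('r, 'x) ring_scheme \<Rightarrow> ('r, 'm) module \<Rightarrow> ('r, 'n) module \<Rightarrow> rat fps"
  where "poincare_series \<iota> R M N =
    Abs_fps (\<lambda>i. of_nat (vectorspace.dim class_ring (restrict_scalars \<iota> (tor R M N i))))"


section \<open>Golod ideals\<close>

text \<open>
  \<open>K\<close> is an \<open>S\<close>-module through \<open>f \<mapsto> f(0)\<close>, and, for \<open>I \<subseteq> (x\<^sub>1, \<dots>, x\<^sub>n)\<close>, an \<open>S/I\<close>-module
  through the value at \<open>0\<close> common to all representatives of a coset.
\<close>

definition residue_module :: "(nat multiset \<Rightarrow> 'k::field, 'k) module"
  where "residue_module = ring_module (\<lambda>f. f {#}) class_ring"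

definition residue_module_quot :: "((nat multiset \<Rightarrow> 'k::field) set, 'k) module"
  where "residue_module_quot = ring_module (\<lambda>X. the_elem ((\<lambda>f. f {#}) ` X)) class_ring"

definition golod_ideal ::
    "nat \<Rightarrow> (nat multiset \<Rightarrow> 'k::field) ring \<Rightarrow> (nat multiset \<Rightarrow> 'k) set \<Rightarrow> bool"
  where "golod_ideal n S I \<longleftrightarrow>
    (let R = S Quot I;
         PRK = poincare_series (\<lambda>c. I +>\<^bsub>S\<^esub> const c) R residue_module_quot residue_module_quot;
         PSR = poincare_series const S residue_module (ring_module (\<lambda>f. I +>\<^bsub>S\<^esub> f) R)
     in PRK = (1 + fps_X) ^ n / (1 - fps_X * (PSR - 1)))"

end

(*
  Let K be the Koszul complex on x_1, ..., x_n over S.  With y_r = x_{sigma(r)}, the formula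
  h(f e_M) = sum_{r < min M} d^r_sigma(f) e_r e_M defines a contracting homotopy of K.  If z is a
  cycle of positive degree modulo I, then z = bd (h z) + h (bd z) and bd z has coefficients in I, so
  z is homologous to the cycle h (bd z) with coefficients in J = d_sigma(I).  Hence the homology of
  K (x) R has a basis of cycles with coefficients in J, and since J^2 <= I all their products
  vanish in K (x) R.  With V the graded span of the basis, shifted by one, the tensor product of
  the tensor algebra T(V) and K (x) R therefore becomes a minimal free resolution of the residue
  field over R with the differential
  d(w v (x) a) = +- w v (x) bd a + w (x) z_v a,
  and counting ranks gives the Golod identity.  That J lies in the maximal ideal (so that the
  resolution is minimal) follows from J^2 <= I.
*)
theory Submission
  imports Defs "HOL-Library.Multiset_Order"
begin

section \<open>Resolutions modulo an ideal and the comparison theorem\<close>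

text \<open>Golodness in general asks for a trivial Massey operation, a coherent family of chains
  for all iterated products of cycles. Here every product of two chosen representatives already lies
  in \<open>I\<close> entrywise, so all higher operations can be taken to be zero, and the square of
  the word differential involves pairwise products only.

  Three obstacles shape the rest. \<open>tor\<close> evaluates whatever finite free resolution
  \<open>SOME\<close> returns, so explicit resolutions count only through a comparison theorem with
  coefficients in a quotient \<open>C/Q\<close>. Finite ranks need finite bases of Koszul homology,
  hence Hilbert's basis theorem for both kinds of \<open>S\<close>; combinations over
  \<open>C\<close> become combinations over the field because each variable annihilates that
  homology. And cosets are awkward to compute with: the homological algebra uses entries in a ring
  \<open>C\<close> of representatives, congruent modulo an ideal, and passes to cosets only at the
  end.

  The locale \<open>golod\<close> serves twice: with \<open>I = J = {0}\<close> and no letters it is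
  the Koszul resolution over \<open>S\<close>, which yields the denominator; with the actual data it
  is the resolution over \<open>R\<close>.\<close>

definition mv :: "'x set \<Rightarrow> ('y \<Rightarrow> 'x \<Rightarrow> 'a::comm_ring_1) \<Rightarrow> ('x \<Rightarrow> 'a) \<Rightarrow> 'y \<Rightarrow> 'a"
  where "mv X A v = (\<lambda>y. \<Sum>x\<in>X. A y x * v x)"

lemma mv_add: "mv X A (\<lambda>x. v x + w x) = (\<lambda>y. mv X A v y + mv X A w y)"
  by (simp add: mv_def distrib_left sum.distrib)

lemma mv_diff: "mv X A (\<lambda>x. v x - w x) = (\<lambda>y. mv X A v y - mv X A w y)"
  by (simp add: mv_def right_diff_distrib sum_subtractf)

lemma mv_minus: "mv X A (\<lambda>x. - v x) = (\<lambda>y. - mv X A v y)"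
  by (simp add: mv_def sum_negf)

lemma mv_sum: "mv X A (\<lambda>x. \<Sum>k\<in>V. c k * z k x) = (\<lambda>y. \<Sum>k\<in>V. c k * mv X A (z k) y)"
  by (rule ext) (simp add: mv_def sum_distrib_left mult.left_commute sum.swap[of _ V])

lemma mv_mv: "mv Y A (mv X B v) = mv X (\<lambda>z x. mv Y A (\<lambda>y. B y x) z) v"
  by (rule ext) (simp add: mv_def sum_distrib_left sum_distrib_right mult.assoc sum.swap[of _ X Y])

lemma mv_unit: "finite X \<Longrightarrow> x \<in> X \<Longrightarrow> mv X A (\<lambda>x'. if x' = x then 1 else 0) = (\<lambda>y. A y x)"
  by (simp add: mv_def if_distrib cong: if_cong)

text \<open>The ring is a subset \<open>C\<close> of a ring type because power series and
  polynomials will be two carriers inside one type. \<open>cst\<close> embeds the field, and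
  \<open>ev\<close> is the augmentation that makes the field a module over \<open>C\<close>.\<close>

locale augmented_subring =
  fixes C :: "'a::comm_ring_1 set" and cst :: "'k::field \<Rightarrow> 'a" and ev :: "'a \<Rightarrow> 'k"
  assumes one_C: "1 \<in> C"
    and add_C: "a \<in> C \<Longrightarrow> b \<in> C \<Longrightarrow> a + b \<in> C"
    and uminus_C: "a \<in> C \<Longrightarrow> - a \<in> C"
    and mult_C: "a \<in> C \<Longrightarrow> b \<in> C \<Longrightarrow> a * b \<in> C"
    and cst_C: "cst c \<in> C"
    and cst_add: "cst (c + d) = cst c + cst d"
    and cst_mult: "cst (c * d) = cst c * cst d"
    and cst_one: "cst 1 = 1"
    and ev_add: "a \<in> C \<Longrightarrow> b \<in> C \<Longrightarrow> ev (a + b) = ev a + ev b"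
    and ev_mult: "a \<in> C \<Longrightarrow> b \<in> C \<Longrightarrow> ev (a * b) = ev a * ev b"
    and ev_cst: "ev (cst c) = c"
begin

lemma zero_C: "0 \<in> C"
  using add_C[OF one_C uminus_C[OF one_C]] by simp

lemma diff_C: "a \<in> C \<Longrightarrow> b \<in> C \<Longrightarrow> a - b \<in> C"
  using add_C[of a "- b"] uminus_C by simp

lemma sum_C: "(\<And>x. x \<in> X \<Longrightarrow> f x \<in> C) \<Longrightarrow> sum f X \<in> C"
  by (induction X rule: infinite_finite_induct) (auto simp: zero_C add_C)

lemma power_C: "a \<in> C \<Longrightarrow> a ^ k \<in> C"
  by (induction k) (auto simp: one_C mult_C)

lemma cst_zero: "cst 0 = 0"
  using cst_add[of 0 0] by simp

lemma cst_minus: "cst (- c) = - cst c"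
  using cst_add[of c "- c"] by (simp add: cst_zero eq_neg_iff_add_eq_0 add.commute)

lemma ev_zero: "ev 0 = 0"
  using ev_cst[of 0] by (simp add: cst_zero)

lemma ev_one: "ev 1 = 1"
  using ev_cst[of 1] by (simp add: cst_one)

lemma ev_minus: "a \<in> C \<Longrightarrow> ev (- a) = - ev a"
  using ev_add[of a "- a"] by (simp add: uminus_C ev_zero eq_neg_iff_add_eq_0 add.commute)

lemma ev_diff: "a \<in> C \<Longrightarrow> b \<in> C \<Longrightarrow> ev (a - b) = ev a - ev b"
  using ev_add[of a "- b"] by (simp add: uminus_C ev_minus)

lemma ev_sum: "(\<And>x. x \<in> X \<Longrightarrow> f x \<in> C) \<Longrightarrow> ev (sum f X) = (\<Sum>x\<in>X. ev (f x))"
  by (induction X rule: infinite_finite_induct) (auto simp: ev_zero ev_add sum_C)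

lemmas C_intros = zero_C one_C add_C uminus_C mult_C diff_C sum_C power_C cst_C

text \<open>The last clause restricts to ideals inside the augmentation ideal, so that
  \<open>ev\<close> is well defined modulo \<open>I\<close> and congruent vectors have the same
  augmentation.\<close>

definition idl :: "'a set \<Rightarrow> bool"
  where "idl I \<longleftrightarrow> I \<subseteq> C \<and> 0 \<in> I \<and> (\<forall>a\<in>I. \<forall>b\<in>I. a + b \<in> I) \<and> (\<forall>c\<in>C. \<forall>a\<in>I. c * a \<in> I) \<and> (\<forall>a\<in>I. ev a = 0)"

definition vc :: "('x \<Rightarrow> 'a) \<Rightarrow> bool"
  where "vc v \<longleftrightarrow> (\<forall>x. v x \<in> C)"

definition mc :: "('y \<Rightarrow> 'x \<Rightarrow> 'a) \<Rightarrow> bool"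
  where "mc A \<longleftrightarrow> (\<forall>y x. A y x \<in> C)"

definition eqm :: "'a set \<Rightarrow> 'x set \<Rightarrow> ('x \<Rightarrow> 'a) \<Rightarrow> ('x \<Rightarrow> 'a) \<Rightarrow> bool"
  where "eqm I X u v \<longleftrightarrow> (\<forall>x\<in>X. u x - v x \<in> I)"

lemma idlD:
  assumes "idl I"
  shows "a \<in> I \<Longrightarrow> a \<in> C" "0 \<in> I" "a \<in> I \<Longrightarrow> b \<in> I \<Longrightarrow> a + b \<in> I"
    "c \<in> C \<Longrightarrow> a \<in> I \<Longrightarrow> c * a \<in> I" "a \<in> I \<Longrightarrow> ev a = 0"
    "a \<in> I \<Longrightarrow> - a \<in> I" "a \<in> I \<Longrightarrow> b \<in> I \<Longrightarrow> a - b \<in> I"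
proof -
  show *: "- a \<in> I" if "a \<in> I" for a
    using assms that uminus_C[OF one_C] mult_minus1[of a] unfolding idl_def by metis
  show "a - b \<in> I" if "a \<in> I" "b \<in> I"
    using assms that *[of b] unfolding idl_def by (metis diff_conv_add_uminus)
qed (use assms in \<open>auto simp: idl_def\<close>)

lemma idl_sum: "idl I \<Longrightarrow> (\<And>x. x \<in> X \<Longrightarrow> f x \<in> I) \<Longrightarrow> sum f X \<in> I"
  by (induction X rule: infinite_finite_induct) (auto simp: idlD)

lemma idl_mono_in: "idl I \<Longrightarrow> a - b \<in> I \<Longrightarrow> b \<in> I \<Longrightarrow> a \<in> I"
  using idlD(3)[of I "a - b" b] by simp

lemma idl_zero: "idl {0}"
  by (simp add: idl_def zero_C ev_zero)

lemma idl_kernel: "idl {a \<in> C. ev a = 0}"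
  by (auto simp: idl_def C_intros ev_zero ev_add ev_mult)

lemma vc_mv: "mc A \<Longrightarrow> vc v \<Longrightarrow> vc (mv X A v)"
  by (simp add: mc_def vc_def mv_def C_intros)

lemma vc_add: "vc v \<Longrightarrow> vc w \<Longrightarrow> vc (\<lambda>x. v x + w x)"
  and vc_diff: "vc v \<Longrightarrow> vc w \<Longrightarrow> vc (\<lambda>x. v x - w x)"
  and vc_minus: "vc v \<Longrightarrow> vc (\<lambda>x. - v x)"
  and vc_cst_sum: "(\<And>k. k \<in> V \<Longrightarrow> vc (z k)) \<Longrightarrow> vc (\<lambda>x. \<Sum>k\<in>V. cst (c k) * z k x)"
  and vc_unit: "vc (\<lambda>x. if x = x0 then 1 else 0)"
  and vc_col: "mc A \<Longrightarrow> vc (\<lambda>y. A y x)"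
  by (auto simp: vc_def mc_def C_intros)

lemma mc_mm: "mc A \<Longrightarrow> mc B \<Longrightarrow> mc (\<lambda>z x. mv Y A (\<lambda>y. B y x) z)"
  by (simp add: mc_def mv_def C_intros)

lemma eqm_refl: "idl I \<Longrightarrow> eqm I X v v"
  by (simp add: eqm_def idlD)

lemma eqm_sym: "idl I \<Longrightarrow> eqm I X u v \<Longrightarrow> eqm I X v u"
  unfolding eqm_def using idlD(6) by fastforce

lemma eqm_trans: "idl I \<Longrightarrow> eqm I X u v \<Longrightarrow> eqm I X v w \<Longrightarrow> eqm I X u w"
  unfolding eqm_def using idlD(3) by fastforce

lemma eqm_add: "idl I \<Longrightarrow> eqm I X u v \<Longrightarrow> eqm I X u' v' \<Longrightarrow> eqm I X (\<lambda>x. u x + u' x) (\<lambda>x. v x + v' x)"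
  unfolding eqm_def 
proof
  fix x assume "idl I" "\<forall>x\<in>X. u x - v x \<in> I" "\<forall>x\<in>X. u' x - v' x \<in> I" "x \<in> X"
  then have "(u x - v x) + (u' x - v' x) \<in> I" by (simp add: idlD)
  then show "u x + u' x - (v x + v' x) \<in> I" by (simp add: algebra_simps)
qed

lemma eqm_diff: "idl I \<Longrightarrow> eqm I X u v \<Longrightarrow> eqm I X u' v' \<Longrightarrow> eqm I X (\<lambda>x. u x - u' x) (\<lambda>x. v x - v' x)"
  unfolding eqm_def
proof
  fix x assume "idl I" "\<forall>x\<in>X. u x - v x \<in> I" "\<forall>x\<in>X. u' x - v' x \<in> I" "x \<in> X"
  then have "(u x - v x) - (u' x - v' x) \<in> I" by (simp add: idlD)
  then show "u x - u' x - (v x - v' x) \<in> I" by (simp add: algebra_simps)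
qed

lemma eqm_subset: "I \<subseteq> Q \<Longrightarrow> eqm I X u v \<Longrightarrow> eqm Q X u v"
  by (auto simp: eqm_def)

lemma eqm_mv: "idl I \<Longrightarrow> mc A \<Longrightarrow> eqm I X u v \<Longrightarrow> eqm I Y (mv X A u) (mv X A v)"
  unfolding eqm_def mv_def mc_def sum_subtractf[symmetric] right_diff_distrib[symmetric]
  by (auto intro!: idl_sum idlD(4))

lemma eqm_mem: "idl I \<Longrightarrow> eqm I X u v \<Longrightarrow> (\<forall>x\<in>X. u x \<in> I) \<longleftrightarrow> (\<forall>x\<in>X. v x \<in> I)"
  unfolding eqm_def by (metis idl_mono_in idlD(6) minus_diff_eq)

text \<open>Projectivity of free modules in coordinates: lifts of the columns, collected in
  \<open>W\<close>, lift every vector by linearity. For indices outside \<open>X\<close> any vector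
  over \<open>C\<close> will do, and zero shows that there is one.\<close>

lemma factor_matrix:
  fixes X :: "'x set" and Y :: "'y set" and Z :: "'z set"
  assumes I: "idl I" and B: "mc B" and A: "mc A"
    and col: "\<And>x. x \<in> X \<Longrightarrow> \<exists>w. vc w \<and> eqm I Z (\<lambda>z. B z x) (mv Y A w)"
  obtains W where "mc W" "\<And>v. vc v \<Longrightarrow> eqm I Z (mv X B v) (mv Y A (mv X W v))"
proof -
  have "\<exists>w. vc w \<and> (x \<in> X \<longrightarrow> eqm I Z (\<lambda>z. B z x) (mv Y A w))" for x
  proof (cases "x \<in> X")
    case False
    have "vc (\<lambda>_. 0 :: 'a)" by (simp add: vc_def zero_C)
    with False show ?thesis by blast
  qed (use col in blast)
  then obtain w where w: "\<And>x. vc (w x)" "\<And>x. x \<in> X \<Longrightarrow> eqm I Z (\<lambda>z. B z x) (mv Y A (w x))"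
    by metis
  show ?thesis
  proof
    show "mc (\<lambda>y x. w x y)" using w(1) by (simp add: mc_def vc_def)
    fix v :: "'x \<Rightarrow> 'a" assume v: "vc v"
    have "mv X B v z - mv Y A (mv X (\<lambda>y x. w x y) v) z = (\<Sum>x\<in>X. v x * (B z x - mv Y A (w x) z))" for z
    proof -
      have "mv X B v z - mv X (\<lambda>z x. mv Y A (w x) z) v z = (\<Sum>x\<in>X. v x * (B z x - mv Y A (w x) z))"
        by (simp add: mv_def[of X] sum_subtractf[symmetric] algebra_simps)
      then show ?thesis by (simp add: mv_mv)
    qed
    then show "eqm I Z (mv X B v) (mv Y A (mv X (\<lambda>y x. w x y) v))"
      using w(2) v unfolding eqm_def vc_def by (auto intro!: idl_sum[OF I] idlD(4)[OF I])
  qed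
qed

section \<open>Complexes, resolutions of the residue field, and the comparison theorem\<close>

definition cyc :: "'a set \<Rightarrow> (nat \<Rightarrow> 'x set) \<Rightarrow> (nat \<Rightarrow> 'x \<Rightarrow> 'x \<Rightarrow> 'a) \<Rightarrow> ('x \<Rightarrow> 'k) \<Rightarrow> nat \<Rightarrow> ('x \<Rightarrow> 'a) \<Rightarrow> bool"
  where "cyc I X d g i v = (case i of 0 \<Rightarrow> (\<Sum>x\<in>X 0. ev (v x) * g x) = 0
    | Suc j \<Rightarrow> \<forall>x\<in>X j. mv (X (Suc j)) (d j) v x \<in> I)"

definition cplx :: "'a set \<Rightarrow> (nat \<Rightarrow> 'x set) \<Rightarrow> (nat \<Rightarrow> 'x \<Rightarrow> 'x \<Rightarrow> 'a) \<Rightarrow> ('x \<Rightarrow> 'k) \<Rightarrow> bool"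
  where "cplx I X d g \<longleftrightarrow> (\<forall>i. finite (X i)) \<and> (\<forall>i. mc (d i))
    \<and> (\<forall>i v. vc v \<longrightarrow> cyc I X d g i (mv (X (Suc i)) (d i) v))"

text \<open>A free resolution of the residue field over \<open>C/I\<close>, by representatives.
  \<open>cyc\<close> in degree 0 is the kernel of the augmentation, so exactness reads the same in
  all degrees; hitting \<open>1\<close> is all of surjectivity, since \<open>cst\<close> supplies
  the scalars. Index sets are arbitrary finite sets because the natural bases later are words paired
  with subsets.\<close>

definition res :: "'a set \<Rightarrow> (nat \<Rightarrow> 'x set) \<Rightarrow> (nat \<Rightarrow> 'x \<Rightarrow> 'x \<Rightarrow> 'a) \<Rightarrow> ('x \<Rightarrow> 'k) \<Rightarrow> bool"
  where "res I X d g \<longleftrightarrow> cplx I X d g \<and> (\<exists>v. vc v \<and> (\<Sum>x\<in>X 0. ev (v x) * g x) = 1)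
    \<and> (\<forall>i v. vc v \<longrightarrow> cyc I X d g i v \<longrightarrow> (\<exists>w. vc w \<and> eqm I (X i) v (mv (X (Suc i)) (d i) w)))"

lemma cyc_cong:
  assumes I: "idl I" and e: "eqm I (X i) u v" and d: "\<And>i. mc (d i)" and u: "vc u" "vc v"
  shows "cyc I X d g i u \<longleftrightarrow> cyc I X d g i v"
proof (cases i)
  case 0
  have "ev (u x) = ev (v x)" if "x \<in> X 0" for x
    using e that 0 u idlD(5)[OF I, of "u x - v x"] by (simp add: eqm_def vc_def ev_diff)
  then show ?thesis by (simp add: cyc_def 0)
next
  case (Suc j)
  have "eqm I (X j) (mv (X i) (d j) u) (mv (X i) (d j) v)" using eqm_mv[OF I d e] .
  from eqm_mem[OF I this] show ?thesis by (simp add: cyc_def Suc)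
qed

definition chain_map :: "'a set \<Rightarrow> (nat \<Rightarrow> 'x set) \<Rightarrow> (nat \<Rightarrow> 'x \<Rightarrow> 'x \<Rightarrow> 'a) \<Rightarrow> ('x \<Rightarrow> 'k)
    \<Rightarrow> (nat \<Rightarrow> 'y set) \<Rightarrow> (nat \<Rightarrow> 'y \<Rightarrow> 'y \<Rightarrow> 'a) \<Rightarrow> ('y \<Rightarrow> 'k) \<Rightarrow> (nat \<Rightarrow> 'y \<Rightarrow> 'x \<Rightarrow> 'a) \<Rightarrow> bool"
  where "chain_map I X d g Y e h \<phi> \<longleftrightarrow> (\<forall>i. mc (\<phi> i))
    \<and> (\<forall>v. vc v \<longrightarrow> (\<Sum>y\<in>Y 0. ev (mv (X 0) (\<phi> 0) v y) * h y) = (\<Sum>x\<in>X 0. ev (v x) * g x))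
    \<and> (\<forall>i v. vc v \<longrightarrow> eqm I (Y i) (mv (X i) (\<phi> i) (mv (X (Suc i)) (d i) v))
        (mv (Y (Suc i)) (e i) (mv (X (Suc i)) (\<phi> (Suc i)) v)))"

text \<open>A lift of the identity of the field, built degree by degree. The invariant
  \<open>P\<close> says that the matrix in degree \<open>i\<close> sends boundaries to cycles of the
  target, which is what exactness of \<open>Y\<close> needs to produce the next matrix.\<close>

lemma comparison:
  fixes X :: "nat \<Rightarrow> 'x set" and Y :: "nat \<Rightarrow> 'y set"
  assumes I: "idl I" and F: "cplx I X d g" and G: "res I Y e h"
  obtains \<phi> where "chain_map I X d g Y e h \<phi>"
proof -
  have G': "cplx I Y e h" using G by (simp add: res_def)
  have d: "mc (d i)" "finite (X i)" and e: "mc (e i)" "finite (Y i)" for i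
    using F G' by (auto simp: cplx_def)
  define P where "P = (\<lambda>i A. mc A \<and> (\<forall>v. vc v \<longrightarrow> cyc I Y e h i (mv (X i) A (mv (X (Suc i)) (d i) v)))
    \<and> (i = 0 \<longrightarrow> (\<forall>v. vc v \<longrightarrow> (\<Sum>y\<in>Y 0. ev (mv (X 0) A v y) * h y) = (\<Sum>x\<in>X 0. ev (v x) * g x))))"
  define R where "R = (\<lambda>i A B. \<forall>v. vc v \<longrightarrow> eqm I (Y i) (mv (X i) A (mv (X (Suc i)) (d i) v))
        (mv (Y (Suc i)) (e i) (mv (X (Suc i)) B v)))"
  have "\<exists>f. \<forall>i. P i (f i) \<and> R i (f i) (f (Suc i))"
  proof (rule dependent_nat_choice)
    obtain v1 where v1: "vc v1" "(\<Sum>y\<in>Y 0. ev (v1 y) * h y) = 1" using G by (auto simp: res_def)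
    \<comment> \<open>\<open>v1\<close> has augmentation 1, so sending the basis vector
      \<open>x\<close> to \<open>g x\<close> times \<open>v1\<close> preserves
      augmentations.\<close>
    define A where "A = (\<lambda>y x. v1 y * cst (g x))"
    have mA: "mc A" using v1 by (simp add: mc_def A_def vc_def C_intros)
    have aug: "(\<Sum>y\<in>Y 0. ev (mv (X 0) A v y) * h y) = (\<Sum>x\<in>X 0. ev (v x) * g x)" if v: "vc v" for v
    proof -
      have "ev (mv (X 0) A v y) = ev (v1 y) * (\<Sum>x\<in>X 0. ev (v x) * g x)" for y
        using v1 v by (simp add: mv_def A_def vc_def ev_sum ev_mult ev_cst C_intros sum_distrib_left mult_ac)
      then have "(\<Sum>y\<in>Y 0. ev (mv (X 0) A v y) * h y)
          = (\<Sum>y\<in>Y 0. ev (v1 y) * h y) * (\<Sum>x\<in>X 0. ev (v x) * g x)"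
        by (simp only: sum_distrib_right[of _ "Y 0"] mult.assoc mult.commute[of _ "h _"])
      with v1 show ?thesis by simp
    qed
    have "cyc I Y e h 0 (mv (X 0) A (mv (X (Suc 0)) (d 0) v))" if "vc v" for v
    proof -
      have "cyc I X d g 0 (mv (X (Suc 0)) (d 0) v)" using F that by (auto simp: cplx_def)
      then show ?thesis using aug[OF vc_mv[OF d(1) that]] by (simp add: cyc_def)
    qed
    with mA aug show "\<exists>A. P 0 A" unfolding P_def by blast
  next
    fix A i assume PA: "P i A"
    then have A: "mc A" by (simp add: P_def)
    let ?B = "\<lambda>y x. mv (X i) A (\<lambda>x'. d i x' x) y"
    have "\<exists>w. vc w \<and> eqm I (Y i) (\<lambda>y. ?B y x) (mv (Y (Suc i)) (e i) w)" if x: "x \<in> X (Suc i)" for x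
    proof -
      have "cyc I Y e h i (mv (X i) A (mv (X (Suc i)) (d i) (\<lambda>x'. if x' = x then 1 else 0)))"
        using PA vc_unit[of x] by (auto simp: P_def)
      then have "cyc I Y e h i (\<lambda>y. ?B y x)" by (simp add: mv_unit[OF d(2) x])
      moreover have "vc (\<lambda>y. ?B y x)" by (intro vc_mv A vc_col d)
      ultimately show ?thesis using G by (auto simp: res_def)
    qed
    from factor_matrix[OF I mc_mm[OF A d(1)] e(1) this]
    obtain W where W: "mc W" "\<And>v. vc v \<Longrightarrow> eqm I (Y i) (mv (X (Suc i)) ?B v)
          (mv (Y (Suc i)) (e i) (mv (X (Suc i)) W v))" by blast
    have R: "R i A W" unfolding R_def using W(2) by (simp add: mv_mv)
    have "cyc I Y e h (Suc i) (mv (X (Suc i)) W (mv (X (Suc (Suc i))) (d (Suc i)) v))" if v: "vc v" for v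
    proof -
      let ?v = "mv (X (Suc (Suc i))) (d (Suc i)) v"
      have v': "vc ?v" using vc_mv[OF d(1) v] .
      have "cyc I X d g (Suc i) ?v" using F v by (auto simp: cplx_def)
      then have "eqm I (X i) (mv (X (Suc i)) (d i) ?v) (\<lambda>_. 0)" by (simp add: cyc_def eqm_def)
      from eqm_mv[OF I A this] have "eqm I (Y i) (mv (X i) A (mv (X (Suc i)) (d i) ?v)) (\<lambda>_. 0)"
        by (simp add: mv_def[of _ _ "\<lambda>_. 0"])
      moreover have "eqm I (Y i) (mv (X i) A (mv (X (Suc i)) (d i) ?v)) (mv (Y (Suc i)) (e i) (mv (X (Suc i)) W ?v))"
        using R v' by (simp add: R_def)
      ultimately have "eqm I (Y i) (mv (Y (Suc i)) (e i) (mv (X (Suc i)) W ?v)) (\<lambda>_. 0)"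
        using eqm_trans[OF I] eqm_sym[OF I] by blast
      then show ?thesis by (simp add: cyc_def eqm_def)
    qed
    with W R show "\<exists>B. P (Suc i) B \<and> R i A B" unfolding P_def by blast
  qed
  then obtain \<phi> where \<phi>: "\<And>i. P i (\<phi> i)" "\<And>i. R i (\<phi> i) (\<phi> (Suc i))" by blast
  have "chain_map I X d g Y e h \<phi>"
    unfolding chain_map_def
  proof (intro conjI allI impI)
    show "mc (\<phi> i)" for i using \<phi>(1)[of i] by (simp add: P_def)
    show "(\<Sum>y\<in>Y 0. ev (mv (X 0) (\<phi> 0) v y) * h y) = (\<Sum>x\<in>X 0. ev (v x) * g x)" if "vc v" for v
      using \<phi>(1)[of 0] that by (simp add: P_def)
  qed (use \<phi>(2) in \<open>simp add: R_def\<close>)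
  then show ?thesis using that by blast
qed

text \<open>A chain map with vanishing augmentation is null-homotopic. The invariant is that
  \<open>\<theta> - s d\<close> takes cycles as values in the next degree; exactness then gives the
  next \<open>s\<close>, where \<open>s i\<close> raises the degree from \<open>i\<close> to
  \<open>Suc i\<close>.\<close>

lemma homotopy:
  fixes X :: "nat \<Rightarrow> 'x set" and Y :: "nat \<Rightarrow> 'y set"
  assumes I: "idl I" and F: "cplx I X d g" and G: "res I Y e h"
    and \<theta>: "\<And>i. mc (\<theta> i)" "\<And>v. vc v \<Longrightarrow> (\<Sum>y\<in>Y 0. ev (mv (X 0) (\<theta> 0) v y) * h y) = 0"
    "\<And>i v. vc v \<Longrightarrow> eqm I (Y i) (mv (X i) (\<theta> i) (mv (X (Suc i)) (d i) v))
        (mv (Y (Suc i)) (e i) (mv (X (Suc i)) (\<theta> (Suc i)) v))"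
  obtains s where "\<And>i. mc (s i)"
    "\<And>v. vc v \<Longrightarrow> eqm I (Y 0) (mv (X 0) (\<theta> 0) v) (mv (Y (Suc 0)) (e 0) (mv (X 0) (s 0) v))"
    "\<And>i v. vc v \<Longrightarrow> eqm I (Y (Suc i)) (mv (X (Suc i)) (\<theta> (Suc i)) v)
        (\<lambda>y. mv (Y (Suc (Suc i))) (e (Suc i)) (mv (X (Suc i)) (s (Suc i)) v) y
          + mv (X i) (s i) (mv (X (Suc i)) (d i) v) y)"
proof -
  have G': "cplx I Y e h" using G by (simp add: res_def)
  have d: "mc (d i)" "finite (X i)" and e: "mc (e i)" "finite (Y i)" for i
    using F G' by (auto simp: cplx_def)
  define P where "P = (\<lambda>i A. mc A \<and> (\<forall>v. vc v \<longrightarrow> cyc I Y e h (Suc i) (\<lambda>y. mv (X (Suc i)) (\<theta> (Suc i)) v y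
      - mv (X i) A (mv (X (Suc i)) (d i) v) y))
    \<and> (i = 0 \<longrightarrow> (\<forall>v. vc v \<longrightarrow> eqm I (Y 0) (mv (X 0) (\<theta> 0) v) (mv (Y (Suc 0)) (e 0) (mv (X 0) A v)))))"
  define R where "R = (\<lambda>i A B. \<forall>v. vc v \<longrightarrow> eqm I (Y (Suc i)) (\<lambda>y. mv (X (Suc i)) (\<theta> (Suc i)) v y
      - mv (X i) A (mv (X (Suc i)) (d i) v) y) (mv (Y (Suc (Suc i))) (e (Suc i)) (mv (X (Suc i)) B v)))"
  have Pcyc: "cyc I Y e h (Suc i) (\<lambda>y. mv (X (Suc i)) (\<theta> (Suc i)) v y - mv (X i) A (mv (X (Suc i)) (d i) v) y)"
    if "mc A" and v: "vc v" and A: "eqm I (Y i) (mv (X i) (\<theta> i) (mv (X (Suc i)) (d i) v))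
        (mv (Y (Suc i)) (e i) (mv (X i) A (mv (X (Suc i)) (d i) v)))" for i A v
  proof -
    have "eqm I (Y i) (mv (Y (Suc i)) (e i) (mv (X (Suc i)) (\<theta> (Suc i)) v))
        (mv (Y (Suc i)) (e i) (mv (X i) A (mv (X (Suc i)) (d i) v)))"
      using eqm_trans[OF I eqm_sym[OF I \<theta>(3)[OF v]] A] .
    then show ?thesis by (simp add: cyc_def mv_diff eqm_def)
  qed
  have "\<exists>f. \<forall>i. P i (f i) \<and> R i (f i) (f (Suc i))"
  proof (rule dependent_nat_choice)
    have "\<exists>w. vc w \<and> eqm I (Y 0) (\<lambda>y. \<theta> 0 y x) (mv (Y (Suc 0)) (e 0) w)" if x: "x \<in> X 0" for x
    proof -
      have "cyc I Y e h 0 (\<lambda>y. \<theta> 0 y x)"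
        using \<theta>(2)[OF vc_unit[of x]] by (simp add: mv_unit[OF d(2) x] cyc_def)
      then show ?thesis using G vc_col[OF \<theta>(1)] by (auto simp: res_def)
    qed
    from factor_matrix[OF I \<theta>(1) e(1) this]
    obtain W where W: "mc W" "\<And>v. vc v \<Longrightarrow> eqm I (Y 0) (mv (X 0) (\<theta> 0) v)
          (mv (Y (Suc 0)) (e 0) (mv (X 0) W v))" by blast
    then show "\<exists>A. P 0 A" unfolding P_def using Pcyc[of W _ 0] W(2)[OF vc_mv[OF d(1)]] by blast
  next
    fix A i assume PA: "P i A"
    then have A: "mc A" by (simp add: P_def)
    let ?B = "\<lambda>y x. \<theta> (Suc i) y x - mv (X i) A (\<lambda>x'. d i x' x) y"
    have Bv: "mv (X (Suc i)) ?B v = (\<lambda>y. mv (X (Suc i)) (\<theta> (Suc i)) v y - mv (X i) A (mv (X (Suc i)) (d i) v) y)" for v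
      unfolding mv_mv by (simp add: mv_def[of "X (Suc i)"] left_diff_distrib sum_subtractf)
    have B: "mc ?B" using mc_mm[OF A d(1)[of i], of "X i"] \<theta>(1) by (auto simp: mc_def C_intros)
    have "\<exists>w. vc w \<and> eqm I (Y (Suc i)) (\<lambda>y. ?B y x) (mv (Y (Suc (Suc i))) (e (Suc i)) w)" if x: "x \<in> X (Suc i)" for x
    proof -
      have "cyc I Y e h (Suc i) (mv (X (Suc i)) ?B (\<lambda>x'. if x' = x then 1 else 0))"
        unfolding Bv using PA vc_unit[of x] by (simp add: P_def)
      then have "cyc I Y e h (Suc i) (\<lambda>y. ?B y x)" by (simp only: mv_unit[OF d(2) x])
      then show ?thesis using G vc_col[OF B] by (auto simp: res_def)
    qed
    from factor_matrix[OF I B e(1) this]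
    obtain W where W: "mc W" "\<And>v. vc v \<Longrightarrow> eqm I (Y (Suc i)) (mv (X (Suc i)) ?B v)
          (mv (Y (Suc (Suc i))) (e (Suc i)) (mv (X (Suc i)) W v))" by blast
    have R: "R i A W" unfolding R_def using W(2) by (simp add: Bv)
    have "cyc I Y e h (Suc (Suc i)) (\<lambda>y. mv (X (Suc (Suc i))) (\<theta> (Suc (Suc i))) v y
      - mv (X (Suc i)) W (mv (X (Suc (Suc i))) (d (Suc i)) v) y)" if v: "vc v" for v
    proof (rule Pcyc[OF W(1) v])
      let ?v = "mv (X (Suc (Suc i))) (d (Suc i)) v"
      have v': "vc ?v" using vc_mv[OF d(1) v] .
      have "cyc I X d g (Suc i) ?v" using F v by (auto simp: cplx_def)
      then have "eqm I (X i) (mv (X (Suc i)) (d i) ?v) (\<lambda>_. 0)" by (simp add: cyc_def eqm_def)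
      from eqm_mv[OF I A this] have "eqm I (Y (Suc i)) (mv (X i) A (mv (X (Suc i)) (d i) ?v)) (\<lambda>_. 0)"
        by (simp add: mv_def[of _ _ "\<lambda>_. 0"])
      from eqm_diff[OF I eqm_refl[OF I, of _ "mv (X (Suc i)) (\<theta> (Suc i)) ?v"] eqm_sym[OF I this]]
      have "eqm I (Y (Suc i)) (mv (X (Suc i)) (\<theta> (Suc i)) ?v)
         (\<lambda>y. mv (X (Suc i)) (\<theta> (Suc i)) ?v y - mv (X i) A (mv (X (Suc i)) (d i) ?v) y)" by simp
      moreover have "eqm I (Y (Suc i)) (\<lambda>y. mv (X (Suc i)) (\<theta> (Suc i)) ?v y - mv (X i) A (mv (X (Suc i)) (d i) ?v) y)
          (mv (Y (Suc (Suc i))) (e (Suc i)) (mv (X (Suc i)) W ?v))"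
        using R v' by (simp add: R_def)
      ultimately show "eqm I (Y (Suc i)) (mv (X (Suc i)) (\<theta> (Suc i)) ?v)
          (mv (Y (Suc (Suc i))) (e (Suc i)) (mv (X (Suc i)) W ?v))"
        using eqm_trans[OF I] by blast
    qed
    with W R show "\<exists>B. P (Suc i) B \<and> R i A B" unfolding P_def by blast
  qed
  then obtain s where s: "\<And>i. P i (s i)" "\<And>i. R i (s i) (s (Suc i))" by blast
  show ?thesis
  proof (rule that)
    show "mc (s i)" for i using s(1)[of i] by (simp add: P_def)
    show "eqm I (Y 0) (mv (X 0) (\<theta> 0) v) (mv (Y (Suc 0)) (e 0) (mv (X 0) (s 0) v))" if "vc v" for v
      using s(1)[of 0] that by (simp add: P_def)
    fix i and v :: "'x \<Rightarrow> 'a" assume v: "vc v"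
    have "eqm I (Y (Suc i)) (\<lambda>y. mv (X (Suc i)) (\<theta> (Suc i)) v y
      - mv (X i) (s i) (mv (X (Suc i)) (d i) v) y) (mv (Y (Suc (Suc i))) (e (Suc i)) (mv (X (Suc i)) (s (Suc i)) v))"
      using s(2)[of i] v by (simp add: R_def)
    then show "eqm I (Y (Suc i)) (mv (X (Suc i)) (\<theta> (Suc i)) v)
        (\<lambda>y. mv (Y (Suc (Suc i))) (e (Suc i)) (mv (X (Suc i)) (s (Suc i)) v) y
          + mv (X i) (s i) (mv (X (Suc i)) (d i) v) y)" by (simp add: eqm_def algebra_simps)
  qed
qed

section \<open>Homology with coefficients in a quotient, and its independence of the
  resolution\<close>

definition hcyc :: "'a set \<Rightarrow> (nat \<Rightarrow> 'x set) \<Rightarrow> (nat \<Rightarrow> 'x \<Rightarrow> 'x \<Rightarrow> 'a) \<Rightarrow> nat \<Rightarrow> ('x \<Rightarrow> 'a) \<Rightarrow> bool"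
  where "hcyc Q X d i v = (case i of 0 \<Rightarrow> True | Suc j \<Rightarrow> \<forall>x\<in>X j. mv (X (Suc j)) (d j) v x \<in> Q)"

text \<open>Representatives of a field basis of the degree \<open>i\<close> homology of the complex
  tensored with \<open>C/Q\<close>, that is, of Tor. The tensored complex has no augmentation, which
  is why \<open>hcyc\<close>, unlike \<open>cyc\<close>, accepts everything in degree 0. Keeping the
  index set \<open>V\<close> apart from the vectors lets \<open>card V\<close> be the dimension
  across different resolutions.\<close>

definition hbasis :: "'a set \<Rightarrow> (nat \<Rightarrow> 'x set) \<Rightarrow> (nat \<Rightarrow> 'x \<Rightarrow> 'x \<Rightarrow> 'a) \<Rightarrow> nat \<Rightarrow> 'v set \<Rightarrow> ('v \<Rightarrow> 'x \<Rightarrow> 'a) \<Rightarrow> bool"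
  where "hbasis Q X d i V z \<longleftrightarrow> finite V \<and> (\<forall>k\<in>V. vc (z k) \<and> hcyc Q X d i (z k))
    \<and> (\<forall>v. vc v \<longrightarrow> hcyc Q X d i v \<longrightarrow> (\<exists>c w. vc w \<and>
        eqm Q (X i) v (\<lambda>x. (\<Sum>k\<in>V. cst (c k) * z k x) + mv (X (Suc i)) (d i) w x)))
    \<and> (\<forall>c w. vc w \<longrightarrow> eqm Q (X i) (\<lambda>x. \<Sum>k\<in>V. cst (c k) * z k x) (mv (X (Suc i)) (d i) w)
        \<longrightarrow> (\<forall>k\<in>V. c k = 0))"

lemma chain_map_comp:
  fixes X :: "nat \<Rightarrow> 'x set" and Y :: "nat \<Rightarrow> 'y set" and Z :: "nat \<Rightarrow> 'z set"
  assumes I: "idl I" and \<phi>: "chain_map I X d g Y e h \<phi>" and \<psi>: "chain_map I Y e h Z f l \<psi>"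
  shows "chain_map I X d g Z f l (\<lambda>i z x. mv (Y i) (\<psi> i) (\<lambda>y. \<phi> i y x) z)"
  unfolding chain_map_def mv_mv[symmetric]
proof (intro conjI allI impI)
  have m: "mc (\<phi> i)" "mc (\<psi> i)" for i using \<phi> \<psi> by (auto simp: chain_map_def)
  show "mc (\<lambda>z x. mv (Y i) (\<psi> i) (\<lambda>y. \<phi> i y x) z)" for i by (intro mc_mm m)
  fix v :: "'x \<Rightarrow> 'a" assume v: "vc v"
  show "(\<Sum>y\<in>Z 0. ev (mv (Y 0) (\<psi> 0) (mv (X 0) (\<phi> 0) v) y) * l y) = (\<Sum>x\<in>X 0. ev (v x) * g x)"
    using \<phi> \<psi> v vc_mv[OF m(1) v] by (auto simp: chain_map_def)
  fix i
  have "eqm I (Y i) (mv (X i) (\<phi> i) (mv (X (Suc i)) (d i) v)) (mv (Y (Suc i)) (e i) (mv (X (Suc i)) (\<phi> (Suc i)) v))"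
    using \<phi> v by (simp add: chain_map_def)
  from eqm_mv[OF I m(2) this]
  have "eqm I (Z i) (mv (Y i) (\<psi> i) (mv (X i) (\<phi> i) (mv (X (Suc i)) (d i) v)))
     (mv (Y i) (\<psi> i) (mv (Y (Suc i)) (e i) (mv (X (Suc i)) (\<phi> (Suc i)) v)))" .
  moreover have "eqm I (Z i) (mv (Y i) (\<psi> i) (mv (Y (Suc i)) (e i) (mv (X (Suc i)) (\<phi> (Suc i)) v)))
     (mv (Z (Suc i)) (f i) (mv (Y (Suc i)) (\<psi> (Suc i)) (mv (X (Suc i)) (\<phi> (Suc i)) v)))"
    using \<psi> vc_mv[OF m(1) v] by (auto simp: chain_map_def)
  ultimately show "eqm I (Z i) (mv (Y i) (\<psi> i) (mv (X i) (\<phi> i) (mv (X (Suc i)) (d i) v)))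
     (mv (Z (Suc i)) (f i) (mv (Y (Suc i)) (\<psi> (Suc i)) (mv (X (Suc i)) (\<phi> (Suc i)) v)))"
    using eqm_trans[OF I] by blast
qed

lemma hcyc_chain_map:
  assumes Q: "idl Q" "I \<subseteq> Q" and \<phi>: "chain_map I X d g Y e h \<phi>" and v: "vc v" "hcyc Q X d i v"
  shows "hcyc Q Y e i (mv (X i) (\<phi> i) v)"
proof (cases i)
  case (Suc j)
  have m: "mc (\<phi> i)" for i using \<phi> by (auto simp: chain_map_def)
  have "eqm Q (X j) (mv (X (Suc j)) (d j) v) (\<lambda>_. 0)" using v Suc by (simp add: hcyc_def eqm_def)
  from eqm_mv[OF Q(1) m this] have "eqm Q (Y j) (mv (X j) (\<phi> j) (mv (X (Suc j)) (d j) v)) (\<lambda>_. 0)"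
    by (simp add: mv_def[of _ _ "\<lambda>_. 0"])
  moreover have "eqm Q (Y j) (mv (X j) (\<phi> j) (mv (X (Suc j)) (d j) v)) (mv (Y (Suc j)) (e j) (mv (X (Suc j)) (\<phi> (Suc j)) v))"
    using \<phi> v by (intro eqm_subset[OF Q(2)]) (simp add: chain_map_def)
  ultimately have "eqm Q (Y j) (mv (Y (Suc j)) (e j) (mv (X (Suc j)) (\<phi> (Suc j)) v)) (\<lambda>_. 0)"
    using eqm_trans[OF Q(1)] eqm_sym[OF Q(1)] by blast
  then show ?thesis by (simp add: hcyc_def eqm_def Suc)
qed (simp add: hcyc_def)

text \<open>\<open>\<tau>\<close> minus the identity has zero augmentation, hence equals
  \<open>d s + s d\<close> modulo \<open>I\<close>; on a cycle modulo \<open>Q\<close> the term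
  \<open>s d\<close> vanishes modulo \<open>Q\<close> and leaves a boundary.\<close>

lemma homotopic_identity:
  assumes I: "idl I" and Q: "idl Q" "I \<subseteq> Q" and F: "res I X d g" and \<tau>: "chain_map I X d g X d g \<tau>"
    and v: "vc v" "hcyc Q X d i v"
  shows "\<exists>w. vc w \<and> eqm Q (X i) (mv (X i) (\<tau> i) v) (\<lambda>x. v x + mv (X (Suc i)) (d i) w x)"
proof -
  have F': "cplx I X d g" using F by (simp add: res_def)
  have d: "mc (d i)" "finite (X i)" for i using F' by (auto simp: cplx_def)
  have mt: "mc (\<tau> i)" for i using \<tau> by (auto simp: chain_map_def)
  define \<theta> where "\<theta> = (\<lambda>i x' x. \<tau> i x' x - (if x' = x then 1 else 0))"
  have \<theta>: "mv (X i) (\<theta> i) v x = mv (X i) (\<tau> i) v x - v x" if "x \<in> X i" for i v x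
    using that d(2)[of i]
    by (simp add: \<theta>_def mv_def left_diff_distrib sum_subtractf if_distrib[of "\<lambda>z. z * c" for c] cong: if_cong)
  have m: "mc (\<theta> i)" for i using mt[of i] by (auto simp: mc_def \<theta>_def C_intros)
  have aug: "(\<Sum>x\<in>X 0. ev (mv (X 0) (\<theta> 0) v x) * g x) = 0" if v: "vc v" for v
  proof -
    have "(\<Sum>x\<in>X 0. ev (mv (X 0) (\<theta> 0) v x) * g x) = (\<Sum>x\<in>X 0. (ev (mv (X 0) (\<tau> 0) v x) - ev (v x)) * g x)"
      using v vc_mv[OF mt v] by (intro sum.cong) (auto simp: \<theta> ev_diff vc_def)
    also have "\<dots> = 0" using \<tau> v by (simp add: left_diff_distrib sum_subtractf chain_map_def)
    finally show ?thesis .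
  qed
  have ch: "eqm I (X i) (mv (X i) (\<theta> i) (mv (X (Suc i)) (d i) v)) (mv (X (Suc i)) (d i) (mv (X (Suc i)) (\<theta> (Suc i)) v))"
    if "vc v" for i v
  proof -
    have "mv (X (Suc i)) (d i) (mv (X (Suc i)) (\<theta> (Suc i)) v)
        = mv (X (Suc i)) (d i) (\<lambda>x. mv (X (Suc i)) (\<tau> (Suc i)) v x - v x)"
      by (rule ext) (simp add: mv_def[of _ "d i"] \<theta>)
    then show ?thesis using \<tau> that by (simp add: eqm_def \<theta> mv_diff chain_map_def)
  qed
  from homotopy[OF I F' F m aug ch] obtain s where s: "\<And>i. mc (s i)"
    "\<And>v. vc v \<Longrightarrow> eqm I (X 0) (mv (X 0) (\<theta> 0) v) (mv (X (Suc 0)) (d 0) (mv (X 0) (s 0) v))"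
    "\<And>i v. vc v \<Longrightarrow> eqm I (X (Suc i)) (mv (X (Suc i)) (\<theta> (Suc i)) v)
        (\<lambda>y. mv (X (Suc (Suc i))) (d (Suc i)) (mv (X (Suc i)) (s (Suc i)) v) y
          + mv (X i) (s i) (mv (X (Suc i)) (d i) v) y)" by blast
  have "eqm Q (X i) (mv (X i) (\<theta> i) v) (mv (X (Suc i)) (d i) (mv (X i) (s i) v))"
  proof (cases i)
    case 0
    then show ?thesis using eqm_subset[OF Q(2) s(2)[OF v(1)]] by simp
  next
    case (Suc j)
    have "eqm Q (X j) (mv (X (Suc j)) (d j) v) (\<lambda>_. 0)" using v Suc by (simp add: hcyc_def eqm_def)
    from eqm_mv[OF Q(1) s(1) this, of "X i" j]
    have "eqm Q (X i) (mv (X j) (s j) (mv (X (Suc j)) (d j) v)) (\<lambda>_. 0)"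
      by (simp add: mv_def[of _ _ "\<lambda>_. 0"])
    from eqm_add[OF Q(1) eqm_refl[OF Q(1)] this, of "mv (X (Suc i)) (d i) (mv (X i) (s i) v)"]
    show ?thesis using eqm_trans[OF Q(1) eqm_subset[OF Q(2) s(3)[OF v(1), of j]]] by (simp add: Suc)
  qed
  then have "eqm Q (X i) (mv (X i) (\<tau> i) v) (\<lambda>x. v x + mv (X (Suc i)) (d i) (mv (X i) (s i) v) x)"
    by (simp add: eqm_def \<theta> algebra_simps)
  then show ?thesis using vc_mv[OF s(1) v(1)] by blast
qed

text \<open>Comparison maps in both directions compose to maps that fix homology classes modulo
  \<open>Q\<close>, so the basis pushed forward along \<open>\<phi>\<close> is again a basis:
  spanning uses \<open>\<phi> \<psi>\<close>, independence uses \<open>\<psi> \<phi>\<close>. This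
  frees the computation of \<open>tor\<close> from the resolution picked by choice.\<close>

lemma hbasis_transfer:
  fixes X :: "nat \<Rightarrow> 'x set" and Y :: "nat \<Rightarrow> 'y set" and V :: "'v set"
  assumes I: "idl I" and Q: "idl Q" "I \<subseteq> Q" and F: "res I X d g" and G: "res I Y e h"
    and z: "hbasis Q X d i V z"
  shows "\<exists>z'. hbasis Q Y e i V z'"
proof -
  have F': "cplx I X d g" and G': "cplx I Y e h" using F G by (simp_all add: res_def)
  obtain \<phi> where \<phi>: "chain_map I X d g Y e h \<phi>"
    using comparison[OF I F' G] .
  obtain \<psi> where \<psi>: "chain_map I Y e h X d g \<psi>"
    using comparison[OF I G' F] .
  have d: "mc (d i)" and e: "mc (e i)" and m: "mc (\<phi> i)" "mc (\<psi> i)" for i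
    using F' G' \<phi> \<psi> by (auto simp: cplx_def chain_map_def)
  note \<tau> = homotopic_identity[OF I Q F chain_map_comp[OF I \<phi> \<psi>], folded mv_mv]
  note \<tau>' = homotopic_identity[OF I Q G chain_map_comp[OF I \<psi> \<phi>], folded mv_mv]
  have \<phi>d: "eqm Q (Y i) (mv (X i) (\<phi> i) (mv (X (Suc i)) (d i) v)) (mv (Y (Suc i)) (e i) (mv (X (Suc i)) (\<phi> (Suc i)) v))"
    if "vc v" for v using \<phi> that by (intro eqm_subset[OF Q(2)]) (simp add: chain_map_def)
  have \<psi>e: "eqm Q (X i) (mv (Y i) (\<psi> i) (mv (Y (Suc i)) (e i) v)) (mv (X (Suc i)) (d i) (mv (Y (Suc i)) (\<psi> (Suc i)) v))"
    if "vc v" for v using \<psi> that by (intro eqm_subset[OF Q(2)]) (simp add: chain_map_def)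
  define z' where "z' = (\<lambda>k. mv (X i) (\<phi> i) (z k))"
  have zs: "vc (z k)" "hcyc Q X d i (z k)" if "k \<in> V" for k using z that by (auto simp: hbasis_def)
  have span: "\<exists>c w. vc w \<and> eqm Q (X i) v (\<lambda>x. (\<Sum>k\<in>V. cst (c k) * z k x) + mv (X (Suc i)) (d i) w x)"
    if "vc v" "hcyc Q X d i v" for v using z that by (simp add: hbasis_def)
  have indep: "c k = 0" if "vc w" "eqm Q (X i) (\<lambda>x. \<Sum>k\<in>V. cst (c k) * z k x) (mv (X (Suc i)) (d i) w)" "k \<in> V"
    for c w k using z that by (auto simp: hbasis_def)
  have z'sum: "(\<lambda>y. \<Sum>k\<in>V. cst (c k) * z' k y) = mv (X i) (\<phi> i) (\<lambda>x. \<Sum>k\<in>V. cst (c k) * z k x)" for c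
    by (simp add: z'_def mv_sum)
  have "hbasis Q Y e i V z'"
    unfolding hbasis_def
  proof (intro conjI ballI allI impI)
    show "finite V" using z by (simp add: hbasis_def)
    show "vc (z' k)" "hcyc Q Y e i (z' k)" if "k \<in> V" for k
      using zs[OF that] hcyc_chain_map[OF Q \<phi>] m by (auto simp: z'_def vc_mv)
    show "\<exists>c w. vc w \<and> eqm Q (Y i) v (\<lambda>y. (\<Sum>k\<in>V. cst (c k) * z' k y) + mv (Y (Suc i)) (e i) w y)"
      if v: "vc v" "hcyc Q Y e i v" for v
    proof -
      have "hcyc Q X d i (mv (Y i) (\<psi> i) v)" using hcyc_chain_map[OF Q \<psi> v] .
      then obtain c w where cw: "vc w" "eqm Q (X i) (mv (Y i) (\<psi> i) v)
          (\<lambda>x. (\<Sum>k\<in>V. cst (c k) * z k x) + mv (X (Suc i)) (d i) w x)"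
        using span[OF vc_mv[OF m(2) v(1)]] by blast
      obtain u where u: "vc u" "eqm Q (Y i) (mv (X i) (\<phi> i) (mv (Y i) (\<psi> i) v)) (\<lambda>y. v y + mv (Y (Suc i)) (e i) u y)"
        using \<tau>'[OF v] by blast
      have 1: "eqm Q (Y i) (mv (X i) (\<phi> i) (mv (Y i) (\<psi> i) v))
         (\<lambda>y. (\<Sum>k\<in>V. cst (c k) * z' k y) + mv (X i) (\<phi> i) (mv (X (Suc i)) (d i) w) y)"
        using eqm_mv[OF Q(1) m(1) cw(2)] by (simp add: mv_add z'_def mv_sum)
      note 2 = eqm_trans[OF Q(1) 1 eqm_add[OF Q(1) eqm_refl[OF Q(1)] \<phi>d[OF cw(1)]]]
      let ?w = "\<lambda>y. mv (X (Suc i)) (\<phi> (Suc i)) w y - u y"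
      have 3: "eqm Q (Y i) (\<lambda>y. v y + mv (Y (Suc i)) (e i) u y)
         (\<lambda>y. (\<Sum>k\<in>V. cst (c k) * z' k y) + mv (Y (Suc i)) (e i) (mv (X (Suc i)) (\<phi> (Suc i)) w) y)"
        using eqm_trans[OF Q(1) eqm_sym[OF Q(1) u(2)] 2] .
      have "eqm Q (Y i) v (\<lambda>y. (\<Sum>k\<in>V. cst (c k) * z' k y) + mv (Y (Suc i)) (e i) ?w y)"
        using 3 by (simp add: mv_diff eqm_def algebra_simps)
      moreover have "vc ?w" using vc_diff[OF vc_mv[OF m(1) cw(1)] u(1)] .
      ultimately show ?thesis by blast
    qed
    fix c w k assume w: "vc w" "eqm Q (Y i) (\<lambda>y. \<Sum>k\<in>V. cst (c k) * z' k y) (mv (Y (Suc i)) (e i) w)" and k: "k \<in> V"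
    let ?v = "\<lambda>x. \<Sum>k\<in>V. cst (c k) * z k x"
    have v: "vc ?v" using zs(1) by (intro vc_cst_sum)
    have "hcyc Q X d i ?v"
      using zs(2) by (auto simp: hcyc_def mv_sum cst_C intro!: idl_sum[OF Q(1)] idlD(4)[OF Q(1)] split: nat.splits)
    then obtain u where u: "vc u" "eqm Q (X i) (mv (Y i) (\<psi> i) (mv (X i) (\<phi> i) ?v)) (\<lambda>x. ?v x + mv (X (Suc i)) (d i) u x)"
      using \<tau>[OF v] by blast
    have "eqm Q (X i) (mv (Y i) (\<psi> i) (mv (X i) (\<phi> i) ?v)) (mv (Y i) (\<psi> i) (mv (Y (Suc i)) (e i) w))"
      using eqm_mv[OF Q(1) m(2) w(2)] by (simp add: z'sum)
    from eqm_trans[OF Q(1) eqm_trans[OF Q(1) eqm_sym[OF Q(1) u(2)] this] \<psi>e[OF w(1)]]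
    have "eqm Q (X i) ?v (mv (X (Suc i)) (d i) (\<lambda>x. mv (Y (Suc i)) (\<psi> (Suc i)) w x - u x))"
      by (simp add: mv_diff eqm_def algebra_simps)
    moreover have "vc (\<lambda>x. mv (Y (Suc i)) (\<psi> (Suc i)) w x - u x)" using vc_diff[OF vc_mv[OF m(2) w(1)] u(1)] .
    ultimately show "c k = 0" using indep k by blast
  qed
  then show ?thesis by blast
qed

end

section \<open>The exterior algebra as coefficient functions on sets of indices\<close>

section \<open>The Koszul complex and its contracting homotopy\<close>

text \<open>The sign of moving \<open>e_l\<close> past the factors of \<open>e_M\<close> with
  smaller index, where \<open>e_M\<close> is the product in increasing order.\<close>

definition sg :: "nat \<Rightarrow> nat set \<Rightarrow> 'a::comm_ring_1"
  where "sg l M = (- 1) ^ card {j \<in> M. j < l}"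

lemma sg_sq: "sg l M * (sg l M * a) = (a :: 'a::comm_ring_1)"
  unfolding sg_def mult.assoc[symmetric] power_add[symmetric] by (simp add: minus_one_power_iff)

lemma sg_cases: "sg l M = (1 :: 'a::comm_ring_1) \<or> sg l M = (- 1 :: 'a)"
  by (simp add: sg_def minus_one_power_iff)

lemma sg_insert: "k \<notin> M \<Longrightarrow> sg l (insert k M) = (if k < l then - sg l M else sg l M :: 'a::comm_ring_1)"
proof (cases "k < l")
  case True
  assume "k \<notin> M"
  have "{j \<in> insert k M. j < l} = insert k {j \<in> M. j < l}" using True by auto
  with \<open>k \<notin> M\<close> True show ?thesis by (simp add: sg_def card_insert_if)
next
  case False
  then have "{j \<in> insert k M. j < l} = {j \<in> M. j < l}" by auto
  with False show ?thesis by (simp add: sg_def)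
qed

lemma sg_remove: "k \<in> M \<Longrightarrow> sg l M = (if k < l then - sg l (M - {k}) else sg l (M - {k}) :: 'a::comm_ring_1)"
  using sg_insert[of k "M - {k}" l] by (simp add: insert_absorb)

lemma sg_min: "(\<And>j. j \<in> M \<Longrightarrow> l \<le> j) \<Longrightarrow> sg l M = (1 :: 'a::comm_ring_1)"
proof -
  assume "\<And>j. j \<in> M \<Longrightarrow> l \<le> j"
  then have "{j \<in> M. j < l} = {}" by force
  then show ?thesis unfolding sg_def by (simp only: card.empty power_0)
qed

text \<open>Left multiplication by \<open>e_k\<close>; \<open>iot\<close> below is contraction with
  the dual of \<open>e_l\<close>. Both act on coefficient functions, so the value at
  \<open>M\<close> is read from the only set that can contribute to it.\<close>

definition lam :: "nat \<Rightarrow> (nat set \<Rightarrow> 'a) \<Rightarrow> nat set \<Rightarrow> 'a::comm_ring_1"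
  where "lam k a M = (if k \<in> M then sg k M * a (M - {k}) else 0)"

definition iot :: "nat \<Rightarrow> (nat set \<Rightarrow> 'a) \<Rightarrow> nat set \<Rightarrow> 'a::comm_ring_1"
  where "iot l a M = (if l \<in> M then 0 else sg l M * a (insert l M))"

lemma iot_add: "iot l (\<lambda>M. a M + b M) M = iot l a M + iot l b M"
  and iot_diff: "iot l (\<lambda>M. a M - b M) M = iot l a M - iot l b M"
  and iot_scale: "iot l (\<lambda>M. c * a M) M = c * iot l a M"
  and iot_zero: "iot l (\<lambda>M. 0) M = 0"
  by (simp_all add: iot_def distrib_left right_diff_distrib mult.left_commute)

text \<open>The Clifford relation: for distinct indices the two orders of inserting and deleting
  differ by one transposition.\<close>

lemma iot_lam: "iot l (lam k a) M + lam k (iot l a) M = (if k = l then a M else 0)"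
proof (cases "k = l")
  case True
  then show ?thesis
    by (auto simp: iot_def lam_def sg_remove[of l M l] sg_insert[of l M l] sg_sq insert_absorb)
next
  case False
  show ?thesis
  proof (cases "k \<in> M \<and> l \<notin> M")
    case True
    have "insert l M - {k} = insert l (M - {k})" using False by auto
    moreover have "sg l M * sg k (insert l M) = (- (sg k M * sg l (M - {k})) :: 'a)"
      using True False sg_remove[of k M l, where 'a='a] sg_insert[of l M k, where 'a='a]
      by (auto simp: mult.commute)
    ultimately show ?thesis using True False
      by (simp add: iot_def lam_def mult.assoc[symmetric] left_minus)
  next
    case neg: False
    then show ?thesis using False by (auto simp: iot_def lam_def)
  qed
qed

lemma iot_iot: "iot l (iot k a) M = - iot k (iot l a) M" and iot_same: "iot l (iot l a) M = 0"
proof -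
  show "iot l (iot l a) M = 0" by (simp add: iot_def)
  show "iot l (iot k a) M = - iot k (iot l a) M"
  proof (cases "l = k \<or> l \<in> M \<or> k \<in> M")
    case False
    then have "sg l M * sg k (insert l M) = (- (sg k M * sg l (insert k M)) :: 'a)"
      using sg_insert[of k M l, where 'a='a] sg_insert[of l M k, where 'a='a]
      by (auto simp: mult.commute)
    then show ?thesis using False
      by (simp add: iot_def mult.assoc[symmetric] insert_commute)
  qed (auto simp: iot_def)
qed

text \<open>Swapping the two indices pairs off the terms. The diagonal has its own hypothesis
  because antisymmetry does not force it to vanish in characteristic two.\<close>

lemma sum_alternating:
  fixes f :: "'b \<Rightarrow> 'b \<Rightarrow> 'c::ab_group_add"
  assumes "finite X" "\<And>l k. f l k = - f k l" "\<And>l. f l l = 0"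
  shows "(\<Sum>l\<in>X. \<Sum>k\<in>X. f l k) = 0"
  using assms(1)
proof (induction X)
  case (insert x X)
  have "(\<Sum>l\<in>X. f l x) = - (\<Sum>k\<in>X. f x k)" unfolding sum_negf[symmetric] by (intro sum.cong refl assms(2))
  then show ?case using insert assms(3) by (simp add: sum.distrib)
qed simp

text \<open>Left multiplication by \<open>e_L\<close>: \<open>foldr\<close> over the sorted list
  puts the smallest index outermost, which matches induction by adding a new minimum.\<close>

definition lamL :: "nat set \<Rightarrow> (nat set \<Rightarrow> 'a) \<Rightarrow> nat set \<Rightarrow> 'a::comm_ring_1"
  where "lamL L a = foldr lam (sorted_list_of_set L) a"

lemma lamL_empty: "lamL {} a = a"
  by (simp add: lamL_def)

lemma lamL_insert:
  assumes "finite L" "\<And>j. j \<in> L \<Longrightarrow> k < j"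
  shows "lamL (insert k L) a = lam k (lamL L a)"
proof -
  have "k \<notin> L" using assms(2) by blast
  then have "sorted_list_of_set (insert k L) = k # sorted_list_of_set L"
    using assms by (simp add: insort_is_Cons less_imp_le)
  then show ?thesis by (simp add: lamL_def)
qed

text \<open>The sign is determined by \<open>L\<close> and \<open>M\<close>, uniformly in
  \<open>a\<close>; arguments about ideal membership and degrees need no more than that.\<close>

lemma lamL_form:
  assumes "finite L"
  shows "\<exists>e. (e = 1 \<or> e = - 1) \<and> (\<forall>a. lamL L a M = (if L \<subseteq> M then e * a (M - L) else 0 :: 'a::comm_ring_1))"
  using assms
proof (induction L arbitrary: M rule: finite_linorder_min_induct)
  case empty
  then show ?case by (auto simp: lamL_empty)
next
  case (insert k L)
  from insert.IH[of "M - {k}"] obtain e :: 'a where e: "e = 1 \<or> e = - 1"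
    "\<And>a. lamL L a (M - {k}) = (if L \<subseteq> M - {k} then e * a (M - {k} - L) else 0)" by blast
  have "k \<notin> L" using insert by blast
  have *: "lamL (insert k L) a M = (if insert k L \<subseteq> M then (sg k M * e) * a (M - insert k L) else 0)" for a :: "nat set \<Rightarrow> 'a"
  proof -
    have "M - {k} - L = M - insert k L" by auto
    then show ?thesis using \<open>k \<notin> L\<close> insert(1,2)
      by (auto simp: lamL_insert lam_def e(2) mult.assoc)
  qed
  have "sg k M * e = 1 \<or> sg k M * e = - 1" using e(1) sg_cases[of k M, where 'a='a] by auto
  with * show ?case by blast
qed

text \<open>Each new index is smaller than the previous ones, so no sign appears in
  \<open>e_L\<close> times a scalar. This is how the differential turns a word coefficient in Koszul
  degree 0 into a multiple of a cycle.\<close>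

lemma lamL_unit:
  assumes "finite L"
  shows "lamL L (\<lambda>M. if M = {} then c else 0) M = (if M = L then c else 0 :: 'a::comm_ring_1)"
  using assms
proof (induction L arbitrary: M rule: finite_linorder_min_induct)
  case empty
  then show ?case by (simp add: lamL_empty)
next
  case (insert k L)
  have "sg k (insert k L) = (1 :: 'a)" using insert by (intro sg_min) (auto simp: less_imp_le)
  moreover have "k \<notin> L" using insert by blast
  then have "k \<in> M \<and> M - {k} = L \<longleftrightarrow> M = insert k L" by blast
  ultimately show ?case using insert by (auto simp: lamL_insert lam_def)
qed

lemma lam_add: "lam k (\<lambda>M. a M + b M) = (\<lambda>M. lam k a M + lam k b M)"
  and lam_scale: "lam k (\<lambda>M. c * a M) = (\<lambda>M. c * lam k a M)"
  by (auto simp: lam_def fun_eq_iff algebra_simps)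

lemma lam_sum: "lam k (\<lambda>M. \<Sum>x\<in>X. f x M) = (\<lambda>M. \<Sum>x\<in>X. lam k (f x) M)"
  by (auto simp: lam_def fun_eq_iff sum_distrib_left)

text \<open>For a permutation, \<open>y r\<close> is the variable with index
  \<open>\<sigma> r\<close>, \<open>D r\<close> is \<open>dd_perm \<sigma> r\<close>, and
  \<open>kap r\<close> sets \<open>y s\<close> to zero for all \<open>s < r\<close>. The Koszul
  differential multiplies by variables only, so the three laws for \<open>D r (y s * a)\<close>
  replace a general product rule.\<close>

locale koszul = augmented_subring C cst ev
  for C :: "'a::comm_ring_1 set" and cst :: "'k::field \<Rightarrow> 'a" and ev :: "'a \<Rightarrow> 'k" +
  fixes n :: nat and y :: "nat \<Rightarrow> 'a" and D :: "nat \<Rightarrow> 'a \<Rightarrow> 'a" and kap :: "nat \<Rightarrow> 'a \<Rightarrow> 'a"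
  assumes y_C: "r \<in> {1..n} \<Longrightarrow> y r \<in> C"
    and ev_y: "r \<in> {1..n} \<Longrightarrow> ev (y r) = 0"
    and D_C: "r \<in> {1..n} \<Longrightarrow> a \<in> C \<Longrightarrow> D r a \<in> C"
    and D_add: "D r (a + b) = D r a + D r b"
    and y_D: "r \<in> {1..n} \<Longrightarrow> y r * D r a = kap r a - kap (Suc r) a"
    and kap_first: "a \<in> C \<Longrightarrow> kap 1 a = a"
    and kap_last: "a \<in> C \<Longrightarrow> kap (Suc n) a = cst (ev a)"
    and D_y_less: "s < r \<Longrightarrow> s \<in> {1..n} \<Longrightarrow> r \<in> {1..n} \<Longrightarrow> D r (y s * a) = 0"
    and D_y_eq: "r \<in> {1..n} \<Longrightarrow> D r (y r * a) = kap r a"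
    and D_y_greater: "r < s \<Longrightarrow> s \<in> {1..n} \<Longrightarrow> r \<in> {1..n} \<Longrightarrow> D r (y s * a) = y s * D r a"
    and noetherian: "\<lbrakk>I \<subseteq> C; 0 \<in> I; \<And>a b. a \<in> I \<Longrightarrow> b \<in> I \<Longrightarrow> a + b \<in> I; \<And>c a. c \<in> C \<Longrightarrow> a \<in> I \<Longrightarrow> c * a \<in> I\<rbrakk>
        \<Longrightarrow> \<exists>G. finite G \<and> G \<subseteq> I \<and> (\<forall>a\<in>I. \<exists>q. (\<forall>g\<in>G. q g \<in> C) \<and> a = (\<Sum>g\<in>G. q g * g))"
begin

lemma D_zero: "D r 0 = 0"
  using D_add[of r 0 0] by simp

lemma D_minus: "D r (- a) = - D r a"
  using D_add[of r a "- a"] by (simp add: D_zero eq_neg_iff_add_eq_0 add.commute)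

lemma D_sum: "D r (\<Sum>x\<in>X. f x) = (\<Sum>x\<in>X. D r (f x))"
  by (induction X rule: infinite_finite_induct) (auto simp: D_zero D_add)

lemma D_sg: "D r (sg l M * a) = sg l M * D r a"
  using sg_cases[of l M, where 'a='a] by (auto simp: D_minus)

lemma sg_C: "sg l M \<in> C"
  using sg_cases[of l M, where 'a='a] by (auto simp: C_intros)

lemma telescope: "m \<le> n \<Longrightarrow> (\<Sum>l\<in>{1..m}. y l * D l a) = kap 1 a - kap (Suc m) a"
  by (induction m) (auto simp: y_D)

section \<open>The Koszul differential, null-homotopies of the variables, and the Leibniz
  rule\<close>

definition bd :: "(nat set \<Rightarrow> 'a) \<Rightarrow> nat set \<Rightarrow> 'a"
  where "bd a M = (\<Sum>l\<in>{1..n}. y l * iot l a M)"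

definition homog :: "nat \<Rightarrow> (nat set \<Rightarrow> 'a) \<Rightarrow> bool"
  where "homog i a \<longleftrightarrow> (\<forall>M. a M \<noteq> 0 \<longrightarrow> M \<subseteq> {1..n} \<and> card M = i)"

lemma bd_add: "bd (\<lambda>M. a M + b M) = (\<lambda>M. bd a M + bd b M)"
  and bd_diff: "bd (\<lambda>M. a M - b M) = (\<lambda>M. bd a M - bd b M)"
  and bd_scale: "bd (\<lambda>M. c * a M) = (\<lambda>M. c * bd a M)"
  and bd_zero: "bd (\<lambda>M. 0) = (\<lambda>M. 0)"
  by (simp_all add: fun_eq_iff bd_def iot_add iot_diff iot_scale iot_zero distrib_left right_diff_distrib
      sum.distrib sum_subtractf sum_distrib_left mult.left_commute)

lemma bd_sum: "bd (\<lambda>M. \<Sum>x\<in>X. f x M) = (\<lambda>M. \<Sum>x\<in>X. bd (f x) M)"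
  by (induction X rule: infinite_finite_induct) (auto simp: bd_zero bd_add)

lemma vc_bd: "vc a \<Longrightarrow> vc (bd a)"
  by (auto simp: vc_def bd_def iot_def intro!: C_intros y_C sg_C)

lemma bd_in_idl: "idl I \<Longrightarrow> (\<And>M. M \<subseteq> {1..n} \<Longrightarrow> a M \<in> I) \<Longrightarrow> M \<subseteq> {1..n} \<Longrightarrow> bd a M \<in> I"
  by (auto simp: bd_def iot_def intro!: idl_sum idlD(4) y_C sg_C idlD(2))

lemma eqm_bd: "idl I \<Longrightarrow> eqm I (Pow {1..n}) a b \<Longrightarrow> eqm I (Pow {1..n}) (bd a) (bd b)"
  using bd_in_idl[of I "\<lambda>M. a M - b M"] by (auto simp: eqm_def bd_diff)

text \<open>The Clifford relation summed against the \<open>y l\<close>. Thus multiplication by each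
  variable is null-homotopic, which later makes Koszul homology a vector space over the
  field.\<close>

lemma bd_lam: "k \<in> {1..n} \<Longrightarrow> bd (lam k a) M + lam k (bd a) M = y k * a M"
proof -
  assume k: "k \<in> {1..n}"
  have "lam k (bd a) M = (\<Sum>l\<in>{1..n}. y l * lam k (iot l a) M)"
    by (simp add: bd_def lam_def sum_distrib_left mult.left_commute)
  then have "bd (lam k a) M + lam k (bd a) M = (\<Sum>l\<in>{1..n}. y l * (iot l (lam k a) M + lam k (iot l a) M))"
    by (simp add: bd_def sum.distrib distrib_left)
  also have "\<dots> = (\<Sum>l\<in>{1..n}. if k = l then y k * a M else 0)" by (intro sum.cong) (auto simp: iot_lam)
  finally show ?thesis using k by simp
qed

lemma bd_bd: "bd (bd a) M = 0"
proof -
  have "bd (bd a) M = (\<Sum>l\<in>{1..n}. \<Sum>k\<in>{1..n}. y l * y k * iot l (iot k a) M)"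
    unfolding bd_def by (auto simp: iot_def sum_distrib_left mult_ac intro!: sum.cong)
  also have "\<dots> = 0"
  proof (rule sum_alternating)
    fix l k
    show "y l * y k * iot l (iot k a) M = - (y k * y l * iot k (iot l a) M)"
      by (subst iot_iot) (simp add: mult.commute)
  qed (simp_all add: iot_same)
  finally show ?thesis .
qed

lemma homog_bd: "homog (Suc i) a \<Longrightarrow> homog i (bd a)"
  unfolding homog_def
proof (intro allI impI)
  fix M assume a: "\<forall>M. a M \<noteq> 0 \<longrightarrow> M \<subseteq> {1..n} \<and> card M = Suc i" and "bd a M \<noteq> 0"
  then obtain l where "y l * iot l a M \<noteq> 0" unfolding bd_def by (meson sum.not_neutral_contains_not_neutral)
  then have l: "l \<notin> M" "a (insert l M) \<noteq> 0" by (auto simp: iot_def split: if_splits)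
  then have "insert l M \<subseteq> {1..n}" "card (insert l M) = Suc i" using a by blast+
  moreover have "finite M" using calculation(1) finite_subset[of M "{1..n}"] by simp
  ultimately show "M \<subseteq> {1..n} \<and> card M = i" using l by simp
qed

lemma homog_lam: "k \<in> {1..n} \<Longrightarrow> homog i a \<Longrightarrow> homog (Suc i) (lam k a)"
  unfolding homog_def
proof (intro allI impI)
  fix M assume k: "k \<in> {1..n}" and a: "\<forall>M. a M \<noteq> 0 \<longrightarrow> M \<subseteq> {1..n} \<and> card M = i" and "lam k a M \<noteq> 0"
  then have M: "k \<in> M" "a (M - {k}) \<noteq> 0" by (auto simp: lam_def split: if_splits)
  then have *: "M - {k} \<subseteq> {1..n}" "card (M - {k}) = i" using a by blast+
  then have "finite M" using finite_subset[of "M - {k}" "{1..n}"] by simp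
  then have "card M = Suc i" using card.remove[OF _ M(1)] *(2) by simp
  moreover have "M \<subseteq> {1..n}" using *(1) k by blast
  ultimately show "M \<subseteq> {1..n} \<and> card M = Suc i" by simp
qed

text \<open>The Leibniz rule for \<open>e_L\<close> times \<open>a\<close>. Adding the smallest
  factor, \<open>bd_lam\<close> moves the differential past it and flips the sign of everything
  already known for \<open>L\<close>.\<close>

lemma bd_lamL:
  assumes "finite L" "L \<subseteq> {1..n}"
  shows "bd (lamL L a) M = (\<Sum>l\<in>L. sg l L * y l * lamL (L - {l}) a M) + (- 1) ^ card L * lamL L (bd a) M"
  using assms
proof (induction L arbitrary: M rule: finite_linorder_min_induct)
  case empty
  then show ?case by (simp add: lamL_empty)
next
  case (insert k L)
  have k: "k \<in> {1..n}" "k \<notin> L" using insert by auto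
  have IH: "bd (lamL L a) = (\<lambda>M. (\<Sum>l\<in>L. sg l L * y l * lamL (L - {l}) a M) + (- 1) ^ card L * lamL L (bd a) M)"
    using insert by auto
  have "bd (lamL (insert k L) a) M = y k * lamL L a M - lam k (bd (lamL L a)) M"
    using bd_lam[OF k(1), of "lamL L a" M] insert by (simp add: lamL_insert algebra_simps)
  also have "lam k (bd (lamL L a)) M = (\<Sum>l\<in>L. sg l L * y l * lam k (lamL (L - {l}) a) M)
      + (- 1) ^ card L * lam k (lamL L (bd a)) M"
    unfolding IH lam_add lam_sum lam_scale ..
  also have "(\<Sum>l\<in>L. sg l L * y l * lam k (lamL (L - {l}) a) M)
      = (\<Sum>l\<in>L. - (sg l (insert k L) * y l * lamL (insert k L - {l}) a M))"
  proof (rule sum.cong)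
    fix l assume l: "l \<in> L"
    then have "k < l" using insert by auto
    then have "insert k L - {l} = insert k (L - {l})" by auto
    moreover have "lamL (insert k (L - {l})) a = lam k (lamL (L - {l}) a)"
      using insert by (intro lamL_insert) auto
    ultimately show "sg l L * y l * lam k (lamL (L - {l}) a) M = - (sg l (insert k L) * y l * lamL (insert k L - {l}) a M)"
      using \<open>k < l\<close> sg_insert[OF k(2), of l, where 'a='a] by simp
  qed simp
  also have "y k * lamL L a M = sg k (insert k L) * y k * lamL (insert k L - {k}) a M"
  proof -
    have "sg k (insert k L) = (1 :: 'a)" using insert by (intro sg_min) (auto simp: less_imp_le)
    then show ?thesis using k by simp
  qed
  also have "lam k (lamL L (bd a)) = lamL (insert k L) (bd a)" using insert by (simp add: lamL_insert)
  finally show ?case using insert k by (simp add: sum_negf)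
qed

text \<open>The exterior product with \<open>z\<close> on the left.\<close>

definition zmult :: "(nat set \<Rightarrow> 'a) \<Rightarrow> (nat set \<Rightarrow> 'a) \<Rightarrow> nat set \<Rightarrow> 'a"
  where "zmult z a M = (\<Sum>L\<in>Pow {1..n}. z L * lamL L a M)"

text \<open>The coefficient of a product at \<open>M\<close> runs over the splittings of
  \<open>M\<close> into \<open>L\<close> and its complement. The signs are fixed before
  \<open>z\<close> and \<open>a\<close>, so they can be ignored when membership in an ideal is
  tested.\<close>

lemma zmult_form: "\<exists>e. (\<forall>L. e L = 1 \<or> e L = - 1) \<and> (\<forall>z a. M \<subseteq> {1..n} \<longrightarrow> zmult z a M = (\<Sum>L\<in>Pow M. e L * z L * a (M - L)))"
proof -
  have "\<forall>L. \<exists>e. L \<subseteq> {1..n} \<longrightarrow> (e = 1 \<or> e = - 1) \<and> (\<forall>a. lamL L a M = (if L \<subseteq> M then e * a (M - L) else 0 :: 'a))"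
  proof (intro allI)
    fix L :: "nat set"
    show "\<exists>e. L \<subseteq> {1..n} \<longrightarrow> (e = 1 \<or> e = - 1) \<and> (\<forall>a. lamL L a M = (if L \<subseteq> M then e * a (M - L) else 0 :: 'a))"
    proof (cases "finite L")
      case True
      from lamL_form[OF True, of M, where 'a='a] show ?thesis by (rule ex_forward) (rule impI)
    qed (use finite_subset[of L "{1..n}"] in auto)
  qed
  then obtain e where e: "\<And>L. L \<subseteq> {1..n} \<Longrightarrow> e L = 1 \<or> e L = - 1"
    "\<And>L a. L \<subseteq> {1..n} \<Longrightarrow> lamL L a M = (if L \<subseteq> M then e L * a (M - L) else 0 :: 'a)" by metis
  define e' where "e' L = (if L \<subseteq> {1..n} then e L else 1)" for L
  have "zmult z a M = (\<Sum>L\<in>Pow M. e' L * z L * a (M - L))" if M: "M \<subseteq> {1..n}" for z a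
  proof -
    have "zmult z a M = (\<Sum>L\<in>Pow {1..n}. if L \<in> Pow M then e' L * z L * a (M - L) else 0)"
      unfolding zmult_def by (intro sum.cong) (auto simp: e(2) e'_def)
    also have "\<dots> = (\<Sum>L\<in>Pow {1..n} \<inter> Pow M. e' L * z L * a (M - L))" by (subst sum.inter_restrict) auto
    also have "Pow {1..n} \<inter> Pow M = Pow M" using M by auto
    finally show ?thesis .
  qed
  moreover have "\<forall>L. e' L = 1 \<or> e' L = - 1" using e(1) by (auto simp: e'_def)
  ultimately show ?thesis by blast
qed

lemma zmult_leibniz:
  assumes "homog i z"
  shows "bd (zmult z a) M = zmult (bd z) a M + (- 1) ^ i * zmult z (bd a) M"
proof -
  let ?P = "Pow {1..n}"
  have fin: "finite L" if "L \<in> ?P" for L using that finite_subset[of L "{1..n}"] by auto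
  have "bd (zmult z a) M = (\<Sum>L\<in>?P. z L * bd (lamL L a) M)"
    unfolding zmult_def[abs_def] bd_sum bd_scale ..
  also have "\<dots> = (\<Sum>L\<in>?P. z L * (\<Sum>l\<in>L. sg l L * y l * lamL (L - {l}) a M)) + (\<Sum>L\<in>?P. (- 1) ^ i * (z L * lamL L (bd a) M))"
    unfolding sum.distrib[symmetric]
  proof (rule sum.cong)
    fix L assume L: "L \<in> ?P"
    show "z L * bd (lamL L a) M = z L * (\<Sum>l\<in>L. sg l L * y l * lamL (L - {l}) a M) + (- 1) ^ i * (z L * lamL L (bd a) M)"
      using assms L fin[OF L] by (cases "z L = 0") (auto simp: bd_lamL homog_def algebra_simps)
  qed simp
  also have "(\<Sum>L\<in>?P. z L * (\<Sum>l\<in>L. sg l L * y l * lamL (L - {l}) a M))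
      = (\<Sum>(L, l)\<in>(SIGMA L:?P. L). z L * (sg l L * y l * lamL (L - {l}) a M))"
    unfolding sum_distrib_left using fin by (intro sum.Sigma) auto
  \<comment> \<open>Each pair of a set and one of its elements is traded for the set without that
    element. Removing \<open>l\<close> does not change the sign of \<open>l\<close> itself, and the
    terms regroup into the coefficients of \<open>bd z\<close>.\<close>
  also have "\<dots> = (\<Sum>(L, l)\<in>(SIGMA L:?P. {1..n} - L). y l * (sg l L * z (insert l L)) * lamL L a M)"
  proof (rule sum.reindex_bij_witness[of _ "\<lambda>(L, l). (insert l L, l)" "\<lambda>(L, l). (L - {l}, l)"], goal_cases)
    case (5 x)
    then obtain L l where x: "x = (L, l)" "l \<in> L" by auto
    then have "insert l (L - {l}) = L" by auto
    moreover have "sg l L = (sg l (L - {l}) :: 'a)" using sg_remove[OF x(2), of l] by simp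
    ultimately show ?case by (simp add: x mult_ac)
  qed auto
  also have "\<dots> = (\<Sum>L\<in>?P. \<Sum>l\<in>{1..n} - L. y l * (sg l L * z (insert l L)) * lamL L a M)"
    by (rule sum.Sigma[symmetric]) auto
  also have "\<dots> = zmult (bd z) a M"
    unfolding zmult_def
  proof (rule sum.cong)
    fix L
    have "bd z L = (\<Sum>l\<in>{1..n} - L. y l * (sg l L * z (insert l L)))"
      unfolding bd_def by (rule sum.mono_neutral_cong_right) (auto simp: iot_def)
    then show "(\<Sum>l\<in>{1..n} - L. y l * (sg l L * z (insert l L)) * lamL L a M) = bd z L * lamL L a M"
      by (simp add: sum_distrib_right)
  qed simp
  also have "(\<Sum>L\<in>?P. (- 1) ^ i * (z L * lamL L (bd a) M)) = (- 1) ^ i * zmult z (bd a) M"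
    by (simp only: zmult_def sum_distrib_left)
  finally show ?thesis .
qed

text \<open>The contracting homotopy read coefficientwise: \<open>e_M\<close> arises only by putting
  \<open>e_r\<close> with \<open>r = Min M\<close> in front of the remaining factors, hence without
  a sign. The guard keeps the support inside \<open>{1..n}\<close>.\<close>

definition hh :: "(nat set \<Rightarrow> 'a) \<Rightarrow> nat set \<Rightarrow> 'a"
  where "hh a M = (if M = {} \<or> \<not> M \<subseteq> {1..n} then 0 else D (Min M) (a (M - {Min M})))"

lemma homog_hh: "homog i a \<Longrightarrow> homog (Suc i) (hh a)"
  unfolding homog_def
proof (intro allI impI)
  fix M assume a: "\<forall>M. a M \<noteq> 0 \<longrightarrow> M \<subseteq> {1..n} \<and> card M = i" and "hh a M \<noteq> 0"
  then have M: "M \<noteq> {}" "M \<subseteq> {1..n}" "a (M - {Min M}) \<noteq> 0" by (auto simp: hh_def D_zero split: if_splits)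
  then have c: "card (M - {Min M}) = i" using a by blast
  have "finite M" using M(2) finite_subset by blast
  then have "card M = Suc i" using card.remove[OF _ Min_in[OF _ M(1)]] c by simp
  with M(2) show "M \<subseteq> {1..n} \<and> card M = Suc i" by simp
qed

lemma Min_range: "M \<noteq> {} \<Longrightarrow> M \<subseteq> {1..n} \<Longrightarrow> Min M \<in> {1..n}"
  using Min_in[of M] finite_subset[of M "{1..n}"] by blast

lemma vc_hh: "vc a \<Longrightarrow> vc (hh a)"
  using D_C Min_range by (auto simp: vc_def hh_def zero_C)

text \<open>Put \<open>m = Min M\<close>. In \<open>bd (hh a)\<close> the indices below
  \<open>m\<close> telescope to \<open>a M - kap m (a M)\<close>. In \<open>hh (bd a)\<close> the
  indices below \<open>m\<close> are killed by \<open>D m\<close>, the index \<open>m\<close>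
  returns \<open>kap m (a M)\<close>, and those above \<open>m\<close> cancel against the rest of
  \<open>bd (hh a)\<close>. For empty \<open>M\<close> the telescope runs to its end and leaves the
  constant term.\<close>

lemma homotopy_identity:
  assumes a: "vc a" and M: "M \<subseteq> {1..n}"
  shows "bd (hh a) M + hh (bd a) M = a M - (if M = {} then cst (ev (a {})) else 0)"
proof (cases "M = {}")
  case True
  have "bd (hh a) {} = (\<Sum>l\<in>{1..n}. y l * D l (a {}))"
    unfolding bd_def by (intro sum.cong) (auto simp: iot_def hh_def sg_def)
  also have "\<dots> = a {} - cst (ev (a {}))"
    using a by (subst telescope) (auto simp: kap_first[simplified] kap_last vc_def)
  finally show ?thesis by (simp add: True hh_def)
next
  case False
  have finM: "finite M" using M finite_subset[of M "{1..n}"] by simp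
  define m where "m = Min M"
  define M' where "M' = M - {m}"
  have m1: "m \<in> M" using Min_in[OF finM False] by (simp add: m_def)
  have m3: "m \<le> j" if "j \<in> M" for j using Min_le[OF finM that] by (simp add: m_def)
  have m4: "m < j" if "j \<in> M'" for j using that m3[of j] by (auto simp: M'_def le_less)
  have m: "m \<in> M" "m \<in> {1..n}" "\<And>j. j \<in> M \<Longrightarrow> m \<le> j" "m \<notin> M'" "M = insert m M'" "\<And>j. j \<in> M' \<Longrightarrow> m < j"
    using m1 m3 m4 M by (auto simp: M'_def)
  let ?T = "\<lambda>l. y l * (sg l M' * D m (a (insert l M')))"
  have D: "hh (bd a) M = D m (bd a M')" using False M by (simp add: hh_def m_def M'_def)
  have split: "{1..n} = {1..m - 1} \<union> {m} \<union> {m<..n}" "{1..m - 1} \<inter> ({m} \<union> {m<..n}) = {}" "{m} \<inter> {m<..n} = {}" using m(2) by auto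
  have sum_split: "(\<Sum>l\<in>{1..n}. f l) = (\<Sum>l\<in>{1..m - 1}. f l) + f m + (\<Sum>l\<in>{m<..n}. f l)" for f :: "nat \<Rightarrow> 'a"
    unfolding split(1) by (subst sum.union_disjoint, simp, simp, use m(2) in auto)+
  have "D m (bd a M') = (\<Sum>l\<in>{1..n}. D m (y l * iot l a M'))" by (simp add: bd_def D_sum)
  also have "\<dots> = kap m (a M) + (\<Sum>l\<in>{m<..n}. D m (y l * iot l a M'))"
  proof -
    have "(\<Sum>l\<in>{1..m - 1}. D m (y l * iot l a M')) = 0"
      by (intro sum.neutral ballI D_y_less) (use m(2) in auto)
    moreover have "iot m a M' = a M" using m sg_min[of M' m, where 'a='a] by (simp add: iot_def less_imp_le)
    ultimately show ?thesis unfolding sum_split by (simp add: D_y_eq[OF m(2)])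
  qed
  also have "(\<Sum>l\<in>{m<..n}. D m (y l * iot l a M')) = (\<Sum>l\<in>{m<..n}. if l \<in> M then 0 else ?T l)"
  proof (rule sum.cong)
    fix l assume l: "l \<in> {m<..n}"
    then have "D m (y l * iot l a M') = y l * D m (iot l a M')" using m(2) by (intro D_y_greater) auto
    then show "D m (y l * iot l a M') = (if l \<in> M then 0 else ?T l)" using l m(5) by (auto simp: iot_def D_sg D_zero)
  qed simp
  finally have hb: "hh (bd a) M = kap m (a M) + (\<Sum>l\<in>{m<..n}. if l \<in> M then 0 else ?T l)" by (simp add: D)
  have "bd (hh a) M = (\<Sum>l\<in>{1..m - 1}. y l * iot l (hh a) M) + (\<Sum>l\<in>{m<..n}. y l * iot l (hh a) M)"
    unfolding bd_def sum_split using m(1) by (simp add: iot_def)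
  also have "(\<Sum>l\<in>{1..m - 1}. y l * iot l (hh a) M) = (\<Sum>l\<in>{1..m - 1}. y l * D l (a M))"
  proof (rule sum.cong)
    fix l assume l: "l \<in> {1..m - 1}"
    then have lM: "l \<notin> M" "\<And>j. j \<in> M \<Longrightarrow> l < j" using m(3) by fastforce+
    then have "Min (insert l M) = l" using finM by (intro Min_eqI) (auto simp: less_imp_le)
    moreover have "insert l M - {l} = M" using lM by auto
    moreover have "l \<in> {1..n}" using l m(2) by auto
    ultimately show "y l * iot l (hh a) M = y l * D l (a M)"
      using lM M sg_min[of M l, where 'a='a] by (simp add: iot_def hh_def less_imp_le)
  qed simp
  also have "\<dots> = a M - kap m (a M)"
  proof -
    have *: "m - 1 \<le> n" "Suc (m - 1) = m" using m(2) by auto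
    show ?thesis using telescope[OF *(1), of "a M"] a unfolding *(2) by (simp add: kap_first[simplified] vc_def)
  qed
  \<comment> \<open>Inserting \<open>l\<close> above \<open>m\<close> keeps the minimum in place,
    and the extra factor \<open>m\<close> of \<open>M\<close> accounts for the opposite
    sign.\<close>
  also have "(\<Sum>l\<in>{m<..n}. y l * iot l (hh a) M) = (\<Sum>l\<in>{m<..n}. - (if l \<in> M then 0 else ?T l))"
  proof (rule sum.cong)
    fix l assume l: "l \<in> {m<..n}"
    show "y l * iot l (hh a) M = - (if l \<in> M then 0 else ?T l)"
    proof (cases "l \<in> M")
      case nM: False
      have "Min (insert l M) = m" using finM l m by (intro Min_eqI) auto
      moreover have "insert l M - {m} = insert l M'" using l m by auto
      moreover have "insert l M \<subseteq> {1..n}" using l m(2) M by auto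
      moreover have "sg l M = (- sg l M' :: 'a)" using l sg_insert[OF m(4), of l, where 'a='a] m(5) by simp
      ultimately show ?thesis using nM by (simp add: iot_def hh_def)
    qed (simp add: iot_def)
  qed simp
  finally show ?thesis using False by (simp add: hb sum_negf)
qed

end

section \<open>Bases of Koszul homology\<close>

context augmented_subring
begin

lemma cst_sum: "cst (\<Sum>x\<in>X. f x) = (\<Sum>x\<in>X. cst (f x))"
  by (induction X rule: infinite_finite_induct) (auto simp: cst_zero cst_add)

lemma cst_diff: "cst (c - d) = cst c - cst d"
  using cst_add[of c "- d"] by (simp add: cst_minus)

lemma basis_mod:
  fixes B :: "('x \<Rightarrow> 'a) set"
  assumes B: "\<And>a b. a \<in> B \<Longrightarrow> b \<in> B \<Longrightarrow> (\<lambda>x. a x + b x) \<in> B" "\<And>c a. a \<in> B \<Longrightarrow> (\<lambda>x. cst c * a x) \<in> B"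
    and G: "finite G" "\<And>z. z \<in> Z \<Longrightarrow> \<exists>c. (\<lambda>x. z x - (\<Sum>g\<in>G. cst (c g) * g x)) \<in> B"
  shows "\<exists>V\<subseteq>G. (\<forall>z\<in>Z. \<exists>c. (\<lambda>x. z x - (\<Sum>g\<in>V. cst (c g) * g x)) \<in> B)
    \<and> (\<forall>c. (\<lambda>x. \<Sum>g\<in>V. cst (c g) * g x) \<in> B \<longrightarrow> (\<forall>g\<in>V. c g = 0))"
  using G
proof (induction G rule: finite_psubset_induct)
  case (psubset V)
  show ?case
  proof (cases "\<forall>c. (\<lambda>x. \<Sum>g\<in>V. cst (c g) * g x) \<in> B \<longrightarrow> (\<forall>g\<in>V. c g = 0)")
    case True
    with psubset show ?thesis by blast
  next
    case False
    then obtain c k where c: "(\<lambda>x. \<Sum>g\<in>V. cst (c g) * g x) \<in> B" "k \<in> V" "c k \<noteq> 0" by blast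
    have "\<exists>c. (\<lambda>x. z x - (\<Sum>g\<in>V - {k}. cst (c g) * g x)) \<in> B" if z: "z \<in> Z" for z
    proof -
      obtain c' where c': "(\<lambda>x. z x - (\<Sum>g\<in>V. cst (c' g) * g x)) \<in> B" using psubset.prems[OF z] by blast
      \<comment> \<open>With this multiple of the dependency subtracted, the coefficient at
        \<open>k\<close> becomes zero.\<close>
      define t where "t = c' k / c k"
      have "(\<Sum>g\<in>V - {k}. cst (c' g - t * c g) * g x) = (\<Sum>g\<in>V. cst (c' g - t * c g) * g x)" for x
        using c psubset.hyps by (subst (2) sum.remove[of _ k]) (auto simp: t_def cst_zero)
      moreover have "(\<Sum>g\<in>V. cst (c' g - t * c g) * g x)
          = (\<Sum>g\<in>V. cst (c' g) * g x) - cst t * (\<Sum>g\<in>V. cst (c g) * g x)" for x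
      proof -
        have "cst (c' g - t * c g) * g x = cst (c' g) * g x - cst t * (cst (c g) * g x)" for g :: "'x \<Rightarrow> 'a"
          by (simp add: cst_diff cst_mult algebra_simps)
        then show ?thesis by (simp add: sum_subtractf sum_distrib_left)
      qed
      ultimately have "(\<lambda>x. z x - (\<Sum>g\<in>V - {k}. cst (c' g - t * c g) * g x))
          = (\<lambda>x. (z x - (\<Sum>g\<in>V. cst (c' g) * g x)) + cst t * (\<Sum>g\<in>V. cst (c g) * g x))"
        by (simp add: fun_eq_iff)
      then have "(\<lambda>x. z x - (\<Sum>g\<in>V - {k}. cst (c' g - t * c g) * g x)) \<in> B"
        using B(1)[OF c' B(2)[OF c(1), of t]] by simp
      then show ?thesis by (rule exI[of _ "\<lambda>g. c' g - t * c g"])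
    qed
    moreover have "V - {k} \<subset> V" using c(2) by blast
    ultimately obtain V' where "V' \<subseteq> V - {k}" "(\<forall>z\<in>Z. \<exists>c. (\<lambda>x. z x - (\<Sum>g\<in>V'. cst (c g) * g x)) \<in> B)
        \<and> (\<forall>c. (\<lambda>x. \<Sum>g\<in>V'. cst (c g) * g x) \<in> B \<longrightarrow> (\<forall>g\<in>V'. c g = 0))"
      using psubset.IH[of "V - {k}"] by blast
    moreover have "V' \<subseteq> V" using calculation(1) by blast
    ultimately show ?thesis by blast
  qed
qed

end

context koszul
begin

text \<open>Finite generation of submodules of a free module, by induction on the coordinates: lifts
  \<open>l\<close> of generators of the ideal of values at \<open>x0\<close>, together with
  generators of the part that vanishes at \<open>x0\<close>.\<close>

lemma noetherian_vectors:
  assumes "finite X" and "\<And>z. z \<in> Z \<Longrightarrow> vc z" "(\<lambda>_. 0) \<in> Z"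
    "\<And>a b. a \<in> Z \<Longrightarrow> b \<in> Z \<Longrightarrow> (\<lambda>x. a x + b x) \<in> Z" "\<And>c a. c \<in> C \<Longrightarrow> a \<in> Z \<Longrightarrow> (\<lambda>x. c * a x) \<in> Z"
  shows "\<exists>G. finite G \<and> G \<subseteq> Z \<and> (\<forall>z\<in>Z. \<exists>q. (\<forall>g\<in>G. q g \<in> C) \<and> (\<forall>x\<in>X. z x = (\<Sum>g\<in>G. q g * g x)))"
  using assms
proof (induction X arbitrary: Z rule: finite_induct)
  case empty
  then show ?case by (intro exI[of _ "{}"]) auto
next
  case (insert x0 X)
  note Z = insert.prems
  define I where "I = (\<lambda>z. z x0) ` Z"
  have "\<exists>G. finite G \<and> G \<subseteq> I \<and> (\<forall>a\<in>I. \<exists>q. (\<forall>g\<in>G. q g \<in> C) \<and> a = (\<Sum>g\<in>G. q g * g))"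
  proof (rule noetherian)
    show "I \<subseteq> C" using Z(1) by (auto simp: I_def vc_def)
    show "0 \<in> I" using Z(2) by (force simp: I_def)
    show "a + b \<in> I" if ab: "a \<in> I" "b \<in> I" for a b
    proof -
      obtain u v where "u \<in> Z" "v \<in> Z" "a = u x0" "b = v x0" using ab by (auto simp: I_def)
      with Z(3)[of u v] show ?thesis unfolding I_def by (intro image_eqI[of _ _ "\<lambda>x. u x + v x"]) auto
    qed
    show "c * a \<in> I" if ca: "c \<in> C" "a \<in> I" for c a
    proof -
      obtain u where "u \<in> Z" "a = u x0" using ca by (auto simp: I_def)
      with Z(4)[OF ca(1), of u] show ?thesis unfolding I_def by (intro image_eqI[of _ _ "\<lambda>x. c * u x"]) auto
    qed
  qed
  then obtain G0 where G0: "finite G0" "G0 \<subseteq> I" "\<And>a. a \<in> I \<Longrightarrow> \<exists>q. (\<forall>g\<in>G0. q g \<in> C) \<and> a = (\<Sum>g\<in>G0. q g * g)" by blast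
  have "\<forall>g\<in>G0. \<exists>z. z \<in> Z \<and> z x0 = g" using G0(2) by (auto simp: I_def)
  then obtain l where l: "\<And>g. g \<in> G0 \<Longrightarrow> l g \<in> Z" "\<And>g. g \<in> G0 \<Longrightarrow> l g x0 = g" by metis
  define Z' where "Z' = {z \<in> Z. z x0 = 0}"
  have "\<exists>G. finite G \<and> G \<subseteq> Z' \<and> (\<forall>z\<in>Z'. \<exists>q. (\<forall>g\<in>G. q g \<in> C) \<and> (\<forall>x\<in>X. z x = (\<Sum>g\<in>G. q g * g x)))"
    by (rule insert.IH) (use Z in \<open>auto simp: Z'_def\<close>)
  then obtain G2 where G2: "finite G2" "G2 \<subseteq> Z'"
    "\<And>z. z \<in> Z' \<Longrightarrow> \<exists>q. (\<forall>g\<in>G2. q g \<in> C) \<and> (\<forall>x\<in>X. z x = (\<Sum>g\<in>G2. q g * g x))" by blast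
  let ?G = "l ` G0 \<union> G2"
  have "\<exists>q. (\<forall>g\<in>?G. q g \<in> C) \<and> (\<forall>x\<in>insert x0 X. z x = (\<Sum>g\<in>?G. q g * g x))" if z: "z \<in> Z" for z
  proof -
    obtain q where q: "\<And>g. g \<in> G0 \<Longrightarrow> q g \<in> C" "z x0 = (\<Sum>g\<in>G0. q g * g)"
      using G0(3)[of "z x0"] z by (auto simp: I_def)
    have sumZ: "(\<lambda>x. \<Sum>g\<in>F. - q g * l g x) \<in> Z" if "F \<subseteq> G0" for F
      using finite_subset[OF that G0(1)] that
    proof (induction F rule: finite_induct)
      case (insert g F)
      have "(\<lambda>x. - q g * l g x) \<in> Z" using insert q(1) l(1) by (intro Z(4)) (auto intro: uminus_C)
      from Z(3)[OF this] insert show ?case by simp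
    qed (simp add: Z(2))
    define w where "w = (\<lambda>x. z x + (\<Sum>g\<in>G0. - q g * l g x))"
    have "w \<in> Z" unfolding w_def using Z(3)[OF z sumZ] by simp
    moreover have "w x0 = 0" using q(2) l(2) by (simp add: w_def sum_negf)
    ultimately obtain p where p: "\<And>g. g \<in> G2 \<Longrightarrow> p g \<in> C" "\<And>x. x \<in> X \<Longrightarrow> w x = (\<Sum>g\<in>G2. p g * g x)"
      using G2(3)[of w] by (auto simp: Z'_def)
    have wx: "w x = (\<Sum>g\<in>G2. p g * g x)" if "x \<in> insert x0 X" for x
    proof (cases "x \<in> X")
      case False
      then have "x = x0" using that by simp
      moreover have "(\<Sum>g\<in>G2. p g * g x0) = 0" using G2(2) by (intro sum.neutral) (auto simp: Z'_def)
      ultimately show ?thesis using \<open>w x0 = 0\<close> by simp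
    qed (rule p(2))
    \<comment> \<open>The two generating sets may overlap, so their coefficients are added; a lift
      \<open>k\<close> belongs to the generator \<open>k x0\<close>.\<close>
    define r where "r = (\<lambda>k. (if k \<in> l ` G0 then q (k x0) else 0) + (if k \<in> G2 then p k else 0))"
    have rC: "\<forall>g\<in>?G. r g \<in> C" using q(1) p(1) l(2) by (auto simp: r_def C_intros)
    have "(\<Sum>k\<in>?G. r k * k x) = z x" if x: "x \<in> insert x0 X" for x
    proof -
      have "(\<Sum>k\<in>?G. r k * k x) = (\<Sum>k\<in>?G. (if k \<in> l ` G0 then q (k x0) * k x else 0)) + (\<Sum>k\<in>?G. if k \<in> G2 then p k * k x else 0)"
        unfolding sum.distrib[symmetric] by (intro sum.cong) (auto simp: r_def distrib_right)
      also have "(\<Sum>k\<in>?G. (if k \<in> l ` G0 then q (k x0) * k x else 0)) = (\<Sum>k\<in>l ` G0. q (k x0) * k x)"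
        using G0(1) G2(1) by (intro sum.mono_neutral_cong_right) auto
      also have "\<dots> = (\<Sum>g\<in>G0. q g * l g x)"
        using l(2) by (subst sum.reindex) (auto simp: inj_on_def intro!: sum.cong dest: arg_cong[where f = "\<lambda>k. k x0"])
      also have "(\<Sum>k\<in>?G. if k \<in> G2 then p k * k x else 0) = (\<Sum>k\<in>G2. p k * k x)"
        using G0(1) G2(1) by (intro sum.mono_neutral_cong_right) auto
      also have "(\<Sum>k\<in>G2. p k * k x) = w x" using wx[OF x] by simp
      finally show ?thesis by (simp add: w_def sum_negf)
    qed
    with rC show ?thesis by metis
  qed
  moreover have "finite ?G" "?G \<subseteq> Z" using G0 G2 l by (auto simp: Z'_def)
  ultimately show ?case by blast
qed

lemma homog_add: "homog i a \<Longrightarrow> homog i b \<Longrightarrow> homog i (\<lambda>M. a M + b M)"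
  unfolding homog_def by (metis add.right_neutral)

lemma homog_scale: "homog i a \<Longrightarrow> homog i (\<lambda>M. c * a M)"
  unfolding homog_def by (metis mult_zero_right)

lemma homog_zero: "homog i (\<lambda>M. 0)"
  by (simp add: homog_def)

lemma lam_in_idl: "idl I \<Longrightarrow> (\<And>M. M \<subseteq> {1..n} \<Longrightarrow> a M \<in> I) \<Longrightarrow> M \<subseteq> {1..n} \<Longrightarrow> lam k a M \<in> I"
proof (cases "k \<in> M")
  case True
  assume I: "idl I" and a: "\<And>M. M \<subseteq> {1..n} \<Longrightarrow> a M \<in> I" and M: "M \<subseteq> {1..n}"
  have "a (M - {k}) \<in> I" by (rule a) (use M in blast)
  then show ?thesis using True idlD(4)[OF I sg_C] by (simp add: lam_def)
qed (simp add: lam_def idlD)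

text \<open>The full telescoping sum: modulo the variables every element is its constant term, with
  the \<open>D r q\<close> as explicit quotients.\<close>

lemma decompose: "q \<in> C \<Longrightarrow> q = cst (ev q) + (\<Sum>r\<in>{1..n}. D r q * y r)"
  using telescope[of n q] by (simp add: kap_first[simplified] kap_last mult.commute)

text \<open>Cycles modulo \<open>I\<close> are finitely generated over \<open>C\<close>; variables
  carry cycles to boundaries, so by \<open>decompose\<close> the field span of the generators
  already covers homology; \<open>hh\<close> moves generators into \<open>J\<close> within their
  classes; elimination makes them independent. Degrees start at \<open>Suc i\<close> because the
  homotopy identity has an extra constant term in degree 0.\<close>

lemma koszul_basis:
  assumes I: "idl I" and J0: "0 \<in> J" and J: "\<And>r a. r \<in> {1..n} \<Longrightarrow> a \<in> I \<Longrightarrow> D r a \<in> J"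
  obtains V where "finite V"
    "\<And>v. v \<in> V \<Longrightarrow> vc v \<and> homog (Suc i) v \<and> (\<forall>M. v M \<in> J) \<and> (\<forall>M\<subseteq>{1..n}. bd v M \<in> I)"
    "\<And>a. vc a \<Longrightarrow> homog (Suc i) a \<Longrightarrow> \<forall>M\<subseteq>{1..n}. bd a M \<in> I \<Longrightarrow>
      \<exists>c g. vc g \<and> homog (Suc (Suc i)) g \<and> eqm I (Pow {1..n}) a (\<lambda>M. (\<Sum>v\<in>V. cst (c v) * v M) + bd g M)"
    "\<And>c g v. vc g \<Longrightarrow> homog (Suc (Suc i)) g \<Longrightarrow> eqm I (Pow {1..n}) (\<lambda>M. \<Sum>v\<in>V. cst (c v) * v M) (bd g) \<Longrightarrow> v \<in> V \<Longrightarrow> c v = 0"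
proof -
  let ?P = "Pow {1..n}"
  define Z where "Z = {a. vc a \<and> homog (Suc i) a \<and> (\<forall>M\<subseteq>{1..n}. bd a M \<in> I)}"
  define B where "B = {b. \<exists>g. vc g \<and> homog (Suc (Suc i)) g \<and> eqm I ?P b (bd g)}"
  have B_add: "(\<lambda>x. a x + b x) \<in> B" if ab: "a \<in> B" "b \<in> B" for a b
  proof -
    obtain g h where "vc g" "homog (Suc (Suc i)) g" "eqm I ?P a (bd g)" "vc h" "homog (Suc (Suc i)) h" "eqm I ?P b (bd h)"
      using ab by (auto simp: B_def)
    then have "vc (\<lambda>M. g M + h M) \<and> homog (Suc (Suc i)) (\<lambda>M. g M + h M) \<and> eqm I ?P (\<lambda>x. a x + b x) (bd (\<lambda>M. g M + h M))"
      by (auto simp: bd_add vc_add homog_add intro: eqm_add[OF I])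
    then show ?thesis by (auto simp: B_def)
  qed
  have B_scale: "(\<lambda>x. c * a x) \<in> B" if ca: "c \<in> C" "a \<in> B" for c a
  proof -
    obtain g where g: "vc g" "homog (Suc (Suc i)) g" "eqm I ?P a (bd g)" using ca by (auto simp: B_def)
    have "eqm I ?P (\<lambda>x. c * a x) (\<lambda>x. c * bd g x)"
      using g(3) ca(1) unfolding eqm_def by (auto simp: right_diff_distrib[symmetric] intro: idlD(4)[OF I])
    then have "vc (\<lambda>M. c * g M) \<and> homog (Suc (Suc i)) (\<lambda>M. c * g M) \<and> eqm I ?P (\<lambda>x. c * a x) (bd (\<lambda>M. c * g M))"
      using g ca(1) by (auto simp: bd_scale homog_scale vc_def C_intros)
    then show ?thesis by (auto simp: B_def)
  qed
  have B_cong: "b \<in> B" if "eqm I ?P a b" "a \<in> B" for a b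
    using that eqm_trans[OF I eqm_sym[OF I]] unfolding B_def by blast
  have B_I: "b \<in> B" if "\<And>M. M \<subseteq> {1..n} \<Longrightarrow> b M \<in> I" for b
    unfolding B_def using that
    by (intro CollectI exI[of _ "\<lambda>_. 0"] conjI homog_zero) (simp_all add: eqm_def bd_zero vc_def zero_C)
  have B_bd: "bd g \<in> B" if "vc g" "homog (Suc (Suc i)) g" for g
    using that eqm_refl[OF I] by (auto simp: B_def)
  have B_sum: "(\<lambda>x. \<Sum>k\<in>F. f k x) \<in> B" if "\<And>k. k \<in> F \<Longrightarrow> f k \<in> B" for F :: "'z set" and f
    using that
  proof (induction F rule: infinite_finite_induct)
    case (insert k F)
    then show ?case using B_add[of "f k" "\<lambda>x. \<Sum>k\<in>F. f k x"] by simp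
  qed (auto intro: B_I simp: idlD[OF I])
  \<comment> \<open>\<open>bd_lam\<close> writes the multiple as a boundary plus
    \<open>lam r (bd a)\<close>, and the latter has entries in \<open>I\<close>.\<close>
  have B_y: "(\<lambda>x. y r * a x) \<in> B" if r: "r \<in> {1..n}" and a: "a \<in> Z" for r a
  proof -
    have a': "vc a" "homog (Suc i) a" "\<And>M. M \<subseteq> {1..n} \<Longrightarrow> bd a M \<in> I" using a by (auto simp: Z_def)
    have 1: "bd (lam r a) \<in> B"
      using a'(1) by (intro B_bd homog_lam r a') (auto simp: vc_def lam_def intro!: C_intros sg_C)
    have 2: "lam r (bd a) \<in> B" by (intro B_I lam_in_idl[OF I] a')
    have "(\<lambda>x. bd (lam r a) x + lam r (bd a) x) = (\<lambda>x. y r * a x)" using bd_lam[OF r] by simp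
    with B_add[OF 1 2] show ?thesis by simp
  qed
  have Z: "(\<lambda>_. 0) \<in> Z" "\<And>z. z \<in> Z \<Longrightarrow> vc z"
    "\<And>a b. a \<in> Z \<Longrightarrow> b \<in> Z \<Longrightarrow> (\<lambda>x. a x + b x) \<in> Z" "\<And>c a. c \<in> C \<Longrightarrow> a \<in> Z \<Longrightarrow> (\<lambda>x. c * a x) \<in> Z"
  proof -
    show "(\<lambda>_. 0) \<in> Z" by (simp add: Z_def homog_zero bd_zero idlD(2)[OF I] vc_def zero_C)
    show "vc z" if "z \<in> Z" for z using that by (simp add: Z_def)
    show "(\<lambda>x. a x + b x) \<in> Z" if "a \<in> Z" "b \<in> Z" for a b
      using that by (simp add: Z_def bd_add vc_add homog_add idlD(3)[OF I])
    show "(\<lambda>x. c * a x) \<in> Z" if "c \<in> C" "a \<in> Z" for c a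
      using that by (simp add: Z_def bd_scale homog_scale idlD(4)[OF I] vc_def mult_C)
  qed
  have finP: "finite ?P" by simp
  from noetherian_vectors[OF finP Z(2,1,3,4)] obtain G where G': "finite G \<and> G \<subseteq> Z
    \<and> (\<forall>z\<in>Z. \<exists>q. (\<forall>g\<in>G. q g \<in> C) \<and> (\<forall>x\<in>?P. z x = (\<Sum>g\<in>G. q g * g x)))" ..
  have G: "finite G" "G \<subseteq> Z" using G' by simp_all
  have G3: "\<exists>q. (\<forall>g\<in>G. q g \<in> C) \<and> (\<forall>x\<in>?P. z x = (\<Sum>g\<in>G. q g * g x))" if "z \<in> Z" for z
    using G' that by simp
  define p where "p = (\<lambda>g. hh (bd g))"
  have p: "p g \<in> Z" "\<And>M. p g M \<in> J" "(\<lambda>x. g x - p g x) \<in> B" if g: "g \<in> Z" for g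
  proof -
    have g': "vc g" "homog (Suc i) g" "\<And>M. M \<subseteq> {1..n} \<Longrightarrow> bd g M \<in> I" using g by (auto simp: Z_def)
    have "g {} = 0" using g'(2) by (auto simp: homog_def)
    then have id: "bd (hh g) M + p g M = g M" if "M \<subseteq> {1..n}" for M
      using homotopy_identity[OF g'(1) that] by (simp add: p_def ev_zero cst_zero)
    then have "eqm {0} ?P (\<lambda>x. bd (hh g) x + p g x) g" by (auto simp: eqm_def)
    from eqm_bd[OF idl_zero this] have "bd (p g) M = bd g M" if "M \<subseteq> {1..n}" for M
      using that by (auto simp: eqm_def bd_add bd_bd)
    then show "p g \<in> Z" unfolding Z_def using g' by (auto simp: p_def intro!: vc_hh vc_bd homog_hh homog_bd)
    show "p g M \<in> J" for M
    proof (cases "M = {} \<or> \<not> M \<subseteq> {1..n}")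
      case False
      then have "bd g (M - {Min M}) \<in> I" by (intro g'(3)) auto
      then show ?thesis using J[OF Min_range] False by (simp add: p_def hh_def)
    qed (auto simp: p_def hh_def J0)
    have "eqm I ?P (bd (hh g)) (\<lambda>x. g x - p g x)" using id by (auto simp: eqm_def idlD[OF I] algebra_simps)
    from B_cong[OF this B_bd[OF vc_hh[OF g'(1)] homog_hh[OF g'(2)]]]
    show "(\<lambda>x. g x - p g x) \<in> B" .
  qed
  have span: "\<exists>c. (\<lambda>x. z x - (\<Sum>k\<in>p ` G. cst (c k) * k x)) \<in> B" if z: "z \<in> Z" for z
  proof -
    obtain q where q: "\<And>g. g \<in> G \<Longrightarrow> q g \<in> C" "\<And>x. x \<in> ?P \<Longrightarrow> z x = (\<Sum>g\<in>G. q g * g x)"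
      using G3[OF z] by blast
    \<comment> \<open>\<open>p\<close> may identify generators, so the coefficients of all
      \<open>g\<close> with the same image are added.\<close>
    define c where "c = (\<lambda>k. \<Sum>g\<in>{g \<in> G. p g = k}. ev (q g))"
    have c: "(\<Sum>k\<in>p ` G. cst (c k) * k x) = (\<Sum>g\<in>G. cst (ev (q g)) * p g x)" for x
      by (subst sum.image_gen[OF G(1), of _ p]) (auto simp: c_def cst_sum sum_distrib_right intro!: sum.cong)
    let ?b = "\<lambda>x. (\<Sum>g\<in>G. \<Sum>r\<in>{1..n}. D r (q g) * (y r * g x)) + (\<Sum>g\<in>G. cst (ev (q g)) * (g x - p g x))"
    have "(\<lambda>x. \<Sum>g\<in>G. \<Sum>r\<in>{1..n}. D r (q g) * (y r * g x)) \<in> B"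
      by (rule B_sum, rule B_sum, rule B_scale[OF D_C B_y]) (use q(1) G(2) in blast)+
    moreover have "(\<lambda>x. \<Sum>g\<in>G. cst (ev (q g)) * (g x - p g x)) \<in> B"
      by (rule B_sum, rule B_scale[OF cst_C p(3)]) (use G(2) in blast)
    ultimately have bB: "?b \<in> B" by (rule B_add)
    have b: "?b x = z x - (\<Sum>k\<in>p ` G. cst (c k) * k x)" if x: "x \<in> ?P" for x
    proof -
      have "z x = (\<Sum>g\<in>G. (cst (ev (q g)) + (\<Sum>r\<in>{1..n}. D r (q g) * y r)) * g x)"
        unfolding q(2)[OF x] by (intro sum.cong refl arg_cong[where f = "\<lambda>t. t * _"] decompose q(1))
      then show ?thesis unfolding c
        by (simp add: distrib_right sum.distrib right_diff_distrib sum_subtractf sum_distrib_right mult.assoc)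
    qed
    have "eqm I ?P ?b (\<lambda>x. z x - (\<Sum>k\<in>p ` G. cst (c k) * k x))"
      unfolding eqm_def
    proof
      fix x assume "x \<in> ?P"
      from b[OF this] show "?b x - (z x - (\<Sum>k\<in>p ` G. cst (c k) * k x)) \<in> I" by (simp only: diff_self idlD(2)[OF I])
    qed
    from B_cong[OF this bB] show ?thesis by (rule exI[of _ c])
  qed
  have "\<exists>V\<subseteq>p ` G. (\<forall>z\<in>Z. \<exists>c. (\<lambda>x. z x - (\<Sum>g\<in>V. cst (c g) * g x)) \<in> B)
    \<and> (\<forall>c. (\<lambda>x. \<Sum>g\<in>V. cst (c g) * g x) \<in> B \<longrightarrow> (\<forall>g\<in>V. c g = 0))"
    by (rule basis_mod[OF B_add B_scale[OF cst_C] finite_imageI[OF G(1)] span])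
  then obtain V where V: "V \<subseteq> p ` G" "\<And>z. z \<in> Z \<Longrightarrow> \<exists>c. (\<lambda>x. z x - (\<Sum>g\<in>V. cst (c g) * g x)) \<in> B"
    "\<And>c g. (\<lambda>x. \<Sum>g\<in>V. cst (c g) * g x) \<in> B \<Longrightarrow> g \<in> V \<Longrightarrow> c g = 0"
    by blast
  show ?thesis
  proof
    show "finite V" using V(1) G(1) finite_subset by blast
    show "vc v \<and> homog (Suc i) v \<and> (\<forall>M. v M \<in> J) \<and> (\<forall>M\<subseteq>{1..n}. bd v M \<in> I)" if v: "v \<in> V" for v
    proof -
      obtain g where g: "g \<in> Z" "v = p g" using v V(1) G(2) by blast
      show ?thesis using p(1,2)[OF g(1)] g(2) by (simp add: Z_def)
    qed
    show "\<exists>c g. vc g \<and> homog (Suc (Suc i)) g \<and> eqm I ?P a (\<lambda>M. (\<Sum>v\<in>V. cst (c v) * v M) + bd g M)"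
      if a: "vc a" "homog (Suc i) a" "\<forall>M\<subseteq>{1..n}. bd a M \<in> I" for a
    proof -
      obtain c where "(\<lambda>x. a x - (\<Sum>g\<in>V. cst (c g) * g x)) \<in> B" using V(2)[of a] a by (auto simp: Z_def)
      then obtain g where g: "vc g" "homog (Suc (Suc i)) g" "eqm I ?P (\<lambda>x. a x - (\<Sum>g\<in>V. cst (c g) * g x)) (bd g)"
        by (auto simp: B_def)
      then have "eqm I ?P a (\<lambda>M. (\<Sum>v\<in>V. cst (c v) * v M) + bd g M)" by (simp add: eqm_def algebra_simps)
      with g show ?thesis by blast
    qed
    show "c v = 0" if "vc g" "homog (Suc (Suc i)) g" "eqm I ?P (\<lambda>M. \<Sum>v\<in>V. cst (c v) * v M) (bd g)" "v \<in> V" for c g v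
      using V(3)[of c v] that by (auto simp: B_def)
  qed
qed

end

section \<open>The Golod complex\<close>

text \<open>A letter keeps the index \<open>i\<close> of its set \<open>V i\<close> so that its
  degree is visible. Words are stored backwards: the head of the list is the tensor factor next to
  the Koszul complex.\<close>

type_synonym 'a word = "(nat \<times> (nat set \<Rightarrow> 'a)) list"

text \<open>\<open>V i\<close> holds cycles of Koszul degree \<open>Suc i\<close>; the class of 1 in
  degree 0 gives no letter. \<open>J_J\<close> carries the square condition and is spent in
  \<open>dF_dF\<close>.\<close>

locale golod = koszul C cst ev n y D kap
  for C :: "'a::comm_ring_1 set" and cst :: "'k::field \<Rightarrow> 'a" and ev :: "'a \<Rightarrow> 'k"
    and n :: nat and y :: "nat \<Rightarrow> 'a" and D :: "nat \<Rightarrow> 'a \<Rightarrow> 'a" and kap :: "nat \<Rightarrow> 'a \<Rightarrow> 'a" +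
  fixes I J :: "'a set" and V :: "nat \<Rightarrow> (nat set \<Rightarrow> 'a) set"
  assumes idl_I: "idl I" and idl_J: "idl J" and J_J: "p \<in> J \<Longrightarrow> q \<in> J \<Longrightarrow> p * q \<in> I"
    and V_finite: "finite (V i)"
    and V_cycle: "v \<in> V i \<Longrightarrow> vc v \<and> homog (Suc i) v \<and> (\<forall>M. v M \<in> J) \<and> (\<forall>M\<subseteq>{1..n}. bd v M \<in> I)"
    and V_span: "vc a \<Longrightarrow> homog (Suc i) a \<Longrightarrow> \<forall>M\<subseteq>{1..n}. bd a M \<in> I \<Longrightarrow>
      \<exists>c g. vc g \<and> homog (Suc (Suc i)) g \<and> eqm I (Pow {1..n}) a (\<lambda>M. (\<Sum>v\<in>V i. cst (c v) * v M) + bd g M)"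
    and V_indep: "vc g \<Longrightarrow> homog (Suc (Suc i)) g
      \<Longrightarrow> eqm I (Pow {1..n}) (\<lambda>M. \<Sum>v\<in>V i. cst (c v) * v M) (bd g) \<Longrightarrow> v \<in> V i \<Longrightarrow> c v = 0"
begin

text \<open>Above degree \<open>n\<close> all chains vanish, so a member of \<open>V i\<close> would
  give a dependency with coefficients 1. Hence the alphabet \<open>Lt\<close> is finite.\<close>

lemma V_empty: "n \<le> i \<Longrightarrow> V i = {}"
proof (rule ccontr)
  assume i: "n \<le> i" and "V i \<noteq> {}"
  then obtain v where v: "v \<in> V i" by blast
  have z: "u M = 0" if "u \<in> V i" for u M
  proof (rule ccontr)
    assume "u M \<noteq> 0"
    then have "M \<subseteq> {1..n}" "card M = Suc i" using V_cycle[OF that] by (auto simp: homog_def)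
    then show False using card_mono[of "{1..n}" M] i by simp
  qed
  have "(\<Sum>v\<in>V i. cst 1 * v M) = 0" for M by (intro sum.neutral) (simp add: z)
  then have "eqm I (Pow {1..n}) (\<lambda>M. \<Sum>v\<in>V i. cst 1 * v M) (bd (\<lambda>_. 0))"
    by (simp add: bd_zero eqm_def idlD(2)[OF idl_I])
  from V_indep[OF _ homog_zero this v] show False by (simp add: vc_def zero_C)
qed

definition Lt :: "(nat \<times> (nat set \<Rightarrow> 'a)) set"
  where "Lt = Sigma {..<n} V"

lemma in_Lt: "(i, v) \<in> Lt \<longleftrightarrow> v \<in> V i"
  using V_empty[of i] by (auto simp: Lt_def not_le[symmetric])

lemma finite_Lt: "finite Lt"
  using V_finite by (simp add: Lt_def)

text \<open>A cycle in \<open>V i\<close> has degree \<open>i + 1\<close>, and the shift in the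
  tensor algebra adds one.\<close>

definition wdeg :: "'a word \<Rightarrow> nat"
  where "wdeg w = (\<Sum>v\<leftarrow>w. fst v + 2)"

lemma wdeg_simps [simp]: "wdeg [] = 0" "wdeg (v # w) = fst v + 2 + wdeg w"
  by (simp_all add: wdeg_def)

lemma length_le_wdeg: "length w \<le> wdeg w"
  by (induction w) auto

text \<open>\<open>f w\<close> is the Koszul coefficient of the word \<open>w\<close>. The
  coefficient at \<open>w\<close> receives its own boundary and, from each word
  \<open>v # w\<close>, the product with the cycle of the head letter.\<close>

definition dF :: "('a word \<Rightarrow> nat set \<Rightarrow> 'a) \<Rightarrow> 'a word \<Rightarrow> nat set \<Rightarrow> 'a"
  where "dF f w M = (- 1) ^ wdeg w * bd (f w) M + (\<Sum>v\<in>Lt. zmult (snd v) (f (v # w)) M)"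

definition supp :: "nat \<Rightarrow> ('a word \<Rightarrow> nat set \<Rightarrow> 'a) \<Rightarrow> bool"
  where "supp N f \<longleftrightarrow> (\<forall>w M. f w M \<noteq> 0 \<longrightarrow> set w \<subseteq> Lt \<and> M \<subseteq> {1..n} \<and> wdeg w + card M = N)"

definition vcw :: "('a word \<Rightarrow> nat set \<Rightarrow> 'a) \<Rightarrow> bool"
  where "vcw f \<longleftrightarrow> (\<forall>w. vc (f w))"

section \<open>Calculus of the exterior product and of the word differential\<close>

lemma idl_mult_right: "idl Q \<Longrightarrow> a \<in> Q \<Longrightarrow> c \<in> C \<Longrightarrow> a * c \<in> Q"
  using idlD(4)[of Q c a] by (simp add: mult.commute)

lemma lamL_formE:
  assumes "finite L"
  obtains e :: 'a where "e = 1 \<or> e = - 1" "\<And>a. lamL L a M = (if L \<subseteq> M then e * a (M - L) else 0)"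
  using lamL_form[OF assms, of M, where 'a='a] by (elim exE conjE) (simp only: simp_thms)

lemma lamL_lin:
  fixes a b :: "nat set \<Rightarrow> 'a"
  assumes "finite L"
  shows "lamL L (\<lambda>M. a M + b M) M = lamL L a M + lamL L b M"
    and "lamL L (\<lambda>M. c * a M) M = c * lamL L a M"
  by (rule lamL_formE[OF assms, of M], simp add: algebra_simps)+

lemma zmult_add: "zmult z (\<lambda>M. a M + b M) M = zmult z a M + zmult z b M"
  and zmult_scale: "zmult z (\<lambda>M. c * a M) M = c * zmult z a M"
proof -
  have fin: "finite L" if "L \<in> Pow {1..n}" for L using that finite_subset[of L "{1..n}"] by auto
  show "zmult z (\<lambda>M. a M + b M) M = zmult z a M + zmult z b M"
    unfolding zmult_def sum.distrib[symmetric] using fin by (intro sum.cong) (auto simp: lamL_lin distrib_left)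
  show "zmult z (\<lambda>M. c * a M) M = c * zmult z a M"
    unfolding zmult_def sum_distrib_left using fin by (intro sum.cong) (auto simp: lamL_lin mult.left_commute)
qed

lemma zmult_zero: "zmult z (\<lambda>_. 0) M = 0"
  using zmult_scale[of z 0 "\<lambda>_. 0" M] by simp

lemma zmult_sum: "zmult z (\<lambda>M. \<Sum>x\<in>X. f x M) M = (\<Sum>x\<in>X. zmult z (f x) M)"
  by (induction X rule: infinite_finite_induct) (auto simp: zmult_zero zmult_add)

lemma zmult_in_idl:
  assumes Q: "idl Q" and M: "M \<subseteq> {1..n}" and za: "\<And>L. L \<subseteq> M \<Longrightarrow> z L * a (M - L) \<in> Q"
  shows "zmult z a M \<in> Q"
proof -
  obtain e where e: "\<And>L. e L = 1 \<or> e L = - 1" "\<And>z a. zmult z a M = (\<Sum>L\<in>Pow M. e L * z L * a (M - L))"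
    using zmult_form[of M] M by metis
  have "e L * z L * a (M - L) \<in> Q" if "L \<in> Pow M" for L
    using e(1)[of L] za[of L] that idlD(6)[OF Q] by auto
  then show ?thesis unfolding e(2) by (intro idl_sum[OF Q])
qed

lemma zmult_homog:
  assumes "homog i z" "homog j a"
  shows "homog (i + j) (zmult z a)"
  unfolding homog_def
proof (intro allI impI)
  fix M assume "zmult z a M \<noteq> 0"
  then obtain L where L: "L \<subseteq> {1..n}" "z L * lamL L a M \<noteq> 0"
    unfolding zmult_def by (metis (no_types, lifting) PowD sum.not_neutral_contains_not_neutral)
  then have fin: "finite L" using finite_subset by blast
  from L(2) have "lamL L a M \<noteq> 0" by auto
  moreover obtain e :: 'a where "\<And>a. lamL L a M = (if L \<subseteq> M then e * a (M - L) else 0)"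
    using lamL_formE[OF fin] by metis
  ultimately have LM: "L \<subseteq> M" "a (M - L) \<noteq> 0" by (auto split: if_splits)
  have "z L \<noteq> 0" using L(2) by auto
  then have c: "card L = i" using assms(1) by (auto simp: homog_def)
  have d: "M - L \<subseteq> {1..n}" "card (M - L) = j" using assms(2) LM(2) by (auto simp: homog_def)
  then have "M \<subseteq> {1..n}" using L(1) by blast
  then have "finite M" using finite_subset by blast
  then have "card M = i + j" using card_mono[OF _ LM(1)] c d(2) card_Diff_subset[OF fin LM(1)] by simp
  with \<open>M \<subseteq> {1..n}\<close> show "M \<subseteq> {1..n} \<and> card M = i + j" by simp
qed

lemma zmult_unit: "L \<subseteq> {1..n} \<Longrightarrow> zmult z (\<lambda>M. if M = {} then c else 0) L = z L * c"
proof -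
  assume L: "L \<subseteq> {1..n}"
  have "zmult z (\<lambda>M. if M = {} then c else 0) L = (\<Sum>L'\<in>Pow {1..n}. if L' = L then z L * c else 0)"
    unfolding zmult_def using finite_subset[of _ "{1..n}"] by (intro sum.cong) (auto simp: lamL_unit)
  then show ?thesis using L by simp
qed

lemma dF_add: "dF (\<lambda>w M. f w M + g w M) w M = dF f w M + dF g w M"
  by (simp add: dF_def bd_add zmult_add sum.distrib algebra_simps)

lemma dF_scale: "dF (\<lambda>w M. c * f w M) w M = c * dF f w M"
  by (simp add: dF_def bd_scale zmult_scale sum_distrib_left algebra_simps)

lemma dF_minus: "dF (\<lambda>w M. - f w M) w M = - dF f w M"
  using dF_scale[of "- 1" f w M] by simp

lemma dF_diff: "dF (\<lambda>w M. f w M - g w M) w M = dF f w M - dF g w M"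
  using dF_add[of f "\<lambda>w M. - g w M" w M] by (simp add: dF_minus)

lemma dF_zero: "dF (\<lambda>w M. 0) w M = 0"
  using dF_scale[of 0 "\<lambda>w M. 0" w M] by simp

lemma dF_sum: "dF (\<lambda>w M. \<Sum>x\<in>X. f x w M) w M = (\<Sum>x\<in>X. dF (f x) w M)"
  by (induction X rule: infinite_finite_induct) (auto simp: dF_zero dF_add)

lemma Lt_cycle: "v \<in> Lt \<Longrightarrow> vc (snd v) \<and> homog (Suc (fst v)) (snd v) \<and> (\<forall>M. snd v M \<in> J) \<and> (\<forall>M\<subseteq>{1..n}. bd (snd v) M \<in> I)"
  using V_cycle[of "snd v" "fst v"] in_Lt[of "fst v" "snd v"] by simp

lemma vc_zmult: "vc z \<Longrightarrow> vc a \<Longrightarrow> vc (zmult z a)"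
proof -
  assume za: "vc z" "vc a"
  have "lamL L a M \<in> C" if "L \<in> Pow {1..n}" for L M
  proof -
    have "finite L" using that finite_subset[of L "{1..n}"] by auto
    then obtain e :: 'a where "e = 1 \<or> e = - 1" "\<And>a. lamL L a M = (if L \<subseteq> M then e * a (M - L) else 0)"
      using lamL_formE by metis
    then show ?thesis using za by (auto simp: vc_def C_intros)
  qed
  with za show ?thesis by (auto simp: vc_def zmult_def intro!: C_intros)
qed

lemma vcw_dF: "vcw f \<Longrightarrow> vcw (dF f)"
proof -
  assume f: "vcw f"
  have "bd (f w) M \<in> C" for w M using vc_bd f by (simp add: vcw_def vc_def)
  moreover have "zmult (snd v) (f (v # w)) M \<in> C" if "v \<in> Lt" for v w M
    using vc_zmult Lt_cycle[OF that] f by (simp add: vcw_def vc_def)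
  ultimately show "vcw (dF f)" unfolding vcw_def vc_def dF_def by (intro allI C_intros)
qed

text \<open>Each term of the differential carries a factor \<open>y l\<close> or an entry of a
  cycle, which lies in \<open>J\<close>; both have zero augmentation. Tensoring with the field
  therefore kills the differential.\<close>

lemma dF_minimal: "vcw f \<Longrightarrow> M \<subseteq> {1..n} \<Longrightarrow> ev (dF f w M) = 0"
proof -
  assume f: "vcw f" and M: "M \<subseteq> {1..n}"
  let ?Q = "{a \<in> C. ev a = 0}"
  note Q = idl_kernel
  have "zmult (snd v) (f (v # w)) M \<in> ?Q" if "v \<in> Lt" for v
    using Lt_cycle[OF that] f idlD(1,5)[OF idl_J] M
    by (intro zmult_in_idl[OF Q]) (auto simp: vcw_def vc_def C_intros ev_mult)
  moreover have "bd (f w) M \<in> ?Q"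
    unfolding bd_def using f y_C ev_y
    by (intro idl_sum[OF Q]) (auto simp: iot_def vcw_def vc_def ev_mult C_intros sg_C ev_zero)
  ultimately have "dF f w M \<in> ?Q"
    unfolding dF_def by (intro idlD(3)[OF Q] idlD(4)[OF Q] idl_sum[OF Q] C_intros)
  then show ?thesis by simp
qed

lemma supp_dF: "supp (Suc N) f \<Longrightarrow> supp N (dF f)"
  unfolding supp_def
proof (intro allI impI)
  fix w M assume f: "\<forall>w M. f w M \<noteq> 0 \<longrightarrow> set w \<subseteq> Lt \<and> M \<subseteq> {1..n} \<and> wdeg w + card M = Suc N" and "dF f w M \<noteq> 0"
  then consider "bd (f w) M \<noteq> 0" | "(\<Sum>v\<in>Lt. zmult (snd v) (f (v # w)) M) \<noteq> 0" unfolding dF_def by fastforce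
  then show "set w \<subseteq> Lt \<and> M \<subseteq> {1..n} \<and> wdeg w + card M = N"
  proof cases
    case 1
    then obtain l where "y l * iot l (f w) M \<noteq> 0" unfolding bd_def by (meson sum.not_neutral_contains_not_neutral)
    then have l: "l \<notin> M" "f w (insert l M) \<noteq> 0" by (auto simp: iot_def split: if_splits)
    then have *: "set w \<subseteq> Lt" "insert l M \<subseteq> {1..n}" "wdeg w + card (insert l M) = Suc N" using f by blast+
    then have "finite M" using finite_subset[of M "{1..n}"] by simp
    with * l show ?thesis by simp
  next
    case 2
    then obtain v where v: "v \<in> Lt" "zmult (snd v) (f (v # w)) M \<noteq> 0" by (meson sum.not_neutral_contains_not_neutral)
    let ?j = "Suc N - wdeg (v # w)"
    have "homog ?j (f (v # w))" using f unfolding homog_def by fastforce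
    moreover have "homog (Suc (fst v)) (snd v)" using Lt_cycle[OF v(1)] by simp
    ultimately have "homog (Suc (fst v) + ?j) (zmult (snd v) (f (v # w)))" by (intro zmult_homog)
    then have M: "M \<subseteq> {1..n}" "card M = Suc (fst v) + ?j"
      using v(2) unfolding homog_def by blast+
    have "\<exists>M'. f (v # w) M' \<noteq> 0"
    proof (rule ccontr)
      assume "\<not> ?thesis"
      then have "f (v # w) = (\<lambda>_. 0)" by auto
      with v(2) show False by (simp add: zmult_zero)
    qed
    then obtain M' where "f (v # w) M' \<noteq> 0" ..
    then have "set (v # w) \<subseteq> Lt" "wdeg (v # w) \<le> Suc N" using f by fastforce+
    with M show ?thesis by simp
  qed
qed

text \<open>Koszul boundaries square to zero and the cross terms with \<open>bd (f (v # w))\<close>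
  cancel. What remains are products with the boundary of a letter, which lie in \<open>I\<close>
  because letters are cycles modulo \<open>I\<close>, and double products of letters, which lie in
  \<open>I\<close> by \<open>J_J\<close>.\<close>

lemma dF_dF:
  assumes f: "vcw f" and M: "M \<subseteq> {1..n}"
  shows "dF (dF f) w M \<in> I"
proof -
  let ?s = "(- 1) ^ wdeg w :: 'a"
  have fC: "f w M \<in> C" for w M using f by (simp add: vcw_def vc_def)
  have 1: "bd (dF f w) M = (\<Sum>v\<in>Lt. bd (zmult (snd v) (f (v # w))) M)"
  proof -
    have "dF f w = (\<lambda>M. ?s * bd (f w) M + (\<Sum>v\<in>Lt. zmult (snd v) (f (v # w)) M))" by (rule ext) (simp add: dF_def)
    then have "bd (dF f w) M = ?s * bd (bd (f w)) M + (\<Sum>v\<in>Lt. bd (zmult (snd v) (f (v # w))) M)"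
      by (simp add: bd_add bd_scale bd_sum)
    then show ?thesis by (simp add: bd_bd)
  qed
  \<comment> \<open>The letter adds \<open>fst v + 2\<close> to the degree while its cycle has
    degree \<open>fst v + 1\<close>, so this sign is opposite to the one from
    \<open>zmult_leibniz\<close>.\<close>
  have 2: "zmult (snd v) (dF f (v # w)) M = ?s * (- 1) ^ fst v * zmult (snd v) (bd (f (v # w))) M
      + (\<Sum>u\<in>Lt. zmult (snd v) (zmult (snd u) (f (u # v # w))) M)" for v
  proof -
    have "dF f (v # w) = (\<lambda>M. (?s * (- 1) ^ fst v) * bd (f (v # w)) M + (\<Sum>u\<in>Lt. zmult (snd u) (f (u # v # w)) M))"
      by (rule ext) (simp add: dF_def power_add mult.commute)
    then show ?thesis by (simp add: zmult_add zmult_scale zmult_sum)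
  qed
  have "dF (dF f) w M = (\<Sum>v\<in>Lt. ?s * bd (zmult (snd v) (f (v # w))) M + zmult (snd v) (dF f (v # w)) M)"
    unfolding dF_def[of "dF f"] 1 by (simp add: sum.distrib sum_distrib_left)
  also have "\<dots> = (\<Sum>v\<in>Lt. ?s * zmult (bd (snd v)) (f (v # w)) M
      + (\<Sum>u\<in>Lt. zmult (snd v) (zmult (snd u) (f (u # v # w))) M))"
  proof (rule sum.cong)
    fix v assume v: "v \<in> Lt"
    show "?s * bd (zmult (snd v) (f (v # w))) M + zmult (snd v) (dF f (v # w)) M
      = ?s * zmult (bd (snd v)) (f (v # w)) M + (\<Sum>u\<in>Lt. zmult (snd v) (zmult (snd u) (f (u # v # w))) M)"
      unfolding 2 using Lt_cycle[OF v] by (subst zmult_leibniz[of "Suc (fst v)"]) (auto simp: algebra_simps)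
  qed simp
  also have "\<dots> \<in> I"
  proof (intro idl_sum[OF idl_I] idlD(3)[OF idl_I] idlD(4)[OF idl_I])
    show "?s \<in> C" by (intro C_intros)
    fix v assume v: "v \<in> Lt"
    show "zmult (bd (snd v)) (f (v # w)) M \<in> I"
    proof (rule zmult_in_idl[OF idl_I M])
      fix L assume "L \<subseteq> M"
      then have "bd (snd v) L \<in> I" using Lt_cycle[OF v] M by blast
      then show "bd (snd v) L * f (v # w) (M - L) \<in> I" by (rule idl_mult_right[OF idl_I _ fC])
    qed
    fix u assume u: "u \<in> Lt"
    have zJ: "zmult (snd u) (f (u # v # w)) M' \<in> J" if "M' \<subseteq> {1..n}" for M'
      using Lt_cycle[OF u] by (intro zmult_in_idl[OF idl_J that] idl_mult_right[OF idl_J _ fC]) simp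
    show "zmult (snd v) (zmult (snd u) (f (u # v # w))) M \<in> I"
    proof (rule zmult_in_idl[OF idl_I M], rule J_J)
      fix L assume "L \<subseteq> M"
      show "snd v L \<in> J" using Lt_cycle[OF v] by simp
      show "zmult (snd u) (f (u # v # w)) (M - L) \<in> J" by (rule zJ) (use M in blast)
    qed
  qed
  finally show ?thesis .
qed

section \<open>Exactness, by descent on the length of words\<close>

lemma supp_diff: "supp N f \<Longrightarrow> supp N g \<Longrightarrow> supp N (\<lambda>w M. f w M - g w M)"
  and supp_add: "supp N f \<Longrightarrow> supp N g \<Longrightarrow> supp N (\<lambda>w M. f w M + g w M)"
  unfolding supp_def by (metis diff_zero diff_0_right diff_self, metis add.right_neutral)

lemma supp_homog: "supp N f \<Longrightarrow> homog (N - wdeg w) (f w)"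
  unfolding supp_def homog_def by fastforce

lemma idl_neg_iff: "idl Q \<Longrightarrow> - a \<in> Q \<longleftrightarrow> a \<in> Q"
  using idlD(6)[of Q a] idlD(6)[of Q "- a"] by auto

lemma idl_add_iff: "idl Q \<Longrightarrow> b \<in> Q \<Longrightarrow> a + b \<in> Q \<longleftrightarrow> a \<in> Q"
  using idlD(3)[of Q a b] idlD(7)[of Q "a + b" b] by auto

text \<open>Letters in front contribute nothing modulo \<open>I\<close> once the longer words do
  not, so on the longest relevant words a cycle is just a Koszul cycle modulo
  \<open>I\<close>.\<close>

lemma dF_unchanged:
  assumes "vcw f" "M \<subseteq> {1..n}" "\<And>v M. M \<subseteq> {1..n} \<Longrightarrow> v \<in> Lt \<Longrightarrow> f (v # w) M \<in> I"
  shows "dF f w M \<in> I \<longleftrightarrow> bd (f w) M \<in> I"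
proof -
  have "(\<Sum>v\<in>Lt. zmult (snd v) (f (v # w)) M) \<in> I"
  proof (intro idl_sum[OF idl_I] zmult_in_idl[OF idl_I assms(2)])
    fix v L assume v: "v \<in> Lt" and L: "L \<subseteq> M"
    have "f (v # w) (M - L) \<in> I" using assms(2,3) v by blast
    moreover have "snd v L \<in> C" using Lt_cycle[OF v] by (simp add: vc_def)
    ultimately show "snd v L * f (v # w) (M - L) \<in> I" by (intro idlD(4)[OF idl_I])
  qed
  then have "dF f w M \<in> I \<longleftrightarrow> (- 1) ^ wdeg w * bd (f w) M \<in> I"
    unfolding dF_def by (rule idl_add_iff[OF idl_I])
  also have "\<dots> \<longleftrightarrow> bd (f w) M \<in> I"
    by (cases "even (wdeg w)") (simp_all add: idl_neg_iff[OF idl_I])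
  finally show ?thesis .
qed

text \<open>Koszul homology modulo \<open>I\<close> in its two cases: positive degrees are spanned
  by \<open>V j\<close>, degree 0 by constants. Truncated subtraction sends words of degree above
  \<open>N\<close> to the case 0, where \<open>f w\<close> vanishes.\<close>

lemma slice_step:
  assumes f: "vcw f" "supp N f" and b: "\<forall>M\<subseteq>{1..n}. bd (f w) M \<in> I"
  shows "\<exists>c h. vc h \<and> homog (Suc (N - wdeg w)) h \<and> (\<forall>M\<subseteq>{1..n}. f w M
      - ((case N - wdeg w of 0 \<Rightarrow> if M = {} then cst (ev (f w {})) else 0 | Suc j \<Rightarrow> \<Sum>v\<in>V j. cst (c v) * v M) + bd h M) \<in> I)"
proof (cases "N - wdeg w")
  case 0
  have fw: "vc (f w)" "homog 0 (f w)" using f supp_homog[OF f(2), of w] 0 by (auto simp: vcw_def)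
  have z: "f w M = 0" if "M \<noteq> {}" for M
  proof (rule ccontr)
    assume "f w M \<noteq> 0"
    then have "M \<subseteq> {1..n}" "card M = 0" using fw(2) by (auto simp: homog_def)
    with that show False using finite_subset[of M "{1..n}"] by auto
  qed
  have "bd (f w) = (\<lambda>_. 0)"
  proof
    fix M
    have "iot l (f w) M = 0" for l by (simp add: iot_def z)
    then show "bd (f w) M = 0" by (simp add: bd_def)
  qed
  then have "hh (bd (f w)) M = 0" for M by (simp add: hh_def D_zero)
  then have "f w M - ((if M = {} then cst (ev (f w {})) else 0) + bd (hh (f w)) M) = 0" if "M \<subseteq> {1..n}" for M
    using homotopy_identity[OF fw(1) that] by simp
  then show ?thesis using vc_hh[OF fw(1)] homog_hh[OF fw(2)] idlD(2)[OF idl_I]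
    by (intro exI[of _ "\<lambda>_. 0"] exI[of _ "hh (f w)"]) (simp add: 0)
next
  case (Suc j)
  have fw: "vc (f w)" "homog (Suc j) (f w)" using f supp_homog[OF f(2), of w] Suc by (auto simp: vcw_def)
  from V_span[OF this b] show ?thesis by (simp add: Suc eqm_def Ball_def)
qed

text \<open>Descent on a length beyond which the cycle vanishes modulo \<open>I\<close>. On the
  longest remaining words its coefficients are Koszul cycles; their boundary part and their part
  spanned by \<open>V\<close> are both hit by the differential, the latter from words with one more
  letter. Constants in Koszul degree 0 are not removed this way and must be shown to vanish;
  \<open>0 < N\<close> puts them on nonempty words.\<close>

lemma exact_aux:
  assumes "0 < N"
  shows "vcw f \<Longrightarrow> supp N f \<Longrightarrow> \<forall>w. \<forall>M\<subseteq>{1..n}. dF f w M \<in> I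
    \<Longrightarrow> \<forall>w. l \<le> length w \<longrightarrow> (\<forall>M\<subseteq>{1..n}. f w M \<in> I)
    \<Longrightarrow> \<exists>g. vcw g \<and> supp (Suc N) g \<and> (\<forall>w. \<forall>M\<subseteq>{1..n}. f w M - dF g w M \<in> I)"
proof (induction l arbitrary: f)
  case 0
  then show ?case
    by (intro exI[of _ "\<lambda>_ _. 0"]) (simp add: vcw_def vc_def zero_C supp_def dF_zero)
next
  case (Suc l)
  note f = Suc.prems(1-3)
  have fI: "f w M \<in> I" if "Suc l \<le> length w" "M \<subseteq> {1..n}" for w M using Suc.prems(4) that by blast
  have fC: "f w M \<in> C" for w M using f by (simp add: vcw_def vc_def)
  define ok where "ok w \<longleftrightarrow> set w \<subseteq> Lt \<and> wdeg w \<le> N" for w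
  have f_ok: "f w = (\<lambda>_. 0)" if "\<not> ok w" for w using f(2) that by (fastforce simp: supp_def ok_def)
  define P where "P w c h \<longleftrightarrow> vc h \<and> homog (Suc (N - wdeg w)) h \<and> (\<forall>M\<subseteq>{1..n}. f w M
      - ((case N - wdeg w of 0 \<Rightarrow> if M = {} then cst (ev (f w {})) else 0 | Suc j \<Rightarrow> \<Sum>v\<in>V j. cst (c v) * v M) + bd h M) \<in> I)"
    for w c h
  have "\<exists>c h. length w = l \<longrightarrow> P w c h" for w
  proof (cases "length w = l")
    case True
    have "bd (f w) M \<in> I" if "M \<subseteq> {1..n}" for M
      using dF_unchanged[OF f(1) that, of w] fI f(3) that True by simp
    then show ?thesis using slice_step[OF f(1,2), of w] by (simp add: P_def)
  qed simp
  then have "\<forall>w. \<exists>c h. length w = l \<longrightarrow> P w c h" by simp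
  then obtain c h where ch: "\<And>w. length w = l \<Longrightarrow> P w (c w) (h w)" by metis
  have h: "\<And>w. length w = l \<Longrightarrow> vc (h w)" "\<And>w. length w = l \<Longrightarrow> homog (Suc (N - wdeg w)) (h w)"
    "\<And>w M. length w = l \<Longrightarrow> M \<subseteq> {1..n} \<Longrightarrow> f w M - ((case N - wdeg w of 0 \<Rightarrow> if M = {} then cst (ev (f w {})) else 0
        | Suc j \<Rightarrow> \<Sum>v\<in>V j. cst (c w v) * v M) + bd (h w) M) \<in> I" using ch unfolding P_def by simp_all
  \<comment> \<open>The sign undoes the one in \<open>dF\<close>. In the second branch a word
    \<open>v # w\<close> takes the scalar \<open>c w v\<close> in Koszul degree 0; the condition
    \<open>wdeg w = Suc N\<close> selects exactly the letters from the \<open>V j\<close> of the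
    matching degree.\<close>
  define g where "g = (\<lambda>w M. if length w = l \<and> ok w then (- 1) ^ wdeg w * h w M
    else if length w = Suc l \<and> set w \<subseteq> Lt \<and> wdeg w = Suc N then (if M = {} then cst (c (tl w) (snd (hd w))) else 0) else 0)"
  have g1: "g w = (\<lambda>M. (- 1) ^ wdeg w * h w M)" if "length w = l" "ok w" for w
    using that by (simp add: g_def)
  have g2: "g w = (\<lambda>M. if M = {} then cst (c (tl w) (snd (hd w))) else 0)" if "length w = Suc l" "set w \<subseteq> Lt" "wdeg w = Suc N" for w
    using that by (auto simp: g_def)
  have g3: "g w = (\<lambda>M. 0)" if "length w \<noteq> l \<or> \<not> ok w" "length w \<noteq> Suc l \<or> \<not> set w \<subseteq> Lt \<or> wdeg w \<noteq> Suc N" for w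
    using that by (intro ext) (auto simp: g_def)
  have bdg: "bd (g w) M = 0" if "length w \<noteq> l" for w M
    using that by (auto simp: g_def bd_def iot_def intro!: sum.neutral)
  have vg: "vcw g" unfolding vcw_def vc_def g_def using h(1) by (auto simp: vc_def intro!: C_intros)
  have sg: "supp (Suc N) g"
    unfolding supp_def
  proof (intro allI impI)
    fix w M assume nz: "g w M \<noteq> 0"
    show "set w \<subseteq> Lt \<and> M \<subseteq> {1..n} \<and> wdeg w + card M = Suc N"
    proof (cases "length w = l \<and> ok w")
      case True
      with nz have "h w M \<noteq> 0" by (auto simp: g1)
      then have "M \<subseteq> {1..n} \<and> card M = Suc (N - wdeg w)" using h(2) True by (auto simp: homog_def)
      then show ?thesis using True by (simp add: ok_def)
    next
      case False
      then show ?thesis using nz by (auto simp: g_def split: if_splits)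
    qed
  qed
  define f' where "f' = (\<lambda>w M. f w M - dF g w M)"
  have f': "vcw f'" "supp N f'"
    using f vg vcw_dF[OF vg] supp_dF[OF sg] by (auto simp: f'_def vcw_def vc_def C_intros intro: supp_diff)
  have cyc: "dF f' w M \<in> I" if "M \<subseteq> {1..n}" for w M
    using f(3) dF_dF[OF vg that] that by (simp add: f'_def dF_diff idlD(7)[OF idl_I])
  have f'_long: "f' w M \<in> I" if "Suc l \<le> length w" "M \<subseteq> {1..n}" for w M
  proof -
    have "g (v # w) = (\<lambda>_. 0)" for v using that by (intro g3) auto
    then have "dF g w M = 0" using bdg[of w M] that by (simp add: dF_def zmult_zero)
    then show ?thesis using fI[OF that] by (simp add: f'_def)
  qed
  \<comment> \<open>After subtracting \<open>dF g\<close>, only the constant term survives on words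
    of length \<open>l\<close>, and only on words of full degree \<open>N\<close>.\<close>
  have f'_l: "f' w M - (if wdeg w = N \<and> ok w \<and> M = {} then cst (ev (f w {})) else 0) \<in> I"
    if w: "length w = l" and M: "M \<subseteq> {1..n}" for w M
  proof (cases "ok w")
    case True
    have b: "dF g w M = bd (h w) M + (\<Sum>v\<in>Lt. zmult (snd v) (g (v # w)) M)"
    proof -
      have "(- 1) ^ wdeg w * ((- 1) ^ wdeg w * bd (h w) M) = bd (h w) M"
        by (simp add: mult.assoc[symmetric] power_add[symmetric] minus_one_power_iff)
      then show ?thesis by (simp add: dF_def g1[OF w True] bd_scale)
    qed
    show ?thesis
    proof (cases "N - wdeg w")
      case 0
      then have N: "wdeg w = N" using True by (simp add: ok_def)
      have "g (v # w) = (\<lambda>_. 0)" for v using N w by (intro g3) auto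
      then have "dF g w M = bd (h w) M" by (simp add: b zmult_zero)
      then show ?thesis using h(3)[OF w M] N True by (simp add: f'_def algebra_simps)
    next
      case (Suc j)
      then have N: "wdeg w + Suc j = N" "wdeg w \<noteq> N" by auto
      have "(\<Sum>v\<in>Lt. zmult (snd v) (g (v # w)) M) = (\<Sum>v\<in>Pair j ` V j. zmult (snd v) (g (v # w)) M)"
      proof (rule sum.mono_neutral_right[OF finite_Lt])
        show "Pair j ` V j \<subseteq> Lt" by (auto simp: in_Lt)
        show "\<forall>v\<in>Lt - Pair j ` V j. zmult (snd v) (g (v # w)) M = 0"
        proof
          fix v assume v: "v \<in> Lt - Pair j ` V j"
          then have "fst v \<noteq> j" using in_Lt[of "fst v" "snd v"] by force
          then have "g (v # w) = (\<lambda>_. 0)" using N w by (intro g3) auto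
          then show "zmult (snd v) (g (v # w)) M = 0" by (simp add: zmult_zero)
        qed
      qed
      also have "\<dots> = (\<Sum>v\<in>V j. zmult v (g ((j, v) # w)) M)"
        by (subst sum.reindex) (auto simp: inj_on_def)
      also have "\<dots> = (\<Sum>v\<in>V j. cst (c w v) * v M)"
      proof (rule sum.cong)
        fix v assume v: "v \<in> V j"
        have "g ((j, v) # w) = (\<lambda>M. if M = {} then cst (c w v) else 0)"
          using w True N v by (subst g2) (auto simp: ok_def in_Lt)
        then show "zmult v (g ((j, v) # w)) M = cst (c w v) * v M"
          using zmult_unit[OF M] by (simp add: mult.commute)
      qed simp
      finally show ?thesis using h(3)[OF w M] N by (simp add: f'_def b Suc algebra_simps)
    qed
  next
    case False
    have "g w = (\<lambda>_. 0)" using False w by (intro g3) auto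
    moreover have "g (v # w) = (\<lambda>_. 0)" for v
      using False w by (intro g3) (auto simp: ok_def)
    ultimately have "dF g w M = 0" by (simp add: dF_def bd_zero zmult_zero)
    then show ?thesis using False f_ok[OF False] by (simp add: f'_def idlD(2)[OF idl_I])
  qed
  \<comment> \<open>The cycle condition at the tail \<open>w'\<close> makes the combination of
    \<open>V j\<close> with these constants a boundary modulo \<open>I\<close>; independence then
    kills every coefficient.\<close>
  have const_zero: "ev (f w {}) = 0" if w: "length w = l" "ok w" "wdeg w = N" for w
  proof -
    obtain u w' where u: "w = u # w'" using w assms by (cases w) auto
    obtain j v where jv: "u = (j, v)" by (cases u)
    have v: "v \<in> V j" using w u jv by (simp add: ok_def in_Lt)
    have N: "N - wdeg w' = Suc (Suc j)" using w u jv by auto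
    have w': "set w' \<subseteq> Lt" "length w' + 1 = l" using w u by (auto simp: ok_def)
    let ?s = "(- 1) ^ wdeg w' :: 'a"
    have g0: "vc (\<lambda>M. - ?s * f' w' M)" "homog (Suc (Suc j)) (\<lambda>M. - ?s * f' w' M)"
      using f' supp_homog[OF f'(2), of w'] N homog_scale[of "Suc (Suc j)" "f' w'" "- ?s"]
      by (simp_all add: vcw_def vc_def C_intros)
    have "eqm I (Pow {1..n}) (\<lambda>M. \<Sum>x\<in>V j. cst (ev (f ((j, x) # w') {})) * x M) (bd (\<lambda>M. - ?s * f' w' M))"
      unfolding eqm_def
    proof
      fix M assume "M \<in> Pow {1..n}"
      then have M: "M \<subseteq> {1..n}" by simp
      let ?e = "\<lambda>x. if fst x = j then cst (ev (f (x # w') {})) else 0"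
      have "zmult (snd x) (f' (x # w')) M - ?e x * snd x M \<in> I" if x: "x \<in> Lt" for x
      proof -
        have *: "wdeg (x # w') = N \<longleftrightarrow> fst x = j" using N by auto
        have E: "f' (x # w') L - (if L = {} then ?e x else 0) \<in> I" if L: "L \<subseteq> {1..n}" for L
          using f'_l[of "x # w'" L] L w' x * by (auto simp: ok_def split: if_splits)
        have "zmult (snd x) (\<lambda>L. f' (x # w') L + - 1 * (if L = {} then ?e x else 0)) M \<in> I"
        proof (rule zmult_in_idl[OF idl_I M])
          fix L assume "L \<subseteq> M"
          then have "M - L \<subseteq> {1..n}" using M by blast
          from E[OF this] have *: "f' (x # w') (M - L) + - 1 * (if M - L = {} then ?e x else 0) \<in> I"
            by (simp only: mult_minus1 add_uminus_conv_diff)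
          have "snd x L \<in> C" using Lt_cycle[OF x] by (simp add: vc_def)
          from idlD(4)[OF idl_I this *]
          show "snd x L * (f' (x # w') (M - L) + - 1 * (if M - L = {} then ?e x else 0)) \<in> I" .
        qed
        then have "zmult (snd x) (f' (x # w')) M - zmult (snd x) (\<lambda>L. if L = {} then ?e x else 0) M \<in> I"
          unfolding zmult_add zmult_scale by simp
        then show ?thesis by (simp only: zmult_unit[OF M] mult.commute)
      qed
      then have "(\<Sum>x\<in>Lt. zmult (snd x) (f' (x # w')) M - ?e x * snd x M) \<in> I" by (rule idl_sum[OF idl_I])
      moreover have "(\<Sum>x\<in>Lt. ?e x * snd x M) = (\<Sum>x\<in>V j. cst (ev (f ((j, x) # w') {})) * x M)"
      proof -
        have "(\<Sum>x\<in>Lt. ?e x * snd x M) = (\<Sum>x\<in>Pair j ` V j. ?e x * snd x M)"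
        proof (rule sum.mono_neutral_right[OF finite_Lt])
          show "Pair j ` V j \<subseteq> Lt" by (auto simp: in_Lt)
          show "\<forall>x\<in>Lt - Pair j ` V j. ?e x * snd x M = 0"
          proof
            fix x assume x: "x \<in> Lt - Pair j ` V j"
            then have "fst x \<noteq> j" using in_Lt[of "fst x" "snd x"] by force
            then show "?e x * snd x M = 0" by simp
          qed
        qed
        also have "\<dots> = (\<Sum>x\<in>V j. cst (ev (f ((j, x) # w') {})) * x M)"
          by (subst sum.reindex) (auto simp: inj_on_def)
        finally show ?thesis .
      qed
      ultimately have "(\<Sum>x\<in>Lt. zmult (snd x) (f' (x # w')) M) - (\<Sum>x\<in>V j. cst (ev (f ((j, x) # w') {})) * x M) \<in> I"
        by (simp add: sum_subtractf)
      from idlD(7)[OF idl_I cyc[OF M, of w'] this]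
      have "(\<Sum>x\<in>V j. cst (ev (f ((j, x) # w') {})) * x M) + ?s * bd (f' w') M \<in> I" by (simp add: dF_def algebra_simps)
      then show "(\<Sum>x\<in>V j. cst (ev (f ((j, x) # w') {})) * x M) - bd (\<lambda>M. - ?s * f' w' M) M \<in> I"
        unfolding bd_scale by simp
    qed
    from V_indep[OF g0 this v] show ?thesis by (simp add: u jv)
  qed
  have "f' w M \<in> I" if "l \<le> length w" "M \<subseteq> {1..n}" for w M
  proof (cases "length w = l")
    case True
    then show ?thesis using f'_l[OF True that(2)] const_zero[OF True] by (auto simp: cst_zero split: if_splits)
  next
    case False
    then show ?thesis using f'_long that by simp
  qed
  then obtain g' where g': "vcw g'" "supp (Suc N) g'" "\<And>w M. M \<subseteq> {1..n} \<Longrightarrow> f' w M - dF g' w M \<in> I"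
    using Suc.IH[OF f'] cyc by blast
  have "vcw (\<lambda>w M. g w M + g' w M)" using vg g'(1) by (simp add: vcw_def vc_def add_C)
  moreover have "f w M - dF (\<lambda>w M. g w M + g' w M) w M \<in> I" if "M \<subseteq> {1..n}" for w M
    using g'(3)[OF that, of w] by (simp add: dF_add f'_def algebra_simps)
  ultimately show ?case using supp_add[OF sg g'(2)] by blast
qed

lemma exact_pos:
  assumes "0 < N" "vcw f" "supp N f" "\<And>w M. M \<subseteq> {1..n} \<Longrightarrow> dF f w M \<in> I"
  obtains g where "vcw g" "supp (Suc N) g" "\<And>w M. M \<subseteq> {1..n} \<Longrightarrow> f w M - dF g w M \<in> I"
proof -
  \<comment> \<open>Letters have positive degree, so words longer than \<open>N\<close> have degree
    above \<open>N\<close>; this is where the descent starts.\<close>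
  have "f w M \<in> I" if w: "Suc N \<le> length w" for w M
  proof -
    have "wdeg w + card M \<noteq> N" using length_le_wdeg[of w] w by simp
    then have "f w M = 0" using assms(3) by (auto simp: supp_def)
    then show ?thesis by (simp add: idlD(2)[OF idl_I])
  qed
  then show ?thesis using exact_aux[OF assms(1-3), of "Suc N"] assms(4) that by blast
qed

text \<open>In degree 0 only the empty word with the empty set occurs, and \<open>hh\<close> writes
  an element of zero augmentation as a combination of the variables.\<close>

lemma exact_zero:
  assumes f: "vcw f" "supp 0 f" and "ev (f [] {}) = 0"
  obtains g where "vcw g" "supp 1 g" "\<And>w M. M \<subseteq> {1..n} \<Longrightarrow> f w M - dF g w M \<in> I"
proof -
  have nil: "f w M = 0" if "w \<noteq> [] \<or> M \<noteq> {}" for w M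
  proof (rule ccontr)
    assume "f w M \<noteq> 0"
    then have "wdeg w + card M = 0" "M \<subseteq> {1..n}" using f(2) by (auto simp: supp_def)
    then show False using that length_le_wdeg[of w] finite_subset[of M "{1..n}"] by auto
  qed
  define h where "h = hh (f [])"
  have f0: "vc (f [])" "homog 0 (f [])" using f supp_homog[OF f(2), of "[]"] by (auto simp: vcw_def)
  define g where "g = (\<lambda>(w :: 'a word) M. if w = [] then h M else 0)"
  have g: "g [] = h" "g (v # w) = (\<lambda>_. 0)" for v w by (simp_all add: g_def)
  have "vcw g" using vc_hh[OF f0(1)] by (simp add: g_def vcw_def vc_def zero_C h_def)
  moreover have "supp 1 g" using homog_hh[OF f0(2)] by (auto simp: supp_def g_def h_def homog_def)
  moreover have "f w M - dF g w M \<in> I" if M: "M \<subseteq> {1..n}" for w M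
  proof (cases w)
    case Nil
    have "bd (f []) = (\<lambda>_. 0)" using nil by (auto simp: bd_def iot_def fun_eq_iff intro!: sum.neutral)
    then have "hh (bd (f [])) M = 0" by (simp add: hh_def D_zero)
    then have "bd h M = f [] M" using homotopy_identity[OF f0(1) M] assms(3) by (simp add: h_def cst_zero)
    then show ?thesis by (simp add: Nil dF_def g zmult_zero idlD(2)[OF idl_I])
  next
    case (Cons v w')
    then have "dF g w M = 0" by (simp add: dF_def g zmult_zero bd_zero)
    then show ?thesis using nil Cons by (simp add: idlD(2)[OF idl_I])
  qed
  ultimately show ?thesis using that by blast
qed

section \<open>The Golod complex in matrix form\<close>

definition FX :: "nat \<Rightarrow> ('a word \<times> nat set) set"
  where "FX N = {(w, M). set w \<subseteq> Lt \<and> M \<subseteq> {1..n} \<and> wdeg w + card M = N}"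

definition FA :: "nat \<Rightarrow> 'a word \<times> nat set \<Rightarrow> 'a word \<times> nat set \<Rightarrow> 'a"
  where "FA N x x' = dF (\<lambda>w M. if (w, M) = x' then 1 else 0) (fst x) (snd x)"

text \<open>Vectors in \<open>res\<close> are arbitrary off the index set; \<open>slice\<close>
  clears those values so that the results about \<open>supp\<close> apply.\<close>

definition slice :: "nat \<Rightarrow> ('a word \<times> nat set \<Rightarrow> 'a) \<Rightarrow> 'a word \<Rightarrow> nat set \<Rightarrow> 'a"
  where "slice N f w M = (if (w, M) \<in> FX N then f (w, M) else 0)"

lemma finite_FX: "finite (FX N)"
proof (rule finite_subset)
  show "FX N \<subseteq> {w. set w \<subseteq> Lt \<and> length w \<le> N} \<times> Pow {1..n}"
  proof
    fix x assume "x \<in> FX N"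
    then obtain w M where x: "x = (w, M)" "set w \<subseteq> Lt" "M \<subseteq> {1..n}" "wdeg w + card M = N" by (auto simp: FX_def)
    with length_le_wdeg[of w] show "x \<in> {w. set w \<subseteq> Lt \<and> length w \<le> N} \<times> Pow {1..n}" by simp
  qed
  show "finite ({w. set w \<subseteq> Lt \<and> length w \<le> N} \<times> Pow {1..n})"
    using finite_lists_length_le[OF finite_Lt] by simp
qed

lemma supp_slice: "supp N (slice N f)"
  by (auto simp: supp_def slice_def FX_def split: if_splits)

lemma vcw_slice: "vc f \<Longrightarrow> vcw (slice N f)"
  by (auto simp: vc_def vcw_def slice_def zero_C)

lemma slice_self: "supp N f \<Longrightarrow> slice N (\<lambda>(w, M). f w M) = f"
proof (intro ext)
  fix w M assume "supp N f"
  then show "slice N (\<lambda>(w, M). f w M) w M = f w M"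
    by (cases "f w M = 0") (simp_all add: supp_def slice_def FX_def)
qed

lemma mv_FA: "mv (FX (Suc N)) (FA N) f = (\<lambda>(w, M). dF (slice (Suc N) f) w M)"
proof
  fix x :: "'a word \<times> nat set"
  obtain w M where x: "x = (w, M)" by (cases x)
  have "slice (Suc N) f = (\<lambda>w M. \<Sum>x'\<in>FX (Suc N). f x' * (if (w, M) = x' then 1 else 0))"
    by (intro ext) (simp add: slice_def if_distrib[of "\<lambda>z. _ * z"] finite_FX cong: if_cong)
  then have "dF (slice (Suc N) f) w M = (\<Sum>x'\<in>FX (Suc N). f x' * dF (\<lambda>w M. if (w, M) = x' then 1 else 0) w M)"
    by (simp only: dF_sum dF_scale)
  then show "mv (FX (Suc N)) (FA N) f x = (case x of (w, M) \<Rightarrow> dF (slice (Suc N) f) w M)"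
    by (simp add: mv_def FA_def x mult.commute)
qed

lemma mc_FA: "mc (FA N)"
proof -
  have "vcw (dF (\<lambda>w M. if (w, M) = x' then 1 else 0))" for x' :: "'a word \<times> nat set"
    by (intro vcw_dF) (simp add: vcw_def vc_def C_intros)
  then show ?thesis by (simp add: mc_def FA_def vcw_def vc_def)
qed

lemma FX_0: "FX 0 = {([], {})}"
proof -
  have "w = [] \<and> M = {}" if "M \<subseteq> {1..n}" "wdeg w + card M = 0" for w :: "'a word" and M
    using that length_le_wdeg[of w] finite_subset[of M "{1..n}"] by auto
  then show ?thesis by (auto simp: FX_def)
qed

lemma FX_D: "(w, M) \<in> FX N \<Longrightarrow> M \<subseteq> {1..n}"
  by (simp add: FX_def)

lemma dF_supp_mem:
  assumes "supp N f" "\<forall>x\<in>FX N. f (fst x) (snd x) \<in> I"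
  shows "f w M \<in> I"
proof (cases "f w M = 0")
  case False
  then have "(w, M) \<in> FX N" using assms(1) by (simp add: supp_def FX_def)
  then show ?thesis using assms(2) by fastforce
qed (simp add: idlD(2)[OF idl_I])

lemma FA_minimal: "M \<subseteq> {1..n} \<Longrightarrow> vc f \<Longrightarrow> ev (mv (FX (Suc N)) (FA N) f (w, M)) = 0"
  by (simp add: mv_FA dF_minimal vcw_slice)

theorem golod_resolution: "res I FX FA (\<lambda>_. 1)"
  unfolding res_def
proof (intro conjI allI impI)
  show "cplx I FX FA (\<lambda>_. 1)"
    unfolding cplx_def
  proof (intro conjI allI impI finite_FX mc_FA)
    fix i and v :: "'a word \<times> nat set \<Rightarrow> 'a" assume v: "vc v"
    show "cyc I FX FA (\<lambda>_. 1) i (mv (FX (Suc i)) (FA i) v)"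
    proof (cases i)
      case 0
      then show ?thesis using FA_minimal[OF _ v] by (simp add: cyc_def FX_0)
    next
      case (Suc j)
      have "slice (Suc j) (mv (FX (Suc (Suc j))) (FA (Suc j)) v) = dF (slice (Suc (Suc j)) v)"
        unfolding mv_FA by (intro slice_self supp_dF supp_slice)
      then have "mv (FX (Suc j)) (FA j) (mv (FX (Suc i)) (FA i) v) (w, M) \<in> I" if "M \<subseteq> {1..n}" for w M
        using dF_dF[OF vcw_slice[OF v] that] by (simp add: mv_FA[of j] Suc)
      then show ?thesis using FX_D by (auto simp: cyc_def Suc)
    qed
  qed
  show "\<exists>v. vc v \<and> (\<Sum>x\<in>FX 0. ev (v x) * 1) = 1"
    by (intro exI[of _ "\<lambda>_. 1"]) (simp add: vc_def one_C FX_0 ev_one)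
  fix i and v :: "'a word \<times> nat set \<Rightarrow> 'a" assume v: "vc v" and cyc: "cyc I FX FA (\<lambda>_. 1) i v"
  have sv: "vcw (slice i v)" "supp i (slice i v)" using vcw_slice[OF v] supp_slice by auto
  have "\<exists>g. vcw g \<and> supp (Suc i) g \<and> (\<forall>w M. M \<subseteq> {1..n} \<longrightarrow> slice i v w M - dF g w M \<in> I)"
  proof (cases i)
    case 0
    have "ev (slice 0 v [] {}) = 0" using cyc by (simp add: 0 cyc_def FX_0 slice_def)
    from exact_zero[OF sv[unfolded 0] this] show ?thesis unfolding 0 One_nat_def by blast
  next
    case (Suc j)
    have "\<forall>x\<in>FX j. dF (slice i v) (fst x) (snd x) \<in> I" using cyc by (simp add: cyc_def Suc mv_FA case_prod_unfold)
    then have cy: "dF (slice i v) w M \<in> I" for w M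
      using sv Suc by (intro dF_supp_mem[of j]) (auto intro: supp_dF)
    have "0 < i" using Suc by simp
    obtain g where "vcw g" "supp (Suc i) g" "\<And>w M. M \<subseteq> {1..n} \<Longrightarrow> slice i v w M - dF g w M \<in> I"
      using exact_pos[OF \<open>0 < i\<close> sv cy] by metis
    then show ?thesis by blast
  qed
  then obtain g where g: "vcw g" "supp (Suc i) g" "\<And>w M. M \<subseteq> {1..n} \<Longrightarrow> slice i v w M - dF g w M \<in> I" by blast
  have "vc (\<lambda>(w, M). g w M)" using g(1) by (auto simp: vcw_def vc_def)
  moreover have "eqm I (FX i) v (mv (FX (Suc i)) (FA i) (\<lambda>(w, M). g w M))"
    unfolding eqm_def
  proof
    fix x assume x: "x \<in> FX i"
    obtain w M where wM: "x = (w, M)" by (cases x)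
    have M: "M \<subseteq> {1..n}" using x wM by (simp add: FX_def)
    have "slice i v w M = v x" using x wM by (simp add: slice_def)
    with g(3)[OF M, of w] show "v x - mv (FX (Suc i)) (FA i) (\<lambda>(w, M). g w M) x \<in> I"
      by (simp add: mv_FA slice_self[OF g(2)] wM)
  qed
  ultimately show "\<exists>w. vc w \<and> eqm I (FX i) v (mv (FX (Suc i)) (FA i) w)" by blast
qed

text \<open>By minimality the differential is zero modulo the augmentation ideal, so all unit
  vectors together form a basis and the dimension of Tor is the rank.\<close>

lemma golod_hbasis:
  "hbasis {a \<in> C. ev a = 0} FX FA i (FX i) (\<lambda>k x. if x = k then 1 else 0)"
  unfolding hbasis_def
proof (intro conjI ballI allI impI)
  let ?Q = "{a \<in> C. ev a = 0}"
  have d0: "mv (FX (Suc i)) (FA i) f x \<in> ?Q" if "vc f" "x \<in> FX i" for f i x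
  proof -
    have "mv (FX (Suc i)) (FA i) f x \<in> C" using vc_mv[OF mc_FA that(1)] unfolding vc_def by blast
    moreover have "ev (mv (FX (Suc i)) (FA i) f (fst x, snd x)) = 0"
      using that by (intro FA_minimal FX_D[of "fst x" _ i]) simp_all
    ultimately show ?thesis by simp
  qed
  show "finite (FX i)" by (rule finite_FX)
  show "vc (\<lambda>x. if x = k then 1 else (0 :: 'a))" for k :: "'a word \<times> nat set" by (rule vc_unit)
  show "hcyc ?Q FX FA i (\<lambda>x. if x = k then 1 else 0)" for k
    using d0[OF vc_unit] by (auto simp: hcyc_def split: nat.splits)
  have unit_sum: "(\<Sum>k\<in>FX i. cst (c k) * (if x = k then 1 else 0)) = cst (c x)" if "x \<in> FX i" for c x
    using that by (simp add: if_distrib[of "\<lambda>z. _ * z"] finite_FX cong: if_cong)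
  show "\<exists>c w. vc w \<and> eqm ?Q (FX i) v (\<lambda>x. (\<Sum>k\<in>FX i. cst (c k) * (if x = k then 1 else 0)) + mv (FX (Suc i)) (FA i) w x)"
    if v: "vc v" for v
  proof (intro exI conjI)
    show "vc (\<lambda>_. 0 :: 'a)" by (simp add: vc_def zero_C)
    show "eqm ?Q (FX i) v (\<lambda>x. (\<Sum>k\<in>FX i. cst (ev (v k)) * (if x = k then 1 else 0)) + mv (FX (Suc i)) (FA i) (\<lambda>_. 0) x)"
      unfolding eqm_def using v
      by (intro ballI, subst unit_sum) (auto simp: mv_def vc_def C_intros ev_diff ev_cst)
  qed
  fix c w k assume "vc w" "eqm ?Q (FX i) (\<lambda>x. \<Sum>k\<in>FX i. cst (c k) * (if x = k then 1 else 0)) (mv (FX (Suc i)) (FA i) w)"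
    and k: "k \<in> FX i"
  then have "cst (c k) - mv (FX (Suc i)) (FA i) w k \<in> ?Q" by (auto simp: eqm_def unit_sum)
  from idl_mono_in[OF idl_kernel this d0[OF \<open>vc w\<close> k]] show "c k = 0" by (simp add: ev_cst)
qed

end

section \<open>The Koszul complex over the ambient ring and its homology modulo the ideal\<close>

section \<open>Poincare series of the Golod complex\<close>

text \<open>Without letters the Golod complex is the Koszul complex itself. If \<open>bd a\<close>
  vanishes then so does \<open>hh (bd a)\<close>, and the homotopy identity exhibits
  \<open>a\<close> as a boundary in positive degree.\<close>

lemma (in koszul) koszul_golod: "golod C cst ev n y D kap {0} {0} (\<lambda>_. {})"
proof
  show "idl {0}" by (rule idl_zero)
  fix a :: "nat set \<Rightarrow> 'a" and i
  assume a: "vc a" "homog (Suc i) a" "\<forall>M\<subseteq>{1..n}. bd a M \<in> {0}"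
  have hz: "hh (bd a) M = 0" for M
  proof (cases "M = {} \<or> \<not> M \<subseteq> {1..n}")
    case False
    then have "M - {Min M} \<subseteq> {1..n}" by blast
    then show ?thesis using a(3) by (simp add: hh_def D_zero)
  qed (auto simp: hh_def)
  have "a {} = 0" using a(2) by (auto simp: homog_def)
  then have "bd (hh a) M = a M" if "M \<subseteq> {1..n}" for M
    using homotopy_identity[OF a(1) that] hz by (simp add: ev_zero cst_zero)
  then have "eqm {0} (Pow {1..n}) a (\<lambda>M. (\<Sum>v\<in>{}. cst (c v) * v M) + bd (hh a) M)" for c :: "(nat set \<Rightarrow> 'a) \<Rightarrow> 'k"
    by (simp add: eqm_def)
  then show "\<exists>c g. vc g \<and> homog (Suc (Suc i)) g \<and> eqm {0} (Pow {1..n}) a (\<lambda>M. (\<Sum>v\<in>{}. cst (c v) * v M) + bd g M)"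
    using vc_hh[OF a(1)] homog_hh[OF a(2)] by blast
qed auto

context golod
begin

interpretation K: golod C cst ev n y D kap "{0}" "{0}" "\<lambda>_. {}"
  by (rule koszul_golod)

lemma koszul_FX: "x \<in> K.FX N \<longleftrightarrow> (\<exists>M. x = ([], M) \<and> M \<subseteq> {1..n} \<and> card M = N)"
  by (auto simp: K.FX_def K.Lt_def)

lemma koszul_FA: "mv (K.FX (Suc N)) (K.FA N) f ([], M) = bd (K.slice (Suc N) f []) M"
  by (simp add: K.mv_FA K.dF_def K.Lt_def)

lemma koszul_slice: "homog N g \<Longrightarrow> K.slice N (\<lambda>(w, M). g M) [] = g"
  by (auto simp: K.slice_def koszul_FX homog_def fun_eq_iff)

lemma koszul_homog: "homog N (K.slice N f [])"
  by (auto simp: K.slice_def koszul_FX homog_def split: if_splits)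

lemma eqm_homog:
  assumes "homog i a" "homog i b" "\<And>M. M \<subseteq> {1..n} \<Longrightarrow> card M = i \<Longrightarrow> a M - b M \<in> I"
  shows "eqm I (Pow {1..n}) a b"
  unfolding eqm_def
proof
  fix M assume M: "M \<in> Pow {1..n}"
  show "a M - b M \<in> I"
  proof (cases "card M = i")
    case False
    then have "a M = 0" "b M = 0" using assms(1,2) unfolding homog_def by blast+
    then show ?thesis by (simp add: idlD(2)[OF idl_I])
  qed (use M assms(3) in simp)
qed

lemma homog_cst_sum: "(\<And>v. v \<in> X \<Longrightarrow> homog i (z v)) \<Longrightarrow> homog i (\<lambda>M. \<Sum>v\<in>X. cst (c v) * z v M)"
  by (induction X rule: infinite_finite_induct) (simp_all add: homog_zero homog_add homog_scale)

text \<open>The resolution over the zero ideal is now read modulo \<open>I\<close>, where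
  \<open>V i\<close> was chosen as a basis of its homology. Only the empty word occurs, so the proof
  is a change of indexing from subsets to pairs.\<close>

lemma koszul_hbasis_pos: "hbasis I K.FX K.FA (Suc i) (V i) (\<lambda>v (w, M). v M)"
  unfolding hbasis_def
proof (intro conjI ballI allI impI)
  show "finite (V i)" by (rule V_finite)
  fix v assume v: "v \<in> V i"
  show "vc (\<lambda>(w :: 'a word, M). v M)" using V_cycle[OF v] by (auto simp: vc_def)
  have "K.slice (Suc i) (\<lambda>(w, M). v M) [] = v" using V_cycle[OF v] by (intro koszul_slice) simp
  then show "hcyc I K.FX K.FA (Suc i) (\<lambda>(w, M). v M)" using V_cycle[OF v] by (auto simp: hcyc_def koszul_FX koszul_FA)
next
  fix f assume f: "vc f" "hcyc I K.FX K.FA (Suc i) f"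
  let ?a = "K.slice (Suc i) f []"
  have a: "vc ?a" "homog (Suc i) ?a" using K.vcw_slice[OF f(1)] koszul_homog by (auto simp: K.vcw_def)
  have "eqm I (Pow {1..n}) (bd ?a) (\<lambda>_. 0)"
    using f(2) by (intro eqm_homog[OF homog_bd[OF a(2)] homog_zero]) (auto simp: hcyc_def koszul_FX koszul_FA[symmetric])
  then have "\<forall>M\<subseteq>{1..n}. bd ?a M \<in> I" by (simp add: eqm_def Ball_def)
  from V_span[OF a this] obtain c g where g: "vc g" "homog (Suc (Suc i)) g"
    "eqm I (Pow {1..n}) ?a (\<lambda>M. (\<Sum>v\<in>V i. cst (c v) * v M) + bd g M)" by blast
  let ?g = "\<lambda>(w :: 'a word, M). g M"
  have "vc ?g" using g(1) by (auto simp: vc_def)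
  moreover have "eqm I (K.FX (Suc i)) f (\<lambda>x. (\<Sum>v\<in>V i. cst (c v) * (case x of (w, M) \<Rightarrow> v M)) + mv (K.FX (Suc (Suc i))) (K.FA (Suc i)) ?g x)"
    unfolding eqm_def
  proof
    fix x assume x: "x \<in> K.FX (Suc i)"
    then obtain M where M: "x = ([], M)" "M \<subseteq> {1..n}" by (auto simp: koszul_FX)
    have "?a M = f x" using x M by (simp add: K.slice_def)
    moreover have "?a M - ((\<Sum>v\<in>V i. cst (c v) * v M) + bd g M) \<in> I" using g(3) M(2) by (simp add: eqm_def)
    ultimately show "f x - ((\<Sum>v\<in>V i. cst (c v) * (case x of (w, M) \<Rightarrow> v M)) + mv (K.FX (Suc (Suc i))) (K.FA (Suc i)) ?g x) \<in> I"
      by (simp add: M(1) koszul_FA koszul_slice[OF g(2)])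
  qed
  ultimately show "\<exists>c w. vc w \<and> eqm I (K.FX (Suc i)) f (\<lambda>x. (\<Sum>v\<in>V i. cst (c v) * (case x of (w, M) \<Rightarrow> v M)) + mv (K.FX (Suc (Suc i))) (K.FA (Suc i)) w x)"
    by blast
next
  fix c f v
  assume f: "vc f" "eqm I (K.FX (Suc i)) (\<lambda>x. \<Sum>v\<in>V i. cst (c v) * (case x of (w, M) \<Rightarrow> v M)) (mv (K.FX (Suc (Suc i))) (K.FA (Suc i)) f)"
    and v: "v \<in> V i"
  let ?g = "K.slice (Suc (Suc i)) f []"
  have g: "vc ?g" "homog (Suc (Suc i)) ?g" using K.vcw_slice[OF f(1)] koszul_homog by (auto simp: K.vcw_def)
  have "eqm I (Pow {1..n}) (\<lambda>M. \<Sum>v\<in>V i. cst (c v) * v M) (bd ?g)"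
  proof (rule eqm_homog)
    show "homog (Suc i) (\<lambda>M. \<Sum>v\<in>V i. cst (c v) * v M)" using V_cycle by (intro homog_cst_sum) blast
    show "homog (Suc i) (bd ?g)" by (rule homog_bd[OF g(2)])
    fix M assume "M \<subseteq> {1..n}" "card M = Suc i"
    then have "([], M) \<in> K.FX (Suc i)" by (simp add: koszul_FX)
    with f(2) show "(\<Sum>v\<in>V i. cst (c v) * v M) - bd ?g M \<in> I"
      by (fastforce simp: eqm_def koszul_FA[symmetric])
  qed
  from V_indep[OF g this v] show "c v = 0" .
qed

text \<open>\<open>hh\<close> shows that an element differs from its constant term by a boundary;
  conversely boundaries and \<open>I\<close> have zero augmentation, so no nonzero constant is a
  boundary modulo \<open>I\<close>.\<close>

lemma koszul_hbasis_zero: "hbasis I K.FX K.FA 0 {()} (\<lambda>_ _. 1)"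
  unfolding hbasis_def
proof (intro conjI ballI allI impI)
  show "finite {()}" by simp
  show "vc (\<lambda>_ :: 'a word \<times> nat set. 1 :: 'a)" by (simp add: vc_def one_C)
  show "hcyc I K.FX K.FA 0 (\<lambda>_. 1)" by (simp add: hcyc_def)
next
  fix f :: "'a word \<times> nat set \<Rightarrow> 'a" assume f: "vc f"
  let ?a = "K.slice 0 f []" and ?q = "f ([], {})"
  have a: "vc ?a" "homog 0 ?a" using K.vcw_slice[OF f(1)] koszul_homog by (auto simp: K.vcw_def)
  have bz: "bd ?a {} = 0"
    by (auto simp: bd_def iot_def K.slice_def koszul_FX intro!: sum.neutral)
  have "?a {} = ?q" by (simp add: K.slice_def koszul_FX)
  then have id: "bd (hh ?a) {} = ?q - cst (ev ?q)"
    using homotopy_identity[OF a(1), of "{}"] by (simp add: hh_def)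
  have g: "homog (Suc 0) (hh ?a)" by (rule homog_hh[OF a(2)])
  let ?g = "\<lambda>(w :: 'a word, M). hh ?a M"
  have "vc ?g" using vc_hh[OF a(1)] by (auto simp: vc_def)
  moreover have "eqm I (K.FX 0) f (\<lambda>x. (\<Sum>u\<in>{()}. cst (ev ?q) * 1) + mv (K.FX (Suc 0)) (K.FA 0) ?g x)"
    by (auto simp: eqm_def koszul_FA koszul_slice[OF g] id K.FX_0 idlD(2)[OF idl_I])
  ultimately show "\<exists>(c :: unit \<Rightarrow> 'k) w. vc w \<and> eqm I (K.FX 0) f (\<lambda>x. (\<Sum>u\<in>{()}. cst (c u) * 1) + mv (K.FX (Suc 0)) (K.FA 0) w x)"
    by (intro exI[of _ "\<lambda>_. ev ?q"] exI[of _ ?g]) simp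
next
  fix c :: "unit \<Rightarrow> 'k" and f k
  assume f: "vc f" "eqm I (K.FX 0) (\<lambda>x. \<Sum>u\<in>{()}. cst (c u) * 1) (mv (K.FX (Suc 0)) (K.FA 0) f)"
  let ?m = "mv (K.FX (Suc 0)) (K.FA 0) f ([], {})"
  have "cst (c ()) - ?m \<in> I" using f(2) by (simp add: eqm_def K.FX_0)
  then have "ev (cst (c ()) - ?m) = 0" by (rule idlD(5)[OF idl_I])
  moreover have "ev ?m = 0" using f(1) by (intro K.FA_minimal) auto
  moreover have "?m \<in> C" using vc_mv[OF K.mc_FA f(1)] by (simp add: vc_def)
  ultimately have "c () = 0" by (simp add: ev_diff cst_C ev_cst)
  then show "c k = 0" by simp
qed

text \<open>The zero function in degree 0 is a mere tag: a one-element index set of the same type as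
  \<open>V\<close>, standing for the class of 1.\<close>

lemma koszul_hbasis:
  "\<exists>z. hbasis I K.FX K.FA i (if i = 0 then {\<lambda>_. 0} else V (i - 1)) (z :: (nat set \<Rightarrow> 'a) \<Rightarrow> 'a word \<times> nat set \<Rightarrow> 'a)"
proof (cases i)
  case 0
  have "hbasis I K.FX K.FA 0 {\<lambda>_. 0 :: 'a} (\<lambda>_ _. 1)"
    using koszul_hbasis_zero unfolding hbasis_def by (auto; metis)
  with 0 show ?thesis by auto
next
  case (Suc j)
  then show ?thesis using koszul_hbasis_pos[of j] by auto
qed

theorem koszul_resolution:
  "\<exists>(X :: nat \<Rightarrow> ('a word \<times> nat set) set) d g. res {0} X d g
    \<and> (\<forall>i. \<exists>z :: (nat set \<Rightarrow> 'a) \<Rightarrow> 'a word \<times> nat set \<Rightarrow> 'a. hbasis I X d i (if i = 0 then {\<lambda>_. 0} else V (i - 1)) z)"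
  using K.golod_resolution koszul_hbasis by blast

section \<open>Generating functions of words, letters and ranks\<close>

definition words :: "nat \<Rightarrow> 'a word set"
  where "words m = {w. set w \<subseteq> Lt \<and> wdeg w = m}"

lemma finite_words: "finite (words m)"
proof (rule finite_subset)
  show "words m \<subseteq> {w. set w \<subseteq> Lt \<and> length w \<le> m}" using length_le_wdeg by (auto simp: words_def)
  show "finite {w. set w \<subseteq> Lt \<and> length w \<le> m}" by (rule finite_lists_length_le[OF finite_Lt])
qed

text \<open>The Hilbert series of the tensor algebra on the shifted letters.\<close>

definition word_series :: "rat fps"
  where "word_series = Abs_fps (\<lambda>m. of_nat (card (words m)))"

text \<open>The shift of index matches \<open>V i\<close> with homological degree
  \<open>Suc i\<close>; the leading 1 is the class of the unit.\<close>

definition betti_series :: "rat fps"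
  where "betti_series = Abs_fps (\<lambda>i. of_nat (if i = 0 then 1 else card (V (i - 1))))"

text \<open>A word is empty or a letter followed by a word, which is the recursion of a geometric
  series.\<close>

lemma word_series_eq: "word_series = 1 + (\<Sum>v\<in>Lt. fps_X ^ (fst v + 2)) * word_series"
proof (rule fps_ext)
  fix m
  \<comment> \<open>The guard \<open>m < fst v + 2\<close> keeps truncated subtraction from
    admitting letters of too large degree.\<close>
  have split: "words m = (if m = 0 then {[]} else {}) \<union> (\<Union>v\<in>Lt. (#) v ` (if m < fst v + 2 then {} else words (m - (fst v + 2))))"
    (is "_ = ?A \<union> ?B")
  proof (intro equalityI subsetI)
    fix w assume w: "w \<in> words m"
    then show "w \<in> ?A \<union> ?B"
    proof (cases w)
      case (Cons v w')
      then have "v \<in> Lt" "w' \<in> words (m - (fst v + 2))" "\<not> m < fst v + 2" using w by (auto simp: words_def)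
      then show ?thesis unfolding Cons by auto
    qed (simp add: words_def)
  next
    fix w assume "w \<in> ?A \<union> ?B"
    then show "w \<in> words m" by (auto simp: words_def split: if_splits)
  qed
  have "card (words m) = card ?A + card ?B"
    unfolding split using finite_Lt finite_words by (intro card_Un_disjoint) auto
  also have "card ?B = (\<Sum>v\<in>Lt. card ((#) v ` (if m < fst v + 2 then {} else words (m - (fst v + 2)))))"
    using finite_words by (intro card_UN_disjoint finite_Lt) auto
  also have "\<dots> = (\<Sum>v\<in>Lt. if m < fst v + 2 then 0 else card (words (m - (fst v + 2))))"
    by (intro sum.cong) (auto simp: card_image)
  finally have "rat_of_nat (card (words m)) = of_nat (card ?A) + (\<Sum>v\<in>Lt. if m < fst v + 2 then 0 else of_nat (card (words (m - (fst v + 2)))))"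
    by (simp add: if_distrib[of of_nat] cong: if_cong)
  then show "fps_nth word_series m = fps_nth (1 + (\<Sum>v\<in>Lt. fps_X ^ (fst v + 2)) * word_series) m"
    by (simp add: sum_distrib_right fps_sum_nth fps_X_power_mult_nth word_series_def del: power_Suc add_2_eq_Suc' cong: if_cong)
qed

text \<open>A letter from \<open>V i\<close> has degree \<open>i + 2\<close>, one more than the
  homological degree of its class; hence the factor \<open>fps_X\<close>.\<close>

lemma letter_series: "(\<Sum>v\<in>Lt. fps_X ^ (fst v + 2)) = fps_X * (betti_series - 1)"
proof (rule fps_ext)
  fix m
  have "card {v \<in> Lt. fst v + 2 = m} = (if m < 2 then 0 else card (V (m - 2)))"
  proof (cases "m < 2")
    case False
    then have "{v \<in> Lt. fst v + 2 = m} = Pair (m - 2) ` V (m - 2)" by (auto simp: in_Lt)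
    then show ?thesis using False by (simp add: card_image inj_on_def)
  next
    case True
    then have "{v \<in> Lt. fst v + 2 = m} = {}" by auto
    then show ?thesis using True by (simp only: card.empty if_True)
  qed
  moreover have "(\<Sum>v\<in>Lt. fps_nth (fps_X ^ (fst v + 2)) m) = (of_nat (card {v \<in> Lt. fst v + 2 = m}) :: rat)"
    by (simp add: fps_X_power_nth finite_Lt sum.If_cases Int_def eq_commute[of m] del: power_Suc add_2_eq_Suc')
  ultimately show "fps_nth (\<Sum>v\<in>Lt. fps_X ^ (fst v + 2)) m = fps_nth (fps_X * (betti_series - 1)) m"
    by (auto simp: fps_sum_nth betti_series_def diff_diff_add numeral_2_eq_2 simp del: power_Suc)
qed

text \<open>A basis element is a subset and a word chosen independently, and expanding the product
  of \<open>1 + fps_X\<close> over \<open>{1..n}\<close> enumerates the subsets by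
  cardinality.\<close>

lemma rank_series: "Abs_fps (\<lambda>N. of_nat (card (FX N))) = (1 + fps_X) ^ n * word_series"
proof (rule fps_ext)
  fix N
  have "(1 + fps_X :: rat fps) ^ n = (\<Prod>i\<in>{1..n}. fps_X + 1)" by (simp add: add.commute)
  also have "\<dots> = (\<Sum>M\<in>Pow {1..n}. fps_X ^ card M)"
    by (subst prod_add) (auto simp: prod_constant)
  finally have *: "(1 + fps_X :: rat fps) ^ n = (\<Sum>M\<in>Pow {1..n}. fps_X ^ card M)" .
  have "card (FX N) = card (SIGMA M:Pow {1..n}. if N < card M then {} else words (N - card M))"
    by (rule bij_betw_same_card[of "\<lambda>(w, M). (M, w)"], rule bij_betwI[of _ _ _ "\<lambda>(M, w). (w, M)"])
       (auto simp: FX_def words_def split: if_splits)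
  also have "\<dots> = (\<Sum>M\<in>Pow {1..n}. if N < card M then 0 else card (words (N - card M)))"
    using finite_words by (subst card_SigmaI) (auto intro!: sum.cong)
  finally have "rat_of_nat (card (FX N)) = (\<Sum>M\<in>Pow {1..n}. if N < card M then 0 else of_nat (card (words (N - card M))))"
    by (simp add: if_distrib[of of_nat] cong: if_cong)
  then show "fps_nth (Abs_fps (\<lambda>N. of_nat (card (FX N)))) N = fps_nth ((1 + fps_X) ^ n * word_series) N"
    unfolding * by (simp add: sum_distrib_right fps_sum_nth fps_X_power_mult_nth word_series_def cong: if_cong)
qed

theorem golod_series: "Abs_fps (\<lambda>N. of_nat (card (FX N))) = (1 + fps_X) ^ n / (1 - fps_X * (betti_series - 1))"
proof -
  let ?d = "1 - fps_X * (betti_series - 1)"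
  \<comment> \<open>The recursion exhibits \<open>word_series\<close> as the inverse of the
    denominator, so the division of power series below is a genuine one.\<close>
  have w: "word_series * ?d = 1" using word_series_eq unfolding letter_series by (simp add: algebra_simps)
  then have "Abs_fps (\<lambda>N. of_nat (card (FX N))) * ?d = (1 + fps_X) ^ n" by (simp add: rank_series mult.assoc)
  moreover have "?d \<noteq> 0" using w by (metis mult_zero_right zero_neq_one)
  ultimately show ?thesis by (metis nonzero_mult_div_cancel_right)
qed

end

section \<open>Tor and dimensions\<close>

context augmented_subring
begin

text \<open>\<open>W\<close> is known only through the surjection \<open>\<tau>\<close> from
  representatives, so the vector space axioms are transported along it before the images of the
  \<open>z k\<close> are seen to be a basis.\<close>

lemma dim_quotient:
  fixes W :: "('k, 'c) module" and \<tau> :: "('x \<Rightarrow> 'a) \<Rightarrow> 'c" and Z :: "('x \<Rightarrow> 'a) set" and V :: "'v set"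
  assumes W: "carrier W = \<tau> ` Z" "zero W = \<tau> (\<lambda>_. 0)"
      "\<And>u v. u \<in> Z \<Longrightarrow> v \<in> Z \<Longrightarrow> add W (\<tau> u) (\<tau> v) = \<tau> (\<lambda>x. u x + v x)"
      "\<And>c u. u \<in> Z \<Longrightarrow> smult W c (\<tau> u) = \<tau> (\<lambda>x. cst c * u x)"
    and Z: "(\<lambda>_. 0) \<in> Z" "\<And>u v. u \<in> Z \<Longrightarrow> v \<in> Z \<Longrightarrow> (\<lambda>x. u x + v x) \<in> Z"
      "\<And>c u. u \<in> Z \<Longrightarrow> (\<lambda>x. cst c * u x) \<in> Z"
    and V: "finite V" "\<And>k. k \<in> V \<Longrightarrow> z k \<in> Z"
      "\<And>u. u \<in> Z \<Longrightarrow> \<exists>c. \<tau> u = \<tau> (\<lambda>x. \<Sum>k\<in>V. cst (c k) * z k x)"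
      "\<And>c k. \<tau> (\<lambda>x. \<Sum>k\<in>V. cst (c k) * z k x) = \<tau> (\<lambda>_. 0) \<Longrightarrow> k \<in> V \<Longrightarrow> c k = 0"
  shows "vectorspace.dim (class_ring :: 'k ring) W = card V"
proof -
  have neg: "(\<lambda>x. - u x) \<in> Z" if "u \<in> Z" for u using Z(3)[OF that, of "- 1"] by (simp add: cst_minus cst_one)
  have ag: "abelian_group W"
  proof (rule abelian_groupI)
    fix x assume "x \<in> carrier W"
    then obtain u where u: "u \<in> Z" "x = \<tau> u" using W(1) by auto
    then show "\<exists>y\<in>carrier W. y \<oplus>\<^bsub>W\<^esub> x = \<zero>\<^bsub>W\<^esub>"
      using neg[OF u(1)] by (intro bexI[of _ "\<tau> (\<lambda>x. - u x)"]) (simp_all add: W)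
    show "\<zero>\<^bsub>W\<^esub> \<oplus>\<^bsub>W\<^esub> x = x" using u Z by (simp add: W)
  next
    fix x y assume "x \<in> carrier W" "y \<in> carrier W"
    then obtain u v where u: "u \<in> Z" "x = \<tau> u" "v \<in> Z" "y = \<tau> v" using W(1) by auto
    then show "x \<oplus>\<^bsub>W\<^esub> y \<in> carrier W" "x \<oplus>\<^bsub>W\<^esub> y = y \<oplus>\<^bsub>W\<^esub> x" by (simp_all add: W Z add.commute)
    fix w assume "w \<in> carrier W"
    then obtain t where "t \<in> Z" "w = \<tau> t" using W(1) by auto
    with u show "x \<oplus>\<^bsub>W\<^esub> y \<oplus>\<^bsub>W\<^esub> w = x \<oplus>\<^bsub>W\<^esub> (y \<oplus>\<^bsub>W\<^esub> w)" by (simp add: W Z add.assoc)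
  qed (use W Z in auto)
  have cf: "field (class_ring :: 'k ring)" by (rule class_field.field_axioms)
  have md: "module (class_ring :: 'k ring) W"
  proof (rule Module.moduleI)
    show "cring (class_ring :: 'k ring)" by (rule class_cring.cring_axioms)
    fix a b x y assume "x \<in> carrier W" "y \<in> carrier W"
    then obtain u v where u: "u \<in> Z" "x = \<tau> u" "v \<in> Z" "y = \<tau> v" using W(1) by auto
    show "a \<odot>\<^bsub>W\<^esub> (x \<oplus>\<^bsub>W\<^esub> y) = a \<odot>\<^bsub>W\<^esub> x \<oplus>\<^bsub>W\<^esub> a \<odot>\<^bsub>W\<^esub> y" using u by (simp add: W Z distrib_left)
  next
    fix a b x assume "x \<in> carrier W"
    then obtain u where u: "u \<in> Z" "x = \<tau> u" using W(1) by auto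
    show "a \<odot>\<^bsub>W\<^esub> x \<in> carrier W" using u by (simp add: W Z)
    show "(a \<oplus>\<^bsub>class_ring\<^esub> b) \<odot>\<^bsub>W\<^esub> x = a \<odot>\<^bsub>W\<^esub> x \<oplus>\<^bsub>W\<^esub> b \<odot>\<^bsub>W\<^esub> x"
      using u by (simp add: W Z cst_add distrib_right)
    show "(a \<otimes>\<^bsub>class_ring\<^esub> b) \<odot>\<^bsub>W\<^esub> x = a \<odot>\<^bsub>W\<^esub> (b \<odot>\<^bsub>W\<^esub> x)"
      using u by (simp add: W Z cst_mult mult.assoc)
    show "\<one>\<^bsub>class_ring\<^esub> \<odot>\<^bsub>W\<^esub> x = x" using u by (simp add: W Z cst_one)
  qed (rule ag)
  interpret vectorspace "class_ring :: 'k ring" W by (rule vectorspace.intro[OF md cf])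
  have Zsum: "(\<lambda>x. \<Sum>k\<in>F. cst (c k) * z k x) \<in> Z" if "finite F" "F \<subseteq> V" for F c
    using that
  proof (induction F rule: finite_induct)
    case (insert k F)
    then show ?case using Z(2)[OF Z(3)[OF V(2)], of k "\<lambda>x. \<Sum>k\<in>F. cst (c k) * z k x" "c k"] by simp
  qed (simp add: Z)
  have comb: "finsum W (\<lambda>k. c k \<odot>\<^bsub>W\<^esub> \<tau> (z k)) F = \<tau> (\<lambda>x. \<Sum>k\<in>F. cst (c k) * z k x)"
    if "finite F" "F \<subseteq> V" for F c
    using that
  proof (induction F rule: finite_induct)
    case (insert k F)
    have k: "z k \<in> Z" using insert V(2) by blast
    have "finsum W (\<lambda>k. c k \<odot>\<^bsub>W\<^esub> \<tau> (z k)) (insert k F)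
        = (c k \<odot>\<^bsub>W\<^esub> \<tau> (z k)) \<oplus>\<^bsub>W\<^esub> finsum W (\<lambda>k. c k \<odot>\<^bsub>W\<^esub> \<tau> (z k)) F"
      using insert V(2) by (intro M.finsum_insert) (auto simp: W Z)
    also have "\<dots> = \<tau> (\<lambda>x. cst (c k) * z k x) \<oplus>\<^bsub>W\<^esub> \<tau> (\<lambda>x. \<Sum>k\<in>F. cst (c k) * z k x)"
      using insert k by (simp add: W)
    also have "\<dots> = \<tau> (\<lambda>x. \<Sum>k\<in>insert k F. cst (c k) * z k x)"
      using insert k Zsum[of F c] by (simp add: W Z)
    finally show ?case .
  qed (simp add: W)
  have inj: "inj_on (\<lambda>k. \<tau> (z k)) V"
  proof (rule inj_onI, rule ccontr)
    fix k l assume kl: "k \<in> V" "l \<in> V" "\<tau> (z k) = \<tau> (z l)" "k \<noteq> l"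
    \<comment> \<open>Equal images of two indices would give a nontrivial relation with these
      coefficients; injectivity lets \<open>V\<close> be counted instead of its image.\<close>
    let ?c = "\<lambda>j. if j = k then 1 else if j = l then - 1 else 0 :: 'k"
    have "(\<lambda>x. \<Sum>j\<in>V. cst (?c j) * z j x) = (\<lambda>x. z k x + cst (- 1) * z l x)"
    proof
      fix x
      have "(\<Sum>j\<in>V. cst (?c j) * z j x) = (\<Sum>j\<in>{k, l}. cst (?c j) * z j x)"
        using kl V(1) by (intro sum.mono_neutral_right) (auto simp: cst_zero)
      then show "(\<Sum>j\<in>V. cst (?c j) * z j x) = z k x + cst (- 1) * z l x" using kl(4) by (simp add: cst_one)
    qed
    then have "\<tau> (\<lambda>x. \<Sum>j\<in>V. cst (?c j) * z j x) = \<tau> (z k) \<oplus>\<^bsub>W\<^esub> (- 1) \<odot>\<^bsub>W\<^esub> \<tau> (z l)"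
      using kl(1,2) V(2) by (simp add: W(3,4) Z)
    also have "\<dots> = \<tau> (z l) \<oplus>\<^bsub>W\<^esub> (- 1) \<odot>\<^bsub>W\<^esub> \<tau> (z l)" by (simp add: kl(3))
    also have "\<dots> = \<tau> (\<lambda>x. z l x + cst (- 1) * z l x)" using kl(2) V(2) by (simp add: W(3,4) Z)
    also have "\<dots> = \<tau> (\<lambda>_. 0)" by (simp add: cst_minus cst_one)
    finally have "?c k = 0" using V(4)[of ?c k] kl(1) by blast
    then show False by simp
  qed
  let ?B = "(\<lambda>k. \<tau> (z k)) ` V"
  have lin: "lincomb a ((\<lambda>k. \<tau> (z k)) ` F) = \<tau> (\<lambda>x. \<Sum>k\<in>F. cst (a (\<tau> (z k))) * z k x)" if "finite F" "F \<subseteq> V" for a F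
  proof -
    have "lincomb a ((\<lambda>k. \<tau> (z k)) ` F) = finsum W (\<lambda>k. a (\<tau> (z k)) \<odot>\<^bsub>W\<^esub> \<tau> (z k)) F"
      unfolding lincomb_def using that V(2) inj_on_subset[OF inj that(2)]
      by (intro M.finsum_reindex) (auto simp: W Z)
    then show ?thesis using comb[OF that, of "\<lambda>k. a (\<tau> (z k))"] by simp
  qed
  have "basis ?B"
    unfolding basis_def
  proof (intro conjI)
    show "?B \<subseteq> carrier W" using V(2) W(1) by auto
    show "lin_indpt ?B"
    proof
      assume "lin_dep ?B"
      then obtain F a v where F: "finite F" "F \<subseteq> ?B" "lincomb a F = \<zero>\<^bsub>W\<^esub>" "v \<in> F" "a v \<noteq> 0"
        unfolding lin_dep_def by auto
      from F(2) obtain G where G: "G \<subseteq> V" "F = (\<lambda>k. \<tau> (z k)) ` G" by (auto simp: subset_image_iff)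
      have fG: "finite G" using G(1) V(1) finite_subset by blast
      let ?c = "\<lambda>k. if k \<in> G then a (\<tau> (z k)) else 0"
      have "(\<lambda>x. \<Sum>k\<in>V. cst (?c k) * z k x) = (\<lambda>x. \<Sum>k\<in>G. cst (a (\<tau> (z k))) * z k x)"
        using G(1) V(1) by (intro ext sum.mono_neutral_cong_right) (auto simp: cst_zero)
      then have c0: "\<tau> (\<lambda>x. \<Sum>k\<in>V. cst (?c k) * z k x) = \<tau> (\<lambda>_. 0)"
        using lin[OF fG G(1), of a] F(3) G(2) by (simp add: W(2))
      have "?c k = 0" if "k \<in> V" for k using V(4)[of ?c k, OF c0 that] .
      then show False using F(4,5) G by fastforce
    qed
    show "span ?B = carrier W"
    proof
      show "span ?B \<subseteq> carrier W"
      proof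
        fix s assume "s \<in> span ?B"
        then obtain F a where F: "F \<subseteq> ?B" "s = lincomb a F" unfolding span_def by auto
        from F(1) obtain G where G: "G \<subseteq> V" "F = (\<lambda>k. \<tau> (z k)) ` G" by (auto simp: subset_image_iff)
        have fG: "finite G" using G(1) V(1) finite_subset by blast
        show "s \<in> carrier W" using lin[OF fG G(1), of a] Zsum[OF fG G(1)] F(2) G(2) by (simp add: W(1))
      qed
      show "carrier W \<subseteq> span ?B"
      proof
        fix s assume "s \<in> carrier W"
        then obtain u where u: "u \<in> Z" "s = \<tau> u" using W(1) by auto
        obtain c where c: "\<tau> u = \<tau> (\<lambda>x. \<Sum>k\<in>V. cst (c k) * z k x)" using V(3)[OF u(1)] by blast
        define a where "a = (\<lambda>t. c (the_inv_into V (\<lambda>k. \<tau> (z k)) t))"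
        have "a (\<tau> (z k)) = c k" if "k \<in> V" for k using the_inv_into_f_f[OF inj that] by (simp add: a_def)
        then have "(\<lambda>x. \<Sum>k\<in>V. cst (a (\<tau> (z k))) * z k x) = (\<lambda>x. \<Sum>k\<in>V. cst (c k) * z k x)"
          by (intro ext sum.cong) auto
        then have "lincomb a ?B = s" using lin[OF V(1) order_refl, of a] c u by simp
        then show "s \<in> span ?B" unfolding span_def using V(1) by force
      qed
    qed
  qed
  then have "dim = card ?B" using V(1) by (intro dim_basis) auto
  also have "\<dots> = card V" by (rule card_image[OF inj])
  finally show ?thesis .
qed

text \<open>\<open>free_resolution\<close> admits only the index sets \<open>{..<b i}\<close>;
  enumerations of the finite sets \<open>X i\<close> transport matrices and exactness.\<close>

lemma res_reindex:
  fixes X :: "nat \<Rightarrow> 'x set"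
  assumes I: "idl I" and F: "res I X d g"
  obtains b :: "nat \<Rightarrow> nat" and d' g' where "res I (\<lambda>i. {..<b i}) d' g'"
proof -
  have F': "cplx I X d g" using F by (simp add: res_def)
  have fin: "finite (X i)" and d: "mc (d i)" for i using F' by (auto simp: cplx_def)
  define b where "b i = card (X i)" for i
  have "\<exists>\<beta>. bij_betw \<beta> {..<b i} (X i)" for i
    using ex_bij_betw_nat_finite[OF fin[of i]] by (auto simp: b_def atLeast0LessThan)
  then obtain \<beta> where \<beta>: "\<And>i. bij_betw (\<beta> i) {..<b i} (X i)" by metis
  define \<gamma> where "\<gamma> i = the_inv_into {..<b i} (\<beta> i)" for i
  have \<gamma>: "\<gamma> i (\<beta> i j) = j" if "j < b i" for i j
    using the_inv_into_f_f[of "\<beta> i" "{..<b i}" j] \<beta>[of i] that by (auto simp: \<gamma>_def bij_betw_def)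
  define d' where "d' i p q = d i (\<beta> i p) (\<beta> (Suc i) q)" for i p q
  define g' where "g' j = g (\<beta> 0 j)" for j
  have mv': "mv {..<b (Suc i)} (d' i) v p = mv (X (Suc i)) (d i) (\<lambda>x. v (\<gamma> (Suc i) x)) (\<beta> i p)" for i v p
  proof -
    have "mv (X (Suc i)) (d i) (\<lambda>x. v (\<gamma> (Suc i) x)) (\<beta> i p)
        = (\<Sum>q<b (Suc i). d i (\<beta> i p) (\<beta> (Suc i) q) * v (\<gamma> (Suc i) (\<beta> (Suc i) q)))"
      unfolding mv_def by (rule sum.reindex_bij_betw[OF \<beta>, symmetric])
    then show ?thesis by (simp add: mv_def d'_def \<gamma>)
  qed
  have vc': "vc (\<lambda>x. v (\<gamma> i x))" if "vc v" for v :: "nat \<Rightarrow> 'a" and i using that by (simp add: vc_def)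
  have X_iff: "(\<forall>x\<in>X i. P x) \<longleftrightarrow> (\<forall>p\<in>{..<b i}. P (\<beta> i p))" for P i
    using \<beta>[of i] unfolding bij_betw_def by (metis imageE image_eqI lessThan_iff)
  have cyc': "cyc I (\<lambda>i. {..<b i}) d' g' i v \<longleftrightarrow> cyc I X d g i (\<lambda>x. v (\<gamma> i x))" for i v
  proof (cases i)
    case 0
    have "(\<Sum>x\<in>X 0. ev (v (\<gamma> 0 x)) * g x) = (\<Sum>q<b 0. ev (v (\<gamma> 0 (\<beta> 0 q))) * g (\<beta> 0 q))"
      by (rule sum.reindex_bij_betw[OF \<beta>, symmetric])
    also have "\<dots> = (\<Sum>q<b 0. ev (v q) * g' q)" by (intro sum.cong) (auto simp: \<gamma> g'_def)
    finally show ?thesis by (simp add: cyc_def 0)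
  next
    case (Suc j)
    then show ?thesis by (simp add: cyc_def mv' X_iff)
  qed
  have "res I (\<lambda>i. {..<b i}) d' g'"
    unfolding res_def
  proof (intro conjI allI impI)
    show "cplx I (\<lambda>i. {..<b i}) d' g'"
      unfolding cplx_def
    proof (intro conjI allI impI)
      show "finite {..<b i}" for i by simp
      show "mc (d' i)" for i using d[of i] by (simp add: mc_def d'_def)
      fix i and v :: "nat \<Rightarrow> 'a" assume v: "vc v"
      let ?u = "mv (X (Suc i)) (d i) (\<lambda>x. v (\<gamma> (Suc i) x))"
      have c1: "cyc I X d g i ?u" using F' vc'[OF v] by (simp add: cplx_def)
      have c2: "vc ?u" by (intro vc_mv d vc' v)
      have c3: "vc (\<lambda>x. mv {..<b (Suc i)} (d' i) v (\<gamma> i x))"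
        using v d by (intro vc' vc_mv) (simp add: mc_def d'_def)
      have c4: "eqm I (X i) ?u (\<lambda>x. mv {..<b (Suc i)} (d' i) v (\<gamma> i x))"
        unfolding eqm_def X_iff by (simp add: mv' \<gamma> idlD(2)[OF I])
      show "cyc I (\<lambda>i. {..<b i}) d' g' i (mv {..<b (Suc i)} (d' i) v)"
        unfolding cyc' using cyc_cong[where d = d and g = g and X = X and i = i, OF I c4 d c2 c3] c1 by simp
    qed
    obtain v where v: "vc v" "(\<Sum>x\<in>X 0. ev (v x) * g x) = 1" using F by (auto simp: res_def)
    have "(\<Sum>x\<in>X 0. ev (v x) * g x) = (\<Sum>q<b 0. ev (v (\<beta> 0 q)) * g (\<beta> 0 q))"
      by (rule sum.reindex_bij_betw[OF \<beta>, symmetric])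
    then show "\<exists>v. vc v \<and> (\<Sum>x<b 0. ev (v x) * g' x) = 1"
      using v by (intro exI[of _ "\<lambda>q. v (\<beta> 0 q)"]) (simp add: vc_def g'_def)
    fix i and v :: "nat \<Rightarrow> 'a" assume v: "vc v" "cyc I (\<lambda>i. {..<b i}) d' g' i v"
    then have "\<exists>w. vc w \<and> eqm I (X i) (\<lambda>x. v (\<gamma> i x)) (mv (X (Suc i)) (d i) w)"
      using F vc'[OF v(1)] unfolding cyc' by (simp add: res_def)
    then obtain w where w: "vc w" "eqm I (X i) (\<lambda>x. v (\<gamma> i x)) (mv (X (Suc i)) (d i) w)" by blast
    have "mv {..<b (Suc i)} (d' i) (\<lambda>q. w (\<beta> (Suc i) q)) p = mv (X (Suc i)) (d i) w (\<beta> i p)" for p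
    proof -
      have "mv (X (Suc i)) (d i) w (\<beta> i p) = (\<Sum>q<b (Suc i). d i (\<beta> i p) (\<beta> (Suc i) q) * w (\<beta> (Suc i) q))"
        unfolding mv_def by (rule sum.reindex_bij_betw[OF \<beta>, symmetric])
      then show ?thesis by (simp add: mv_def d'_def)
    qed
    then have "eqm I {..<b i} v (mv {..<b (Suc i)} (d' i) (\<lambda>q. w (\<beta> (Suc i) q)))"
      using w(2) unfolding eqm_def X_iff by (simp add: \<gamma>)
    moreover have "vc (\<lambda>q. w (\<beta> (Suc i) q))" using w(1) by (simp add: vc_def)
    ultimately show "\<exists>w. vc w \<and> eqm I {..<b i} v (mv {..<b (Suc i)} (d' i) w)" by blast
  qed
  then show ?thesis by (rule that)
qed

end

section \<open>Rings and module records described by representatives\<close>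

locale presented_ring = augmented_subring C cst ev
  for C :: "'a::comm_ring_1 set" and cst :: "'k::field \<Rightarrow> 'a" and ev :: "'a \<Rightarrow> 'k" +
  fixes A :: "('r, 'x) ring_scheme" and \<pi> :: "'a \<Rightarrow> 'r" and I :: "'a set"
  assumes idl_I: "idl I"
    and carrier_A: "carrier A = \<pi> ` C" and zero_A: "\<zero>\<^bsub>A\<^esub> = \<pi> 0"
    and \<pi>_add: "p \<in> C \<Longrightarrow> q \<in> C \<Longrightarrow> \<pi> p \<oplus>\<^bsub>A\<^esub> \<pi> q = \<pi> (p + q)"
    and \<pi>_mult: "p \<in> C \<Longrightarrow> q \<in> C \<Longrightarrow> \<pi> p \<otimes>\<^bsub>A\<^esub> \<pi> q = \<pi> (p * q)"
    and \<pi>_eq: "p \<in> C \<Longrightarrow> q \<in> C \<Longrightarrow> \<pi> p = \<pi> q \<longleftrightarrow> p - q \<in> I"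
begin

text \<open>\<open>N\<close> is \<open>C/Q\<close> as a module over \<open>A = C/I\<close>, with
  \<open>\<rho>\<close> and \<open>\<pi>\<close> as quotient maps. The ambient ring, its quotient by
  the ideal and the residue field all have this form.\<close>

definition cyclic_module :: "('r, 'n) module \<Rightarrow> ('a \<Rightarrow> 'n) \<Rightarrow> 'a set \<Rightarrow> bool"
  where "cyclic_module N \<rho> Q \<longleftrightarrow> idl Q \<and> I \<subseteq> Q \<and> carrier N = \<rho> ` C \<and> \<zero>\<^bsub>N\<^esub> = \<rho> 0
    \<and> (\<forall>p\<in>C. \<forall>q\<in>C. \<rho> p \<oplus>\<^bsub>N\<^esub> \<rho> q = \<rho> (p + q)) \<and> (\<forall>p\<in>C. \<forall>q\<in>C. \<pi> p \<odot>\<^bsub>N\<^esub> \<rho> q = \<rho> (p * q))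
    \<and> (\<forall>p\<in>C. \<forall>q\<in>C. \<rho> p = \<rho> q \<longleftrightarrow> p - q \<in> Q)"

definition rvec :: "('a \<Rightarrow> 'n) \<Rightarrow> nat \<Rightarrow> (nat \<Rightarrow> 'a) \<Rightarrow> nat \<Rightarrow> 'n"
  where "rvec \<rho> b v = (\<lambda>j\<in>{..<b}. \<rho> (v j))"

lemma cyclic_self: "cyclic_module (ring_module (\<lambda>r. r) A) \<pi> I"
  using idl_I by (simp add: cyclic_module_def ring_module_def carrier_A zero_A \<pi>_add \<pi>_mult \<pi>_eq)

lemma cyclicD:
  assumes "cyclic_module N \<rho> Q"
  shows "idl Q" "I \<subseteq> Q" "carrier N = \<rho> ` C" "\<zero>\<^bsub>N\<^esub> = \<rho> 0" "p \<in> C \<Longrightarrow> q \<in> C \<Longrightarrow> \<rho> p \<oplus>\<^bsub>N\<^esub> \<rho> q = \<rho> (p + q)"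
    "p \<in> C \<Longrightarrow> q \<in> C \<Longrightarrow> \<pi> p \<odot>\<^bsub>N\<^esub> \<rho> q = \<rho> (p * q)" "p \<in> C \<Longrightarrow> q \<in> C \<Longrightarrow> \<rho> p = \<rho> q \<longleftrightarrow> p - q \<in> Q"
  using assms by (simp_all add: cyclic_module_def)

lemma cyclic_abelian_group: "cyclic_module N \<rho> Q \<Longrightarrow> abelian_group N"
proof (rule abelian_groupI)
  assume N: "cyclic_module N \<rho> Q"
  note D = cyclicD[OF N]
  fix x assume "x \<in> carrier N"
  then obtain p where p: "p \<in> C" "x = \<rho> p" using D(3) by auto
  then show "\<exists>y\<in>carrier N. y \<oplus>\<^bsub>N\<^esub> x = \<zero>\<^bsub>N\<^esub>"
    by (intro bexI[of _ "\<rho> (- p)"]) (simp_all add: D(3-5) uminus_C)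
  show "\<zero>\<^bsub>N\<^esub> \<oplus>\<^bsub>N\<^esub> x = x" using p by (simp add: D(3-5) zero_C)
next
  assume N: "cyclic_module N \<rho> Q"
  note D = cyclicD[OF N]
  fix x y assume "x \<in> carrier N" "y \<in> carrier N"
  then obtain p q where p: "p \<in> C" "x = \<rho> p" "q \<in> C" "y = \<rho> q" using D(3) by auto
  then show "x \<oplus>\<^bsub>N\<^esub> y \<in> carrier N" "x \<oplus>\<^bsub>N\<^esub> y = y \<oplus>\<^bsub>N\<^esub> x" by (simp_all add: D(3-5) add_C add.commute)
  fix z assume "z \<in> carrier N"
  then obtain r where "r \<in> C" "z = \<rho> r" using D(3) by auto
  with p show "x \<oplus>\<^bsub>N\<^esub> y \<oplus>\<^bsub>N\<^esub> z = x \<oplus>\<^bsub>N\<^esub> (y \<oplus>\<^bsub>N\<^esub> z)" by (simp add: D(3-5) add_C add.assoc)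
qed (auto simp: cyclicD zero_C)

lemma cyclic_finsum:
  assumes N: "cyclic_module N \<rho> Q" and f: "\<And>j. j < (m :: nat) \<Longrightarrow> f j \<in> C"
  shows "(\<Oplus>\<^bsub>N\<^esub>j\<in>{..<m}. \<rho> (f j)) = \<rho> (\<Sum>j<m. f j)"
  using f
proof (induction m)
  case 0
  interpret abelian_group N by (rule cyclic_abelian_group[OF N])
  show ?case using cyclicD(4)[OF N] by simp
next
  case (Suc m)
  interpret abelian_group N by (rule cyclic_abelian_group[OF N])
  have "(\<Oplus>\<^bsub>N\<^esub>j\<in>{..<Suc m}. \<rho> (f j)) = \<rho> (f m) \<oplus>\<^bsub>N\<^esub> (\<Oplus>\<^bsub>N\<^esub>j\<in>{..<m}. \<rho> (f j))"
    unfolding lessThan_Suc using Suc.prems cyclicD(3)[OF N] by (intro finsum_insert) auto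
  moreover have "(\<Sum>j<m. f j) \<in> C" using Suc.prems by (intro sum_C) simp
  ultimately show ?case using Suc.prems[of m] Suc.IH Suc.prems cyclicD(5)[OF N] by (simp add: add.commute)
qed

lemma carrier_power_module:
  assumes N: "cyclic_module N \<rho> Q"
  shows "carrier (power_module N b) = rvec \<rho> b ` {v. vc v}"
proof (intro equalityI subsetI)
  fix u assume u: "u \<in> carrier (power_module N b)"
  then have "\<forall>j. \<exists>p\<in>C. j < b \<longrightarrow> u j = \<rho> p"
    using cyclicD(3)[OF N] zero_C by (fastforce simp: power_module_def PiE_iff)
  then obtain v where "\<forall>j. v j \<in> C \<and> (j < b \<longrightarrow> u j = \<rho> (v j))" by metis
  moreover have "u j = undefined" if "\<not> j < b" for j using u that by (auto simp: power_module_def PiE_iff extensional_def)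
  ultimately have "u = rvec \<rho> b v" "vc v" by (auto simp: rvec_def vc_def fun_eq_iff restrict_def)
  then show "u \<in> rvec \<rho> b ` {v. vc v}" by blast
qed (use cyclicD(3)[OF N] in \<open>auto simp: rvec_def power_module_def vc_def split: if_splits\<close>)

lemma rvec_eq:
  assumes N: "cyclic_module N \<rho> Q" and "vc u" "vc v"
  shows "rvec \<rho> b u = rvec \<rho> b v \<longleftrightarrow> eqm Q {..<b} u v"
  using assms cyclicD(7)[OF N] by (auto simp: rvec_def eqm_def vc_def fun_eq_iff restrict_def)

lemma mat_map_vec:
  assumes N: "cyclic_module N \<rho> Q" and d: "mc d'" "\<forall>i<p. \<forall>j<q. d i j = \<pi> (d' i j)" and v: "vc v"
  shows "mat_map N p q d (rvec \<rho> q v) = rvec \<rho> p (mv {..<q} d' v)"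
proof -
  interpret abelian_group N by (rule cyclic_abelian_group[OF N])
  have "(\<Oplus>\<^bsub>N\<^esub>j\<in>{..<q}. d i j \<odot>\<^bsub>N\<^esub> rvec \<rho> q v j) = \<rho> (mv {..<q} d' v i)" if i: "i < p" for i
  proof -
    have "(\<Oplus>\<^bsub>N\<^esub>j\<in>{..<q}. d i j \<odot>\<^bsub>N\<^esub> rvec \<rho> q v j) = (\<Oplus>\<^bsub>N\<^esub>j\<in>{..<q}. \<rho> (d' i j * v j))"
      using d v i cyclicD(3,6)[OF N] by (intro finsum_cong') (auto simp: rvec_def mc_def vc_def mult_C)
    also have "\<dots> = \<rho> (\<Sum>j<q. d' i j * v j)"
      using d(1) v by (intro cyclic_finsum[OF N]) (auto simp: mc_def vc_def mult_C)
    finally show ?thesis by (simp add: mv_def)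
  qed
  then show ?thesis by (auto simp: mat_map_def rvec_def fun_eq_iff restrict_def)
qed

lemma zero_power_module: "cyclic_module N \<rho> Q \<Longrightarrow> \<zero>\<^bsub>power_module N b\<^esub> = rvec \<rho> b (\<lambda>_. 0)"
  by (simp add: power_module_def rvec_def cyclicD)

lemma mat_image_vec:
  assumes "cyclic_module N \<rho> Q" "mc d'" "\<forall>i<p. \<forall>j<q. d i j = \<pi> (d' i j)"
  shows "mat_image N p q d = rvec \<rho> p ` mv {..<q} d' ` {v. vc v}"
  unfolding mat_image_def carrier_power_module[OF assms(1)]
  using mat_map_vec[OF assms] by (force simp: image_iff)

lemma mat_kernel_vec:
  assumes "cyclic_module N \<rho> Q" "mc d'" "\<forall>i<p. \<forall>j<q. d i j = \<pi> (d' i j)"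
  shows "mat_kernel N p q d = rvec \<rho> q ` {v. vc v \<and> (\<forall>i<p. mv {..<q} d' v i \<in> Q)}"
proof -
  have "mat_map N p q d (rvec \<rho> q v) = \<zero>\<^bsub>power_module N p\<^esub> \<longleftrightarrow> (\<forall>i<p. mv {..<q} d' v i \<in> Q)" if "vc v" for v
  proof -
    have "mat_map N p q d (rvec \<rho> q v) = \<zero>\<^bsub>power_module N p\<^esub> \<longleftrightarrow> eqm Q {..<p} (mv {..<q} d' v) (\<lambda>_. 0)"
      unfolding mat_map_vec[OF assms that] zero_power_module[OF assms(1)]
      using that assms(2) by (intro rvec_eq[OF assms(1)] vc_mv) (auto simp: vc_def zero_C)
    then show ?thesis by (simp add: eqm_def Ball_def)
  qed
  then show ?thesis unfolding mat_kernel_def carrier_power_module[OF assms(1)] by blast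
qed

text \<open>Equality of an image and a kernel, as sets of coset vectors, unfolds into inclusion and
  lifting of representatives because the kernel condition \<open>P\<close> respects
  congruence.\<close>

lemma image_kernel_iff:
  assumes N: "cyclic_module N \<rho> Q" and F: "\<And>w. vc w \<Longrightarrow> vc (F w)"
    and P: "\<And>u v. vc u \<Longrightarrow> vc v \<Longrightarrow> eqm Q {..<b} u v \<Longrightarrow> P u \<longleftrightarrow> P v"
  shows "rvec \<rho> b ` F ` {w. vc w} = rvec \<rho> b ` {v. vc v \<and> P v}
    \<longleftrightarrow> (\<forall>w. vc w \<longrightarrow> P (F w)) \<and> (\<forall>v. vc v \<longrightarrow> P v \<longrightarrow> (\<exists>w. vc w \<and> eqm Q {..<b} v (F w)))"
proof (intro iffI conjI allI impI)
  assume eq: "rvec \<rho> b ` F ` {w. vc w} = rvec \<rho> b ` {v. vc v \<and> P v}"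
  show "P (F w)" if "vc w" for w
  proof -
    have "rvec \<rho> b (F w) \<in> rvec \<rho> b ` {v. vc v \<and> P v}" using that eq by blast
    then obtain v where "vc v" "P v" "rvec \<rho> b (F w) = rvec \<rho> b v" by blast
    then show ?thesis using rvec_eq[OF N F[OF that], of v b] P[OF F[OF that]] by blast
  qed
  show "\<exists>w. vc w \<and> eqm Q {..<b} v (F w)" if "vc v" "P v" for v
  proof -
    have "rvec \<rho> b v \<in> rvec \<rho> b ` F ` {w. vc w}" using that eq by blast
    then obtain w where "vc w" "rvec \<rho> b v = rvec \<rho> b (F w)" by blast
    then show ?thesis using rvec_eq[OF N that(1) F] by blast
  qed
next
  assume *: "(\<forall>w. vc w \<longrightarrow> P (F w)) \<and> (\<forall>v. vc v \<longrightarrow> P v \<longrightarrow> (\<exists>w. vc w \<and> eqm Q {..<b} v (F w)))"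
  show "rvec \<rho> b ` F ` {w. vc w} = rvec \<rho> b ` {v. vc v \<and> P v}"
  proof (intro equalityI subsetI)
    fix x assume "x \<in> rvec \<rho> b ` {v. vc v \<and> P v}"
    then obtain v where v: "vc v" "P v" "x = rvec \<rho> b v" by blast
    then obtain w where w: "vc w" "eqm Q {..<b} v (F w)" using * by blast
    then have "x = rvec \<rho> b (F w)" using rvec_eq[OF N v(1) F[OF w(1)]] v(3) by blast
    then show "x \<in> rvec \<rho> b ` F ` {w. vc w}" using w(1) by blast
  next
    fix x assume "x \<in> rvec \<rho> b ` F ` {w. vc w}"
    then obtain w where "vc w" "x = rvec \<rho> b (F w)" by blast
    then show "x \<in> rvec \<rho> b ` {v. vc v \<and> P v}" using * F by blast
  qed
qed

text \<open>The target of the augmentation is the field with \<open>ev\<close> as quotient map, so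
  \<open>aug\<close> becomes a sum in the field. \<open>free_resolution\<close> treats degree 0
  separately while \<open>res\<close> does not, hence the split of the quantifier over
  degrees.\<close>

lemma free_resolution_iff:
  fixes M :: "('r, 'k) module"
  assumes M: "cyclic_module M ev {a \<in> C. ev a = 0}" "carrier M = UNIV" "add M = (+)" "\<And>p c. p \<in> C \<Longrightarrow> \<pi> p \<odot>\<^bsub>M\<^esub> c = ev p * c"
    and d: "\<And>i. mc (d' i)" "\<And>i p q. p < b i \<Longrightarrow> q < b (Suc i) \<Longrightarrow> d i p q = \<pi> (d' i p q)"
  shows "free_resolution A M (b, d, g) \<longleftrightarrow> res I (\<lambda>i. {..<b i}) d' g"
proof -
  let ?F = "ring_module (\<lambda>r. r) A"
  let ?aug = "\<lambda>v. \<Oplus>\<^bsub>M\<^esub>j\<in>{..<b 0}. v j \<odot>\<^bsub>M\<^esub> g j"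
  let ?X = "\<lambda>i. {..<b i}"
  note F = cyclic_self
  have mat: "\<forall>p<b i. \<forall>q<b (Suc i). d i p q = \<pi> (d' i p q)" for i using d(2) by blast
  have dC: "\<forall>i. \<forall>p<b i. \<forall>q<b (Suc i). d i p q \<in> carrier A" using d by (auto simp: carrier_A mc_def)
  have aug: "?aug (rvec \<pi> (b 0) v) = (\<Sum>j<b 0. ev (v j) * g j)" if v: "vc v" for v
  proof -
    interpret abelian_group M by (rule cyclic_abelian_group[OF M(1)])
    have vC: "v j \<in> C" for j using v by (simp add: vc_def)
    have "?aug (rvec \<pi> (b 0) v) = (\<Oplus>\<^bsub>M\<^esub>j\<in>{..<b 0}. ev (v j * cst (g j)))"
      by (intro finsum_cong') (simp_all add: rvec_def M(2,4) vC ev_mult cst_C ev_cst)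
    also have "\<dots> = ev (\<Sum>j<b 0. v j * cst (g j))"
      using vC by (intro cyclic_finsum[OF M(1)]) (simp add: C_intros)
    finally show ?thesis using vC by (simp add: ev_sum ev_mult C_intros ev_cst)
  qed
  have zM: "\<zero>\<^bsub>M\<^esub> = 0" using cyclicD(4)[OF M(1)] by (simp add: ev_zero)
  have surj: "?aug ` carrier (power_module ?F (b 0)) = carrier M \<longleftrightarrow> (\<exists>v. vc v \<and> (\<Sum>j<b 0. ev (v j) * g j) = 1)"
  proof
    assume "?aug ` carrier (power_module ?F (b 0)) = carrier M"
    then have "1 \<in> ?aug ` carrier (power_module ?F (b 0))" by (simp add: M(2))
    then obtain v where "vc v" "1 = ?aug (rvec \<pi> (b 0) v)" unfolding carrier_power_module[OF F] by blast
    then show "\<exists>v. vc v \<and> (\<Sum>j<b 0. ev (v j) * g j) = 1" using aug by metis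
  next
    assume "\<exists>v. vc v \<and> (\<Sum>j<b 0. ev (v j) * g j) = 1"
    then obtain v where v: "vc v" "(\<Sum>j<b 0. ev (v j) * g j) = 1" by blast
    have "c \<in> ?aug ` carrier (power_module ?F (b 0))" for c
    proof -
      have vC: "v j \<in> C" for j using v by (simp add: vc_def)
      have cv: "vc (\<lambda>j. cst c * v j)" using v by (simp add: vc_def C_intros)
      have "(\<Sum>j<b 0. ev (cst c * v j) * g j) = c * (\<Sum>j<b 0. ev (v j) * g j)"
        by (simp add: ev_mult cst_C vC ev_cst sum_distrib_left mult.assoc)
      then have "c = ?aug (rvec \<pi> (b 0) (\<lambda>j. cst c * v j))" using aug[OF cv] v(2) by simp
      then show ?thesis unfolding carrier_power_module[OF F] using cv by blast
    qed
    then show "?aug ` carrier (power_module ?F (b 0)) = carrier M" by (auto simp: M(2))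
  qed
  have cyc_resp: "cyc I ?X d' g i u \<longleftrightarrow> cyc I ?X d' g i v" if "vc u" "vc v" "eqm I {..<b i} u v" for i u v
    using cyc_cong[where d = d' and g = g and X = ?X and i = i, OF idl_I that(3) d(1) that(1,2)] .
  have ex0: "mat_image ?F (b 0) (b 1) (d 0) = {v \<in> carrier (power_module ?F (b 0)). ?aug v = \<zero>\<^bsub>M\<^esub>} \<longleftrightarrow>
      (\<forall>w. vc w \<longrightarrow> cyc I ?X d' g 0 (mv {..<b (Suc 0)} (d' 0) w)) \<and>
      (\<forall>v. vc v \<longrightarrow> cyc I ?X d' g 0 v \<longrightarrow> (\<exists>w. vc w \<and> eqm I {..<b 0} v (mv {..<b (Suc 0)} (d' 0) w)))"
  proof -
    have k: "{v \<in> carrier (power_module ?F (b 0)). ?aug v = \<zero>\<^bsub>M\<^esub>} = rvec \<pi> (b 0) ` {v. vc v \<and> cyc I ?X d' g 0 v}"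
      unfolding carrier_power_module[OF F] using aug by (auto simp: cyc_def zM)
    show ?thesis
      unfolding k One_nat_def mat_image_vec[OF F d(1) mat, of 0]
      by (rule image_kernel_iff[OF F vc_mv[OF d(1)] cyc_resp])
  qed
  have exS: "mat_image ?F (b (Suc i)) (b (Suc (Suc i))) (d (Suc i)) = mat_kernel ?F (b i) (b (Suc i)) (d i) \<longleftrightarrow>
      (\<forall>w. vc w \<longrightarrow> cyc I ?X d' g (Suc i) (mv {..<b (Suc (Suc i))} (d' (Suc i)) w)) \<and>
      (\<forall>v. vc v \<longrightarrow> cyc I ?X d' g (Suc i) v \<longrightarrow> (\<exists>w. vc w \<and> eqm I {..<b (Suc i)} v (mv {..<b (Suc (Suc i))} (d' (Suc i)) w)))" for i
  proof -
    have k: "mat_kernel ?F (b i) (b (Suc i)) (d i) = rvec \<pi> (b (Suc i)) ` {v. vc v \<and> cyc I ?X d' g (Suc i) v}"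
      unfolding mat_kernel_vec[OF F d(1) mat, of i] by (simp add: cyc_def Ball_def)
    show ?thesis
      unfolding k mat_image_vec[OF F d(1) mat, of "Suc i"]
      by (rule image_kernel_iff[OF F vc_mv[OF d(1)] cyc_resp])
  qed
  have gM: "\<forall>j<b 0. g j \<in> carrier M" by (simp add: M(2))
  have alln: "(\<forall>i. P i) \<longleftrightarrow> P 0 \<and> (\<forall>i. P (Suc i))" for P :: "nat \<Rightarrow> bool"
    by (metis not0_implies_Suc)
  have "res I ?X d' g \<longleftrightarrow> (\<exists>v. vc v \<and> (\<Sum>j<b 0. ev (v j) * g j) = 1) \<and> (\<forall>i. (\<forall>w. vc w \<longrightarrow> cyc I ?X d' g i (mv {..<b (Suc i)} (d' i) w)) \<and>
      (\<forall>v. vc v \<longrightarrow> cyc I ?X d' g i v \<longrightarrow> (\<exists>w. vc w \<and> eqm I {..<b i} v (mv {..<b (Suc i)} (d' i) w))))"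
    unfolding res_def cplx_def using d(1) by auto
  also have "\<dots> \<longleftrightarrow> free_resolution A M (b, d, g)"
    unfolding free_resolution_def Let_def case_prod_conv surj ex0 exS using dC gM
    by (subst alln) simp
  finally show ?thesis by simp
qed

lemma dim_homology:
  assumes N: "cyclic_module N \<rho> Q" and d: "\<And>i. mc (d' i)" "\<And>i p q. p < b i \<Longrightarrow> q < b (Suc i) \<Longrightarrow> d i p q = \<pi> (d' i p q)"
    and z: "hbasis Q (\<lambda>i. {..<b i}) d' i V z"
    and Z: "Z = (case i of 0 \<Rightarrow> carrier (power_module N (b 0)) | Suc j \<Rightarrow> mat_kernel N (b j) (b (Suc j)) (d j))"
    and B: "B = mat_image N (b i) (b (Suc i)) (d i)"
  shows "vectorspace.dim (class_ring :: 'k ring)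
    (restrict_scalars (\<lambda>c. \<pi> (cst c)) (quot_module ((power_module N (b i))\<lparr>carrier := Z\<rparr>) B)) = card V"
proof -
  let ?X = "\<lambda>i. {..<b i}"
  let ?P = "(power_module N (b i))\<lparr>carrier := Z\<rparr>"
  let ?d = "mv {..<b (Suc i)} (d' i)"
  let ?S = "{v. vc v \<and> hcyc Q ?X d' i v}"
  \<comment> \<open>The coset of \<open>u\<close> modulo boundaries, kept as a set so that it
    coincides with an element of \<open>quot_module\<close>.\<close>
  define \<tau> where "\<tau> u = rvec \<rho> (b i) ` {x. \<exists>w. vc w \<and> x = (\<lambda>j. ?d w j + u j)}" for u
  note Q = cyclicD(1)[OF N]
  have mat: "\<forall>p<b i. \<forall>q<b (Suc i). d i p q = \<pi> (d' i p q)" for i using d(2) by blast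
  have Z': "Z = rvec \<rho> (b i) ` ?S"
    unfolding Z by (cases i) (simp_all add: hcyc_def carrier_power_module[OF N] mat_kernel_vec[OF N d(1) mat] Ball_def)
  have vadd: "rvec \<rho> m u \<oplus>\<^bsub>power_module N m\<^esub> rvec \<rho> m v = rvec \<rho> m (\<lambda>j. u j + v j)" if "vc u" "vc v" for m u v
    using that cyclicD(5)[OF N] by (auto simp: power_module_def rvec_def vc_def fun_eq_iff restrict_def)
  have vsm: "\<pi> (cst c) \<odot>\<^bsub>power_module N m\<^esub> rvec \<rho> m u = rvec \<rho> m (\<lambda>j. cst c * u j)" if "vc u" for m u c
    using that cyclicD(6)[OF N] cst_C by (auto simp: power_module_def rvec_def vc_def fun_eq_iff restrict_def)
  have B': "B = rvec \<rho> (b i) ` ?d ` {w. vc w}" unfolding B by (rule mat_image_vec[OF N d(1) mat])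
  have dC: "vc (?d w)" if "vc w" for w using that by (intro vc_mv d)
  have cos: "B +>\<^bsub>?P\<^esub> rvec \<rho> (b i) u = \<tau> u" if u: "vc u" for u
  proof -
    have "B +>\<^bsub>?P\<^esub> rvec \<rho> (b i) u = (\<Union>h\<in>B. {h \<oplus>\<^bsub>power_module N (b i)\<^esub> rvec \<rho> (b i) u})"
      by (simp add: a_r_coset_def')
    also have "\<dots> = (\<Union>w\<in>{w. vc w}. {rvec \<rho> (b i) (\<lambda>j. ?d w j + u j)})"
      unfolding B' using vadd[OF dC u] by simp
    finally show ?thesis by (auto simp: \<tau>_def)
  qed
  let ?W = "restrict_scalars (\<lambda>c. \<pi> (cst c)) (quot_module ?P B)"
  have dz: "?d (\<lambda>_. 0) = (\<lambda>_. 0)" by (simp add: mv_def)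
  have \<tau>_add: "set_add ?P (\<tau> u) (\<tau> v) = \<tau> (\<lambda>j. u j + v j)" if uv: "vc u" "vc v" for u v
  proof -
    have "set_add ?P (\<tau> u) (\<tau> v) = {x \<oplus>\<^bsub>power_module N (b i)\<^esub> y |x y. x \<in> \<tau> u \<and> y \<in> \<tau> v}"
      by (auto simp: set_add_def')
    also have "\<dots> = {rvec \<rho> (b i) (\<lambda>j. (?d w j + u j) + (?d w' j + v j)) |w w'. vc w \<and> vc w'}"
    proof (intro equalityI subsetI)
      fix x assume "x \<in> {x \<oplus>\<^bsub>power_module N (b i)\<^esub> y |x y. x \<in> \<tau> u \<and> y \<in> \<tau> v}"
      then obtain w w' where w: "vc w" "vc w'" "x = rvec \<rho> (b i) (\<lambda>j. ?d w j + u j) \<oplus>\<^bsub>power_module N (b i)\<^esub> rvec \<rho> (b i) (\<lambda>j. ?d w' j + v j)"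
        unfolding \<tau>_def by blast
      have "x = rvec \<rho> (b i) (\<lambda>j. (?d w j + u j) + (?d w' j + v j))"
        unfolding w(3) by (rule vadd[OF vc_add[OF dC[OF w(1)] uv(1)] vc_add[OF dC[OF w(2)] uv(2)]])
      then show "x \<in> {rvec \<rho> (b i) (\<lambda>j. (?d w j + u j) + (?d w' j + v j)) |w w'. vc w \<and> vc w'}" using w(1,2) by blast
    next
      fix x assume "x \<in> {rvec \<rho> (b i) (\<lambda>j. (?d w j + u j) + (?d w' j + v j)) |w w'. vc w \<and> vc w'}"
      then obtain w w' where w: "vc w" "vc w'" "x = rvec \<rho> (b i) (\<lambda>j. (?d w j + u j) + (?d w' j + v j))" by blast
      have "x = rvec \<rho> (b i) (\<lambda>j. ?d w j + u j) \<oplus>\<^bsub>power_module N (b i)\<^esub> rvec \<rho> (b i) (\<lambda>j. ?d w' j + v j)"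
        unfolding w(3) by (rule vadd[OF vc_add[OF dC[OF w(1)] uv(1)] vc_add[OF dC[OF w(2)] uv(2)], symmetric])
      then show "x \<in> {x \<oplus>\<^bsub>power_module N (b i)\<^esub> y |x y. x \<in> \<tau> u \<and> y \<in> \<tau> v}"
        unfolding \<tau>_def using w(1,2) by blast
    qed
    also have "\<dots> = \<tau> (\<lambda>j. u j + v j)"
    proof (intro equalityI subsetI)
      fix x assume "x \<in> {rvec \<rho> (b i) (\<lambda>j. (?d w j + u j) + (?d w' j + v j)) |w w'. vc w \<and> vc w'}"
      then obtain w w' where w: "vc w" "vc w'" "x = rvec \<rho> (b i) (\<lambda>j. (?d w j + u j) + (?d w' j + v j))" by blast
      then have "x = rvec \<rho> (b i) (\<lambda>j. ?d (\<lambda>j. w j + w' j) j + (u j + v j))" by (simp add: mv_add algebra_simps)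
      then show "x \<in> \<tau> (\<lambda>j. u j + v j)" unfolding \<tau>_def using vc_add[OF w(1,2)] by blast
    next
      fix x assume "x \<in> \<tau> (\<lambda>j. u j + v j)"
      then obtain w where w: "vc w" "x = rvec \<rho> (b i) (\<lambda>j. ?d w j + (u j + v j))" unfolding \<tau>_def by blast
      then have "x = rvec \<rho> (b i) (\<lambda>j. (?d w j + u j) + (?d (\<lambda>_. 0) j + v j))" by (simp add: dz algebra_simps)
      moreover have "vc (\<lambda>_. 0 :: 'a)" by (simp add: vc_def zero_C)
      ultimately show "x \<in> {rvec \<rho> (b i) (\<lambda>j. (?d w j + u j) + (?d w' j + v j)) |w w'. vc w \<and> vc w'}" using w(1) by blast
    qed
    finally show ?thesis .
  qed
  \<comment> \<open>\<open>quot_module\<close> scales a coset by a union over its members;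
    boundaries are stable under scalars, so all members give the same coset.\<close>
  have \<tau>_smult: "(\<Union>x\<in>\<tau> u. B +>\<^bsub>?P\<^esub> (\<pi> (cst c) \<odot>\<^bsub>?P\<^esub> x)) = \<tau> (\<lambda>j. cst c * u j)" if u: "vc u" for u c
  proof -
    have "B +>\<^bsub>?P\<^esub> (\<pi> (cst c) \<odot>\<^bsub>?P\<^esub> rvec \<rho> (b i) (\<lambda>j. ?d w j + u j)) = \<tau> (\<lambda>j. cst c * (?d w j + u j))" if w: "vc w" for w
    proof -
      have "\<pi> (cst c) \<odot>\<^bsub>?P\<^esub> rvec \<rho> (b i) (\<lambda>j. ?d w j + u j) = rvec \<rho> (b i) (\<lambda>j. cst c * (?d w j + u j))"
        using vsm[OF vc_add[OF dC[OF w] u]] by simp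
      then show ?thesis using vc_add[OF dC[OF w] u] by (simp only:) (rule cos, simp add: vc_def C_intros)
    qed
    then have "(\<Union>x\<in>\<tau> u. B +>\<^bsub>?P\<^esub> (\<pi> (cst c) \<odot>\<^bsub>?P\<^esub> x)) = (\<Union>w\<in>{w. vc w}. \<tau> (\<lambda>j. cst c * (?d w j + u j)))"
      unfolding \<tau>_def[of u] by blast
    also have "\<dots> = \<tau> (\<lambda>j. cst c * u j)"
    proof (intro equalityI subsetI)
      fix x assume "x \<in> (\<Union>w\<in>{w. vc w}. \<tau> (\<lambda>j. cst c * (?d w j + u j)))"
      then obtain w w' where w: "vc w" "vc w'" "x = rvec \<rho> (b i) (\<lambda>j. ?d w' j + cst c * (?d w j + u j))" unfolding \<tau>_def by blast
      have "?d (\<lambda>j. w' j + cst c * w j) = (\<lambda>j. ?d w' j + cst c * ?d w j)"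
        by (rule ext) (simp add: mv_def sum.distrib sum_distrib_left algebra_simps)
      then have "x = rvec \<rho> (b i) (\<lambda>j. ?d (\<lambda>j. w' j + cst c * w j) j + cst c * u j)"
        using w(3) by (simp add: algebra_simps)
      moreover have "vc (\<lambda>j. w' j + cst c * w j)" using w by (simp add: vc_def C_intros)
      ultimately show "x \<in> \<tau> (\<lambda>j. cst c * u j)" unfolding \<tau>_def by blast
    next
      fix x assume x: "x \<in> \<tau> (\<lambda>j. cst c * u j)"
      have "\<tau> (\<lambda>j. cst c * u j) = \<tau> (\<lambda>j. cst c * (?d (\<lambda>_. 0) j + u j))" by (simp add: dz)
      moreover have "vc (\<lambda>_ :: nat. 0 :: 'a)" by (simp add: vc_def zero_C)
      ultimately show "x \<in> (\<Union>w\<in>{w. vc w}. \<tau> (\<lambda>j. cst c * (?d w j + u j)))" using x by blast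
    qed
    finally show ?thesis .
  qed
  \<comment> \<open>This turns equality of cosets into the relation in which \<open>hbasis\<close>
    is phrased: congruence modulo \<open>Q\<close> up to a boundary.\<close>
  have \<tau>_eq: "\<tau> u = \<tau> v \<longleftrightarrow> (\<exists>w. vc w \<and> eqm Q {..<b i} u (\<lambda>j. v j + ?d w j))" if uv: "vc u" "vc v" for u v
  proof
    assume "\<tau> u = \<tau> v"
    moreover have "rvec \<rho> (b i) (\<lambda>j. ?d (\<lambda>_. 0) j + u j) \<in> \<tau> u" unfolding \<tau>_def by (auto simp: vc_def zero_C intro!: exI[of _ "\<lambda>_. 0"])
    ultimately have "rvec \<rho> (b i) u \<in> \<tau> v" by (simp add: dz)
    then obtain w where w: "vc w" "rvec \<rho> (b i) u = rvec \<rho> (b i) (\<lambda>j. ?d w j + v j)" unfolding \<tau>_def by blast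
    then have "eqm Q {..<b i} u (\<lambda>j. ?d w j + v j)" using rvec_eq[OF N uv(1) vc_add[OF dC uv(2)]] by blast
    then show "\<exists>w. vc w \<and> eqm Q {..<b i} u (\<lambda>j. v j + ?d w j)" using w(1) by (auto simp: add.commute)
  next
    have sub: "\<tau> u \<subseteq> \<tau> v" if uv: "vc u" "vc v" and w: "vc w" "eqm Q {..<b i} u (\<lambda>j. v j + ?d w j)" for u v w
    proof
      fix x assume "x \<in> \<tau> u"
      then obtain w' where w': "vc w'" "x = rvec \<rho> (b i) (\<lambda>j. ?d w' j + u j)" unfolding \<tau>_def by blast
      have "eqm Q {..<b i} (\<lambda>j. ?d w' j + u j) (\<lambda>j. ?d (\<lambda>j. w' j + w j) j + v j)"
        using w(2) by (simp add: eqm_def mv_add algebra_simps)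
      moreover have "vc (\<lambda>j. w' j + w j)" using vc_add[OF w'(1) w(1)] .
      ultimately have "x = rvec \<rho> (b i) (\<lambda>j. ?d (\<lambda>j. w' j + w j) j + v j)"
        unfolding w'(2) using rvec_eq[OF N vc_add[OF dC uv(1)] vc_add[OF dC uv(2)]] w'(1) by blast
      then show "x \<in> \<tau> v" unfolding \<tau>_def using vc_add[OF w'(1) w(1)] by blast
    qed
    assume "\<exists>w. vc w \<and> eqm Q {..<b i} u (\<lambda>j. v j + ?d w j)"
    then obtain w where w: "vc w" "eqm Q {..<b i} u (\<lambda>j. v j + ?d w j)" by blast
    have "eqm Q {..<b i} (\<lambda>j. u j - ?d w j) v"
      using w(2) by (simp add: eqm_def algebra_simps)
    then have "eqm Q {..<b i} v (\<lambda>j. u j + ?d (\<lambda>j. - w j) j)" using eqm_sym[OF Q] by (simp add: mv_minus)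
    then show "\<tau> u = \<tau> v" using sub[OF uv w] sub[OF uv(2,1) vc_minus[OF w(1)]] by blast
  qed
  have zs: "finite V" "\<And>k. k \<in> V \<Longrightarrow> vc (z k) \<and> hcyc Q ?X d' i (z k)"
    and span: "\<And>v. vc v \<Longrightarrow> hcyc Q ?X d' i v \<Longrightarrow> \<exists>c w. vc w \<and> eqm Q {..<b i} v (\<lambda>x. (\<Sum>k\<in>V. cst (c k) * z k x) + ?d w x)"
    and indep: "\<And>c w. vc w \<Longrightarrow> eqm Q {..<b i} (\<lambda>x. \<Sum>k\<in>V. cst (c k) * z k x) (?d w) \<Longrightarrow> \<forall>k\<in>V. c k = 0"
    using z unfolding hbasis_def by blast+
  have vz: "vc (\<lambda>_ :: nat. 0 :: 'a)" by (simp add: vc_def zero_C)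
  have vsum: "vc (\<lambda>x. \<Sum>k\<in>V. cst (c k) * z k x)" for c using zs(2) by (intro vc_cst_sum) blast
  show ?thesis
  proof (rule dim_quotient[of _ \<tau> ?S V z])
    show "carrier ?W = \<tau> ` ?S"
    proof -
      define cs where "cs a = B +>\<^bsub>?P\<^esub> a" for a
      have "carrier ?W = cs ` Z"
        by (auto simp: restrict_scalars_def quot_module_def A_RCOSETS_def RCOSETS_def a_r_coset_def cs_def)
      also have "cs ` Z = (\<lambda>u. cs (rvec \<rho> (b i) u)) ` ?S" unfolding Z' by (rule image_image)
      also have "\<dots> = \<tau> ` ?S" using cos by (intro image_cong) (simp_all add: cs_def)
      finally show ?thesis .
    qed
    show "zero ?W = \<tau> (\<lambda>_. 0)"
      by (auto simp: restrict_scalars_def quot_module_def B' \<tau>_def)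
    show "add ?W (\<tau> u) (\<tau> v) = \<tau> (\<lambda>x. u x + v x)" if "u \<in> ?S" "v \<in> ?S" for u v
      using that \<tau>_add by (simp add: restrict_scalars_def quot_module_def)
    show "smult ?W c (\<tau> u) = \<tau> (\<lambda>x. cst c * u x)" if "u \<in> ?S" for u c
      using that \<tau>_smult by (simp add: restrict_scalars_def quot_module_def)
    show "(\<lambda>_. 0) \<in> ?S" using vz by (auto simp: hcyc_def mv_def idlD(2)[OF Q] split: nat.splits)
    show "(\<lambda>x. u x + v x) \<in> ?S" if "u \<in> ?S" "v \<in> ?S" for u v
      using that by (auto simp: hcyc_def mv_add vc_add idlD(3)[OF Q] split: nat.splits)
    show "(\<lambda>x. cst c * u x) \<in> ?S" if u: "u \<in> ?S" for u c
    proof -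
      have "mv X E (\<lambda>x. cst c * u x) y = cst c * mv X E u y" for X E and y :: nat
        by (simp add: mv_def sum_distrib_left mult.left_commute)
      then show ?thesis using u by (auto simp: hcyc_def vc_def C_intros idlD(4)[OF Q] split: nat.splits)
    qed
    show "finite V" by (rule zs(1))
    show "z k \<in> ?S" if "k \<in> V" for k using zs(2)[OF that] by simp
    show "\<exists>c. \<tau> u = \<tau> (\<lambda>x. \<Sum>k\<in>V. cst (c k) * z k x)" if uS: "u \<in> ?S" for u
    proof -
      have u: "vc u" "hcyc Q ?X d' i u" using uS by simp_all
      obtain c w where "vc w" "eqm Q {..<b i} u (\<lambda>x. (\<Sum>k\<in>V. cst (c k) * z k x) + ?d w x)"
        using span[OF u] by blast
      then have "\<tau> u = \<tau> (\<lambda>x. \<Sum>k\<in>V. cst (c k) * z k x)" using \<tau>_eq[OF u(1) vsum] by blast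
      then show ?thesis by blast
    qed
    show "c k = 0" if \<tau>0: "\<tau> (\<lambda>x. \<Sum>k\<in>V. cst (c k) * z k x) = \<tau> (\<lambda>_. 0)" and k: "k \<in> V" for c k
    proof -
      obtain w where w: "vc w" "eqm Q {..<b i} (\<lambda>x. \<Sum>k\<in>V. cst (c k) * z k x) (\<lambda>j. 0 + ?d w j)"
        using \<tau>_eq[OF vsum vz] \<tau>0 by blast
      then show ?thesis using indep[OF w(1)] k by simp
    qed
  qed
qed

text \<open>The explicit resolution \<open>X\<close> shows that the choice in \<open>tor\<close>
  succeeds; the matrices so chosen are lifted to entries in \<open>C\<close>, and
  \<open>hbasis_transfer\<close> carries the known basis over to them.\<close>

theorem dim_tor:
  fixes M :: "('r, 'k) module" and X :: "nat \<Rightarrow> 'w set"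
  assumes M: "cyclic_module M ev {a \<in> C. ev a = 0}" "carrier M = UNIV" "add M = (+)" "\<And>p c. p \<in> C \<Longrightarrow> \<pi> p \<odot>\<^bsub>M\<^esub> c = ev p * c"
    and N: "cyclic_module N \<rho> Q" and F: "res I X e h" and z: "hbasis Q X e i V z"
  shows "vectorspace.dim (class_ring :: 'k ring) (restrict_scalars (\<lambda>c. \<pi> (cst c)) (tor A M N i)) = card V"
proof -
  note iff = free_resolution_iff[OF M]
  obtain b0 :: "nat \<Rightarrow> nat" and d0 g0 where r0: "res I (\<lambda>i. {..<b0 i}) d0 g0" by (rule res_reindex[OF idl_I F])
  then have "mc (d0 i)" for i by (simp add: res_def cplx_def)
  then have "free_resolution A M (b0, \<lambda>i p q. \<pi> (d0 i p q), g0)" using iff[of d0 b0 "\<lambda>i p q. \<pi> (d0 i p q)" g0] r0 by blast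
  then have chosen: "free_resolution A M (SOME F. free_resolution A M F)" by (rule someI)
  obtain b d g where S: "(SOME F. free_resolution A M F) = (b, d, g)" by (cases "SOME F. free_resolution A M F") auto
  have fr: "free_resolution A M (b, d, g)" using chosen unfolding S .
  have dA: "\<forall>i. \<forall>p<b i. \<forall>q<b (Suc i). d i p q \<in> carrier A"
    using fr unfolding free_resolution_def Let_def case_prod_conv by (rule conjunct1)
  have "\<exists>x\<in>C. p < b i \<longrightarrow> q < b (Suc i) \<longrightarrow> d i p q = \<pi> x" for i p q
  proof (cases "p < b i \<and> q < b (Suc i)")
    case True
    then have "d i p q \<in> \<pi> ` C" using dA carrier_A by simp
    then show ?thesis by blast
  qed (use zero_C in blast)
  then have "\<forall>i p q. \<exists>x\<in>C. p < b i \<longrightarrow> q < b (Suc i) \<longrightarrow> d i p q = \<pi> x" by blast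
  then obtain d' where d': "\<And>i p q. d' i p q \<in> C" "\<And>i p q. p < b i \<Longrightarrow> q < b (Suc i) \<Longrightarrow> d i p q = \<pi> (d' i p q)" by metis
  have mc: "mc (d' i)" for i using d'(1) by (simp add: mc_def)
  have "res I (\<lambda>i. {..<b i}) d' g" using iff[of d' b d g] mc d'(2) fr by simp
  from hbasis_transfer[OF idl_I cyclicD(1,2)[OF N] F this z] obtain z' where z': "hbasis Q (\<lambda>i. {..<b i}) d' i V z'" ..
  show ?thesis
    unfolding tor_def S Let_def case_prod_conv
    by (rule dim_homology[OF N mc d'(2) z' refl refl])
qed

end

section \<open>Power series and polynomials as a type\<close>

text \<open>The subsequence runs through points whose value is below all later ones; such points
  occur arbitrarily late because every tail attains its minimum.\<close>

lemma nondecreasing_subsequence: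
  fixes f :: "nat \<Rightarrow> nat"
  obtains r :: "nat \<Rightarrow> nat" where "strict_mono r" "\<And>a b. a \<le> b \<Longrightarrow> f (r a) \<le> f (r b)"
proof -
  let ?P = "\<lambda>x. \<forall>j\<ge>x. f x \<le> f j"
  have ex: "\<exists>y>x. ?P y" for x
  proof -
    obtain y where y: "y > x" "\<And>j. j > x \<Longrightarrow> f y \<le> f j"
      using ex_has_least_nat[of "\<lambda>j. j > x" "Suc x" f] by auto
    then have "?P y" by auto
    with y(1) show ?thesis by blast
  qed
  have "\<exists>r. \<forall>k. ?P (r k) \<and> r k < r (Suc k)"
    by (rule dependent_nat_choice) (use ex in blast)+
  then obtain r where r: "\<And>k. ?P (r k)" "\<And>k. r k < r (Suc k)" by blast
  have sm: "strict_mono r" using r(2) by (simp add: strict_mono_Suc_iff)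
  have "f (r a) \<le> f (r b)" if "a \<le> b" for a b
    using r(1)[of a] strict_mono_less_eq[OF sm, of a b] that by simp
  then show ?thesis by (rule that[OF sm])
qed

text \<open>The variables are treated one at a time, each thinning the subsequence further; earlier
  variables stay monotone under thinning.\<close>

lemma multiset_subsequence:
  fixes s :: "nat \<Rightarrow> nat multiset"
  shows "\<exists>r :: nat \<Rightarrow> nat. strict_mono r \<and> (\<forall>i\<in>{1..n :: nat}. \<forall>a b. a \<le> b \<longrightarrow> count (s (r a)) i \<le> count (s (r b)) i)"
proof (induction n)
  case 0
  show ?case by (intro exI[of _ id]) (simp add: strict_mono_def)
next
  case (Suc n)
  then obtain r :: "nat \<Rightarrow> nat" where r0: "strict_mono r \<and> (\<forall>i\<in>{1..n}. \<forall>a b. a \<le> b \<longrightarrow> count (s (r a)) i \<le> count (s (r b)) i)" ..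
  have r: "strict_mono r" "\<And>i a b. i \<in> {1..n} \<Longrightarrow> a \<le> b \<Longrightarrow> count (s (r a)) i \<le> count (s (r b)) i"
    using r0 by auto
  obtain r' :: "nat \<Rightarrow> nat" where r': "strict_mono r'" "\<And>a b. a \<le> b \<Longrightarrow> count (s (r (r' a))) (Suc n) \<le> count (s (r (r' b))) (Suc n)"
    using nondecreasing_subsequence[of "\<lambda>j. count (s (r j)) (Suc n)"] by blast
  have mono: "r' a \<le> r' b" if "a \<le> b" for a b using strict_mono_less_eq[OF r'(1), of a b] that by simp
  have "strict_mono (r \<circ> r')" using r(1) r'(1) by (rule strict_mono_o)
  moreover have "count (s ((r \<circ> r') a)) i \<le> count (s ((r \<circ> r') b)) i" if "i \<in> {1..Suc n}" "a \<le> b" for i a b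
    using that r'(2)[OF that(2)] r(2)[OF _ mono[OF that(2)], of i] by (cases "i = Suc n") auto
  ultimately show ?case by (intro exI[of _ "r \<circ> r'"] conjI ballI allI impI)
qed

text \<open>\<open>M\<close> consists of the minimal elements for divisibility; infinitely many of
  them would contain two comparable ones along a monotone subsequence.\<close>

lemma dickson:
  assumes L: "\<And>m. m \<in> L \<Longrightarrow> set_mset m \<subseteq> {1..n :: nat}"
  obtains M where "finite M" "M \<subseteq> L" "\<And>m. m \<in> L \<Longrightarrow> \<exists>k\<in>M. k \<subseteq># m"
proof -
  define M where "M = {m \<in> L. \<forall>k\<in>L. k \<subseteq># m \<longrightarrow> k = m}"
  have above: "\<exists>k\<in>M. k \<subseteq># m" if "m \<in> L" for m
    using that
  proof (induction "size m" arbitrary: m rule: less_induct)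
    case less
    show ?case
    proof (cases "m \<in> M")
      case False
      then obtain k where k: "k \<in> L" "k \<subseteq># m" "k \<noteq> m" using less.prems by (auto simp: M_def)
      then have "size k < size m" by (metis mset_subset_size subset_mset.less_le)
      then obtain k' where "k' \<in> M" "k' \<subseteq># k" using less.hyps k(1) by blast
      then show ?thesis using k(2) subset_mset.order_trans by blast
    qed auto
  qed
  have "finite M"
  proof (rule ccontr)
    assume "infinite M"
    then obtain s :: "nat \<Rightarrow> nat multiset" where s: "inj s" "range s \<subseteq> M"
      using infinite_countable_subset by blast
    obtain r :: "nat \<Rightarrow> nat" where r0: "strict_mono r \<and> (\<forall>i\<in>{1..n}. \<forall>a b. a \<le> b \<longrightarrow> count (s (r a)) i \<le> count (s (r b)) i)"
      using multiset_subsequence ..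
    have r: "strict_mono r" "\<And>i a b. i \<in> {1..n} \<Longrightarrow> a \<le> b \<Longrightarrow> count (s (r a)) i \<le> count (s (r b)) i"
      using r0 by auto
    have sM: "s j \<in> L" "\<And>k. k \<in> L \<Longrightarrow> k \<subseteq># s j \<Longrightarrow> k = s j" for j using s(2) by (auto simp: M_def)
    have "s (r 0) \<subseteq># s (r 1)"
    proof (rule mset_subset_eqI)
      fix i
      show "count (s (r 0)) i \<le> count (s (r 1)) i"
      proof (cases "i \<in> {1..n}")
        case False
        then have "i \<notin># s (r 0)" using L[OF sM(1)] by blast
        then show ?thesis by (simp add: not_in_iff)
      qed (simp add: r(2))
    qed
    then have "s (r 0) = s (r 1)" using sM by blast
    then have "r 0 = r 1" using s(1) by (simp add: inj_def)
    then show False using r(1) by (simp add: strict_mono_eq)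
  qed
  moreover have "M \<subseteq> L" by (auto simp: M_def)
  ultimately show ?thesis using above by (rule that)
qed

section \<open>The ring of all formal coefficient functions\<close>

typedef 'k ps = "UNIV :: (nat multiset \<Rightarrow> 'k) set"
  morphisms coef Ps ..

lemma coef_Ps [simp]: "coef (Ps f) = f"
  by (simp add: Ps_inverse)

lemma ps_eqI: "(\<And>m. coef f m = coef g m) \<Longrightarrow> f = g"
  by (metis coef_inject ext)

text \<open>All coefficient functions form a ring, without a bound on the variables, because a
  monomial has finitely many divisors. The class instance supplies the sums and ring laws that the
  locales use; the actual rings are cut out by \<open>ps_carrier\<close>.\<close>

instantiation ps :: (field) comm_ring_1
begin

definition "0 = Ps (const 0)"
definition "1 = Ps (const 1)"
definition "f + g = Ps (\<lambda>m. coef f m + coef g m)"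
definition "- f = Ps (\<lambda>m. - coef f m)"
definition "f - g = Ps (\<lambda>m. coef f m - coef g m)" for f g :: "'a ps"
definition "f * g = Ps (mps_mult (coef f) (coef g))"

lemmas ps_defs = zero_ps_def one_ps_def plus_ps_def uminus_ps_def minus_ps_def times_ps_def

instance
proof
  fix f g h :: "'a ps"
  show "f * g * h = f * (g * h)" by (simp add: ps_defs mps_mult_assoc)
  show "f * g = g * f" by (simp add: ps_defs mps_mult_commute)
  show "1 * f = f" by (simp add: ps_defs mps_mult_one coef_inverse)
  show "(f + g) * h = f * h + g * h" by (simp add: ps_defs mps_mult_add mps_mult_commute[of _ "coef h"])
  have "const (0 :: 'a) {#} \<noteq> const 1 {#}" by (simp add: const_def)
  then show "(0 :: 'a ps) \<noteq> 1" by (metis coef_Ps zero_ps_def one_ps_def)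
qed (auto simp: ps_defs const_def coef_inverse algebra_simps intro!: ps_eqI)

end

lemma coef_simps [simp]: "coef 0 m = 0" "coef (f + g) m = coef f m + coef g m" "coef (- f) m = - coef f m"
  "coef (f - g) m = coef f m - coef g m"
  by (simp_all add: ps_defs const_def)

lemma coef_mult: "coef (f * g) = mps_mult (coef f) (coef g)"
  by (simp add: ps_defs)

lemma coef_sum: "coef (sum f X) m = (\<Sum>x\<in>X. coef (f x) m)"
  by (induction X rule: infinite_finite_induct) auto

definition mono_ps :: "nat multiset \<Rightarrow> 'k \<Rightarrow> 'k::field ps"
  where "mono_ps a c = Ps (\<lambda>m. if m = a then c else 0)"

lemma coef_mono_ps_mult: "coef (mono_ps a c * g) m = (if a \<subseteq># m then c * coef g (m - a) else 0)"
proof -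
  have "coef (mono_ps a c * g) m = (\<Sum>b\<in>{b. b \<subseteq># m}. if b = a then c * coef g (m - a) else 0)"
    unfolding coef_mult mps_mult_def mono_ps_def by (intro sum.cong) auto
  then show ?thesis by (simp add: finite_submset)
qed

text \<open>The coefficients of the quotients are found by recursion along the well-order of monomials.\<close>

lemma power_series_division:
  fixes f :: "'k::field ps" and g :: "nat multiset \<Rightarrow> 'k ps"
  assumes M: "finite M" and g: "\<And>k. k \<in> M \<Longrightarrow> coef (g k) k \<noteq> 0" "\<And>k m. k \<in> M \<Longrightarrow> coef (g k) m \<noteq> 0 \<Longrightarrow> k \<le> m"
  shows "\<exists>q. (\<forall>k\<in>M. coef (q k) \<in> carrier (power_series_ring n)) \<and> (\<forall>m. set_mset m \<subseteq> {1..n}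
    \<longrightarrow> (\<exists>k\<in>M. k \<subseteq># m) \<longrightarrow> coef (\<Sum>k\<in>M. q k * g k) m = coef f m)"
proof -
  define L where "L = {m. set_mset m \<subseteq> {1..n} \<and> (\<exists>k\<in>M. k \<subseteq># m)}"
  \<comment> \<open>Each reducible monomial gets one responsible divisor, so that the unknown
    coefficient \<open>c m\<close> belongs to a single quotient.\<close>
  define \<kappa> where "\<kappa> m = (SOME k. k \<in> M \<and> k \<subseteq># m)" for m
  have \<kappa>: "\<kappa> m \<in> M" "\<kappa> m \<subseteq># m" if "m \<in> L" for m
    using that someI_ex[of "\<lambda>k. k \<in> M \<and> k \<subseteq># m"] by (auto simp: L_def \<kappa>_def)
  define good where "good k a \<longleftrightarrow> a + k \<in> L \<and> \<kappa> (a + k) = k" for k a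
  \<comment> \<open>Solves the equation at \<open>m\<close> for \<open>c m\<close>; the other
    contributions involve unknowns at smaller monomials only, so the recursion is along
    \<open><\<close>.\<close>
  define H where "H c m = (if m \<in> L then (coef f m - (\<Sum>k\<in>M. \<Sum>a | a \<subseteq># m.
      if good k a \<and> a + k < m then c (a + k) * coef (g k) (m - a) else 0)) / coef (g (\<kappa> m)) (\<kappa> m) else 0)"
    for c and m
  define c where "c = wfrec {(x, y). x < y} H"
  have c: "c m = H c m" for m
  proof -
    have "c m = H (cut c {(x, y). x < y} m) m" unfolding c_def by (rule wfrec[OF wf])
    also have "\<dots> = H c m" by (auto simp: H_def cut_apply intro!: sum.cong)
    finally show ?thesis .
  qed
  define q where "q k = Ps (\<lambda>a. if good k a then c (a + k) else 0)" for k
  show ?thesis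
  proof (intro exI[of _ q] conjI ballI allI impI)
    show "coef (q k) \<in> carrier (power_series_ring n)" if "k \<in> M" for k
      by (auto simp: q_def carrier_power_series_ring good_def L_def split: if_splits)
    fix m assume m: "set_mset m \<subseteq> {1..n}" "\<exists>k\<in>M. k \<subseteq># m"
    then have mL: "m \<in> L" by (simp add: L_def)
    let ?x = "c m * coef (g (\<kappa> m)) (\<kappa> m)"
    let ?t = "\<lambda>k a. if good k a \<and> a + k < m then c (a + k) * coef (g k) (m - a) else 0"
    have "coef (\<Sum>k\<in>M. q k * g k) m = (\<Sum>k\<in>M. \<Sum>a | a \<subseteq># m. (if good k a then c (a + k) else 0) * coef (g k) (m - a))"
      by (simp add: coef_sum coef_mult mps_mult_def q_def)
    also have "\<dots> = (\<Sum>k\<in>M. \<Sum>a | a \<subseteq># m. ?t k a + (if a = m - \<kappa> m then if k = \<kappa> m then ?x else 0 else 0))"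
    proof (intro sum.cong refl)
      fix k a assume k: "k \<in> M" and "a \<in> {a. a \<subseteq># m}"
      then have a: "a \<subseteq># m" by simp
      have iff: "(a = m - \<kappa> m \<and> k = \<kappa> m) \<longleftrightarrow> (good k a \<and> a + k = m)"
        using \<kappa>(2)[OF mL] mL by (auto simp: good_def)
      consider "a + k = m" | "a + k < m" | "a + k > m" by (metis neqE)
      then show "(if good k a then c (a + k) else 0) * coef (g k) (m - a)
          = ?t k a + (if a = m - \<kappa> m then if k = \<kappa> m then ?x else 0 else 0)"
      proof cases
        case 1
        then have "m - a = k" by auto
        then show ?thesis using 1 iff by auto
      next
        case 2
        then show ?thesis using iff by auto
      next
        case 3
        \<comment> \<open>\<open>k\<close> is the least monomial of \<open>g k\<close>, so
          multiplying by the monomial \<open>a\<close> reaches nothing below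
          \<open>a + k\<close>.\<close>
        have "coef (g k) (m - a) = 0"
        proof (rule ccontr)
          assume "coef (g k) (m - a) \<noteq> 0"
          then have "a + k \<le> a + (m - a)" using g(2)[OF k] by (simp add: add_left_mono)
          then show False using 3 a by (simp add: leD)
        qed
        then show ?thesis using 3 iff by auto
      qed
    qed
    also have "\<dots> = (\<Sum>k\<in>M. \<Sum>a | a \<subseteq># m. ?t k a) + ?x"
      using \<kappa>[OF mL] M by (simp add: sum.distrib finite_submset)
    also have "?x = coef f m - (\<Sum>k\<in>M. \<Sum>a | a \<subseteq># m. ?t k a)"
      using g(1)[OF \<kappa>(1)[OF mL]] mL by (subst c) (simp add: H_def)
    finally show "coef (\<Sum>k\<in>M. q k * g k) m = coef f m" by simp
  qed
qed

section \<open>Hilbert's basis theorem for power series and for polynomials\<close>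

definition ps_carrier :: "(nat multiset \<Rightarrow> 'k::field) ring \<Rightarrow> 'k ps set"
  where "ps_carrier S = {f. coef f \<in> carrier S}"

text \<open>Dickson's lemma applied to leading monomials; \<open>lm\<close> is left open because
  series use the least and polynomials the greatest monomial.\<close>

lemma monomial_ideal_generators:
  fixes I :: "'k::field ps set" and lm :: "'k ps \<Rightarrow> nat multiset"
  assumes "\<And>f. f \<in> I \<Longrightarrow> f \<noteq> 0 \<Longrightarrow> set_mset (lm f) \<subseteq> {1..n}"
  shows "\<exists>M g. finite M \<and> (\<forall>k\<in>M. g k \<in> I \<and> g k \<noteq> 0 \<and> lm (g k) = k)
    \<and> (\<forall>f\<in>I. f \<noteq> 0 \<longrightarrow> (\<exists>k\<in>M. k \<subseteq># lm f))"
proof -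
  let ?L = "lm ` {f \<in> I. f \<noteq> 0}"
  obtain M where M: "finite M" "M \<subseteq> ?L" "\<And>m. m \<in> ?L \<Longrightarrow> \<exists>k\<in>M. k \<subseteq># m"
    using dickson[of ?L n] assms by blast
  have "\<forall>k\<in>M. \<exists>f. f \<in> I \<and> f \<noteq> 0 \<and> lm f = k" using M(2) by blast
  then obtain g where g: "\<And>k. k \<in> M \<Longrightarrow> g k \<in> I \<and> g k \<noteq> 0 \<and> lm (g k) = k" by metis
  have "\<forall>f\<in>I. f \<noteq> 0 \<longrightarrow> (\<exists>k\<in>M. k \<subseteq># lm f)" using M(3) by blast
  then show ?thesis using M(1) g by (intro exI[of _ M] exI[of _ g]) blast
qed

text \<open>The locale wants coefficients indexed by the generators themselves, whence the
  injectivity of \<open>g\<close>.\<close>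

lemma span_imp_generators:
  fixes g :: "'i \<Rightarrow> 'r::comm_ring_1"
  assumes M: "finite M" "\<And>k. k \<in> M \<Longrightarrow> g k \<in> I" and inj: "inj_on g M"
    and span: "\<And>f. f \<in> I \<Longrightarrow> \<exists>q. (\<forall>k\<in>M. q k \<in> C) \<and> f = (\<Sum>k\<in>M. q k * g k)"
  shows "\<exists>G. finite G \<and> G \<subseteq> I \<and> (\<forall>a\<in>I. \<exists>q. (\<forall>h\<in>G. q h \<in> C) \<and> a = (\<Sum>h\<in>G. q h * h))"
proof (intro exI[of _ "g ` M"] conjI ballI)
  fix a assume "a \<in> I"
  then obtain q where q: "\<And>k. k \<in> M \<Longrightarrow> q k \<in> C" "a = (\<Sum>k\<in>M. q k * g k)" using span by blast
  let ?q = "\<lambda>h. q (the_inv_into M g h)"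
  have "?q (g k) = q k" if "k \<in> M" for k using the_inv_into_f_f[OF inj that] by simp
  then have "(\<forall>h\<in>g ` M. ?q h \<in> C) \<and> a = (\<Sum>h\<in>g ` M. ?q h * h)"
    using q by (simp add: sum.reindex[OF inj])
  then show "\<exists>q. (\<forall>h\<in>g ` M. q h \<in> C) \<and> a = (\<Sum>h\<in>g ` M. q h * h)" by (rule exI[of _ ?q])
qed (use M in auto)

text \<open>Division leaves a remainder that vanishes at every multiple of a leading monomial. It
  lies in \<open>I\<close>, so its own leading monomial would be such a multiple; hence it is zero.
  Leading means least, as a series need not have a greatest monomial.\<close>

lemma power_series_noetherian:
  fixes I :: "'k::field ps set"
  assumes C: "C = ps_carrier (power_series_ring n)" and I: "I \<subseteq> C"
    and add: "\<And>a b. a \<in> I \<Longrightarrow> b \<in> I \<Longrightarrow> a + b \<in> I" and mult: "\<And>c a. c \<in> C \<Longrightarrow> a \<in> I \<Longrightarrow> c * a \<in> I"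
    and zero: "0 \<in> I" and neg: "\<And>a. a \<in> I \<Longrightarrow> - a \<in> I"
  shows "\<exists>G. finite G \<and> G \<subseteq> I \<and> (\<forall>a\<in>I. \<exists>q. (\<forall>h\<in>G. q h \<in> C) \<and> a = (\<Sum>h\<in>G. q h * h))"
proof -
  define lm where "lm f = (LEAST m. coef f m \<noteq> 0)" for f :: "'k ps"
  have lm: "coef f (lm f) \<noteq> 0" "\<And>m. coef f m \<noteq> 0 \<Longrightarrow> lm f \<le> m" if "f \<noteq> 0" for f
  proof -
    have "\<exists>m. coef f m \<noteq> 0" using that ps_eqI[of f 0] by auto
    then show "coef f (lm f) \<noteq> 0" unfolding lm_def by (rule LeastI_ex)
    show "\<And>m. coef f m \<noteq> 0 \<Longrightarrow> lm f \<le> m" unfolding lm_def by (rule Least_le)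
  qed
  have supp: "set_mset m \<subseteq> {1..n}" if "f \<in> C" "coef f m \<noteq> 0" for f m
    using that by (auto simp: C ps_carrier_def carrier_power_series_ring)
  have lmn: "set_mset (lm f) \<subseteq> {1..n}" if "f \<in> I" "f \<noteq> 0" for f
    by (rule supp[of f]) (use lm(1)[OF that(2)] that(1) I in auto)
  have "\<exists>M g. finite M \<and> (\<forall>k\<in>M. g k \<in> I \<and> g k \<noteq> 0 \<and> lm (g k) = k)
    \<and> (\<forall>f\<in>I. f \<noteq> 0 \<longrightarrow> (\<exists>k\<in>M. k \<subseteq># lm f))"
    by (rule monomial_ideal_generators) (rule lmn)
  then obtain M g where M0: "finite M \<and> (\<forall>k\<in>M. g k \<in> I \<and> g k \<noteq> 0 \<and> lm (g k) = k)
    \<and> (\<forall>f\<in>I. f \<noteq> 0 \<longrightarrow> (\<exists>k\<in>M. k \<subseteq># lm f))"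
    by (elim exE)
  have M: "finite M" "\<And>k. k \<in> M \<Longrightarrow> g k \<in> I \<and> g k \<noteq> 0 \<and> lm (g k) = k"
    "\<And>f. f \<in> I \<Longrightarrow> f \<noteq> 0 \<Longrightarrow> \<exists>k\<in>M. k \<subseteq># lm f"
    using M0 by simp_all
  have sumI: "(\<Sum>k\<in>F. q k * g k) \<in> I" if "\<And>k. k \<in> F \<Longrightarrow> q k \<in> C" "F \<subseteq> M" for F q
    using that by (induction F rule: infinite_finite_induct) (auto simp: zero intro!: add mult M(2)[THEN conjunct1])
  show ?thesis
  proof (rule span_imp_generators[OF M(1)])
    show "inj_on g M" by (rule inj_on_inverseI[of _ lm]) (use M(2) in blast)
    fix f assume f: "f \<in> I"
    have g1: "coef (g k) k \<noteq> 0" "\<And>m. coef (g k) m \<noteq> 0 \<Longrightarrow> k \<le> m" if "k \<in> M" for k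
      using M(2)[OF that] lm by metis+
    have "\<exists>q. (\<forall>k\<in>M. coef (q k) \<in> carrier (power_series_ring n)) \<and> (\<forall>m. set_mset m \<subseteq> {1..n}
      \<longrightarrow> (\<exists>k\<in>M. k \<subseteq># m) \<longrightarrow> coef (\<Sum>k\<in>M. q k * g k) m = coef f m)"
      by (rule power_series_division[OF M(1)]) (rule g1; assumption)+
    then obtain q where q: "\<forall>k\<in>M. coef (q k) \<in> carrier (power_series_ring n)"
      "\<forall>m. set_mset m \<subseteq> {1..n} \<longrightarrow> (\<exists>k\<in>M. k \<subseteq># m) \<longrightarrow> coef (\<Sum>k\<in>M. q k * g k) m = coef f m"
      by (elim exE conjE)
    have qC: "\<forall>k\<in>M. q k \<in> C" using q(1) by (simp add: C ps_carrier_def)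
    let ?r = "f + - (\<Sum>k\<in>M. q k * g k)"
    have r: "?r \<in> I" using qC by (intro add f neg sumI) auto
    have "?r = 0"
    proof (rule ccontr)
      assume nz: "?r \<noteq> 0"
      have "set_mset (lm ?r) \<subseteq> {1..n}" using supp lm(1)[OF nz] r I by blast
      then have "coef ?r (lm ?r) = 0" using q(2) M(3)[OF r nz] by simp
      then show False using lm(1)[OF nz] by simp
    qed
    then show "\<exists>q. (\<forall>k\<in>M. q k \<in> C) \<and> f = (\<Sum>k\<in>M. q k * g k)" using qC by (intro exI[of _ q]) simp
  qed (use M(2) in blast)
qed

text \<open>Cancelling the greatest monomial against a generator strictly lowers it, and the order
  on monomials is well-founded. Division from below as for series could produce infinite
  quotients.\<close>

lemma polynomial_noetherian:
  fixes I :: "'k::field ps set"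
  assumes C: "C = ps_carrier (polynomial_ring n)" and I: "I \<subseteq> C"
    and add: "\<And>a b. a \<in> I \<Longrightarrow> b \<in> I \<Longrightarrow> a + b \<in> I" and mult: "\<And>c a. c \<in> C \<Longrightarrow> a \<in> I \<Longrightarrow> c * a \<in> I"
    and C_zero: "0 \<in> C" and C_add: "\<And>a b. a \<in> C \<Longrightarrow> b \<in> C \<Longrightarrow> a + b \<in> C" and neg: "\<And>a. a \<in> I \<Longrightarrow> - a \<in> I"
  shows "\<exists>G. finite G \<and> G \<subseteq> I \<and> (\<forall>a\<in>I. \<exists>q. (\<forall>h\<in>G. q h \<in> C) \<and> a = (\<Sum>h\<in>G. q h * h))"
proof -
  define lm where "lm f = Max {m. coef f m \<noteq> 0}" for f :: "'k ps"
  have supp: "set_mset m \<subseteq> {1..n}" if "f \<in> C" "coef f m \<noteq> 0" for f m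
    using that by (auto simp: C ps_carrier_def carrier_polynomial_ring)
  have lm: "coef f (lm f) \<noteq> 0" "\<And>m. coef f m \<noteq> 0 \<Longrightarrow> m \<le> lm f" if "f \<noteq> 0" "f \<in> I" for f
  proof -
    have fin: "finite {m. coef f m \<noteq> 0}" using that I by (auto simp: C ps_carrier_def carrier_polynomial_ring)
    have "{m. coef f m \<noteq> 0} \<noteq> {}" using that ps_eqI[of f 0] by auto
    from Max_in[OF fin this] show "coef f (lm f) \<noteq> 0" by (simp add: lm_def)
    show "\<And>m. coef f m \<noteq> 0 \<Longrightarrow> m \<le> lm f" unfolding lm_def using Max_ge[OF fin] by simp
  qed
  have lmn: "set_mset (lm f) \<subseteq> {1..n}" if "f \<in> I" "f \<noteq> 0" for f
    by (rule supp[of f]) (use lm(1)[OF that(2,1)] that(1) I in auto)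
  have "\<exists>M g. finite M \<and> (\<forall>k\<in>M. g k \<in> I \<and> g k \<noteq> 0 \<and> lm (g k) = k)
    \<and> (\<forall>f\<in>I. f \<noteq> 0 \<longrightarrow> (\<exists>k\<in>M. k \<subseteq># lm f))"
    by (rule monomial_ideal_generators) (rule lmn)
  then obtain M g where M0: "finite M \<and> (\<forall>k\<in>M. g k \<in> I \<and> g k \<noteq> 0 \<and> lm (g k) = k)
    \<and> (\<forall>f\<in>I. f \<noteq> 0 \<longrightarrow> (\<exists>k\<in>M. k \<subseteq># lm f))"
    by (elim exE)
  have M: "finite M" "\<And>k. k \<in> M \<Longrightarrow> g k \<in> I \<and> g k \<noteq> 0 \<and> lm (g k) = k"
    "\<And>f. f \<in> I \<Longrightarrow> f \<noteq> 0 \<Longrightarrow> \<exists>k\<in>M. k \<subseteq># lm f"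
    using M0 by simp_all
  \<comment> \<open>The induction is on a bound \<open>m\<close> for the monomials of
    \<open>f\<close>, so that the zero polynomial needs no leading monomial.\<close>
  have reduce: "\<exists>q. (\<forall>k\<in>M. q k \<in> C) \<and> f = (\<Sum>k\<in>M. q k * g k)"
    if "f \<in> I" "\<forall>t. coef f t \<noteq> 0 \<longrightarrow> t \<le> m" for f m
    using that
  proof (induction m arbitrary: f rule: less_induct)
    case (less m)
    show ?case
    proof (cases "f = 0")
      case True
      then show ?thesis using C_zero by (intro exI[of _ "\<lambda>_. 0"]) simp
    next
      case False
      note fI = less.prems(1)
      obtain k where k: "k \<in> M" "k \<subseteq># lm f" using M(3)[OF fI False] by blast
      let ?g = "g k" and ?t = "lm f"
      have gk: "?g \<noteq> 0" "?g \<in> I" "lm ?g = k" using M(2)[OF k(1)] by auto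
      have g0: "coef ?g k \<noteq> 0" "\<And>s. coef ?g s \<noteq> 0 \<Longrightarrow> s \<le> k" using lm[OF gk(1,2)] by (simp_all add: gk(3))
      let ?c = "mono_ps (?t - k) (coef f ?t / coef ?g k)"
      have tn: "set_mset ?t \<subseteq> {1..n}" using supp lm(1)[OF False fI] fI I by blast
      then have "set_mset (?t - k) \<subseteq> {1..n}" by (meson diff_subset_eq_self set_mset_mono subset_trans)
      moreover have "{m. (if m = ?t - k then coef f ?t / coef ?g k else 0) \<noteq> 0} \<subseteq> {?t - k}" by auto
      ultimately have cC: "?c \<in> C"
        by (auto simp: C ps_carrier_def carrier_polynomial_ring mono_ps_def intro: finite_subset split: if_splits)
      let ?f = "f + - (?c * ?g)"
      have fI': "?f \<in> I" using cC gk by (intro add neg mult fI) auto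
      have low: "s < ?t" if s: "coef ?f s \<noteq> 0" for s
      proof (rule ccontr)
        assume "\<not> s < ?t"
        then consider "s = ?t" | "?t < s" by (metis neqE)
        then show False
        proof cases
          case 1
          have "?t - (?t - k) = k" using k(2) by (simp add: subset_mset.diff_diff_right)
          then show False using s 1 g0 by (simp add: coef_mono_ps_mult)
        next
          case 2
          have "coef f s = 0" using lm(2)[OF False fI, of s] 2 leD by blast
          then have "?t - k \<subseteq># s" "coef ?g (s - (?t - k)) \<noteq> 0" using s by (auto simp: coef_mono_ps_mult split: if_splits)
          then have "s - (?t - k) \<le> k" using g0 by blast
          then have "(s - (?t - k)) + (?t - k) \<le> k + (?t - k)" by (rule add_right_mono)
          then have "s \<le> ?t" using \<open>?t - k \<subseteq># s\<close> k(2) by simp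
          then show False using 2 by simp
        qed
      qed
      have "\<exists>q. (\<forall>k\<in>M. q k \<in> C) \<and> ?f = (\<Sum>k\<in>M. q k * g k)"
      proof (cases "?f = 0")
        case True
        then show ?thesis using C_zero by (intro exI[of _ "\<lambda>_. 0"]) simp
      next
        case nz: False
        have "lm ?f < ?t" using low lm(1)[OF nz fI'] by blast
        also have "?t \<le> m" using less.prems(2) lm(1)[OF False fI] by blast
        finally have "lm ?f < m" .
        then show ?thesis using less.IH[OF _ fI'] lm(2)[OF nz fI'] by blast
      qed
      then obtain q where q: "\<And>k. k \<in> M \<Longrightarrow> q k \<in> C" "?f = (\<Sum>k\<in>M. q k * g k)" by blast
      let ?q = "\<lambda>j. q j + (if j = k then ?c else 0)"
      have "(\<Sum>j\<in>M. ?q j * g j) = (\<Sum>j\<in>M. q j * g j) + (\<Sum>j\<in>M. if j = k then ?c * g k else 0)"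
        unfolding sum.distrib[symmetric] by (intro sum.cong) (auto simp: distrib_right)
      also have "\<dots> = f" using k(1) M(1) q(2)[symmetric] by simp
      finally have "f = (\<Sum>j\<in>M. ?q j * g j)" by simp
      moreover have "\<forall>j\<in>M. ?q j \<in> C" using q(1) cC by (auto intro: C_add)
      ultimately show ?thesis by (intro exI[of _ ?q] conjI)
    qed
  qed
  show ?thesis
  proof (rule span_imp_generators[OF M(1)])
    show "inj_on g M" by (rule inj_on_inverseI[of _ lm]) (use M(2) in blast)
    fix f assume f: "f \<in> I"
    then show "\<exists>q. (\<forall>k\<in>M. q k \<in> C) \<and> f = (\<Sum>k\<in>M. q k * g k)"
      using reduce[OF f, of "lm f"] reduce[OF f, of "{#}"] lm(2)[OF _ f] by (cases "f = 0") auto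
  qed (use M(2) in blast)
qed

section \<open>The Koszul data of a permutation\<close>

lemma act_inverse:
  assumes "bij \<sigma>"
  shows "act \<sigma> (act (inv_into UNIV \<sigma>) f) = f" "act (inv_into UNIV \<sigma>) (act \<sigma> f) = f"
  using assms
  by (auto simp: act_def inv_inv_eq multiset.map_comp comp_def bij_is_surj surj_f_inv_f bij_is_inj)

lemma act_diff: "act \<sigma> (\<lambda>m. f m - g m) = (\<lambda>m. act \<sigma> f m - act \<sigma> g m)"
  by (simp add: act_def)

lemma dd_perm_add: "dd_perm \<sigma> r (\<lambda>m. f m + g m) = (\<lambda>m. dd_perm \<sigma> r f m + dd_perm \<sigma> r g m)"
  by (auto simp: dd_perm_def act_def dd_def div_var_def kill_below_def)

lemma kill_below_var: "kill_below r (var s) = (if s < r then const 0 else var s)"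
  by (auto simp: kill_below_def var_def const_def fun_eq_iff)

lemma dd_var: "dd r (var s :: nat multiset \<Rightarrow> 'k::field) = (if r = s then const 1 else const 0)"
proof -
  have "mps_mult (var r) (const 1) = (var r :: nat multiset \<Rightarrow> 'k)" using mps_mult_one[of "var r :: nat multiset \<Rightarrow> 'k"] by (simp add: mps_mult_commute)
  then have "div_var r (var r) = (const 1 :: nat multiset \<Rightarrow> 'k)" using div_var_mult[of r "const 1 :: nat multiset \<Rightarrow> 'k"] by simp
  moreover have "div_var r (\<lambda>m. 0) = (const 0 :: nat multiset \<Rightarrow> 'k)" by (auto simp: div_var_def const_def)
  ultimately show ?thesis unfolding dd_def kill_below_var
    by (auto simp: const_def div_var_def fun_eq_iff)
qed

lemma mps_mult_zero: "mps_mult (const 0) f = const 0"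
proof
  fix m
  show "mps_mult (const 0) f m = const 0 m" by (subst mps_mult_const) (simp add: const_def)
qed

text \<open>A case of the product rule \<open>dd_mult\<close>; for \<open>s = r\<close> its two
  summands add up to \<open>kill_below r f\<close> by \<open>var_mult_dd\<close>.\<close>

lemma dd_var_mult:
  "dd r (mps_mult (var s) f) = (if s < r then const 0 else if s = r then kill_below r f else mps_mult (var s) (dd r f))"
proof -
  have e: "dd r (mps_mult (var s) f) = (\<lambda>m. mps_mult (if s < r then const 0 else var s) (dd r f) m
      + mps_mult (if r = s then const 1 else const 0) (kill_below (Suc r) f) m)"
    unfolding dd_mult kill_below_var dd_var ..
  consider "s < r" | "s = r" | "r < s" by linarith
  then show ?thesis
  proof cases
    case 1
    then show ?thesis unfolding e by (simp add: mps_mult_zero) (simp add: const_def)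
  next
    case 2
    then show ?thesis unfolding e by (simp add: mps_mult_one var_mult_dd)
  next
    case 3
    then show ?thesis unfolding e by (simp add: mps_mult_zero) (simp add: const_def)
  qed
qed

context
  fixes S :: "(nat multiset \<Rightarrow> 'k::field) ring" and n :: nat
  assumes S: "S = power_series_ring n \<or> S = polynomial_ring n"
begin

lemma S_simps: "mult S = mps_mult" "one S = const 1" "zero S = const 0" "add S = (\<lambda>f g m. f m + g m)"
  using S by auto

lemma cring_S: "cring S"
  using S cring_power_series_ring cring_polynomial_ring by blast

lemma uminus_carrier: "f \<in> carrier S \<Longrightarrow> (\<lambda>m. - f m) \<in> carrier S"
  using S by (auto simp: carrier_power_series_ring carrier_polynomial_ring)

lemma const_carrier: "const c \<in> carrier S"
proof -
  have "{m. const c m \<noteq> 0} \<subseteq> {{#}}" by (auto simp: const_def)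
  then have "finite {m. const c m \<noteq> 0}" by (rule finite_subset) simp
  then show ?thesis using S by (auto simp: carrier_power_series_ring carrier_polynomial_ring const_def split: if_splits)
qed

lemma mult_carrier: "f \<in> carrier S \<Longrightarrow> g \<in> carrier S \<Longrightarrow> mps_mult f g \<in> carrier S"
  using cring_S monoid.m_closed[of S f g] unfolding S_simps cring_def Ring.ring_def by blast

lemma add_carrier: "f \<in> carrier S \<Longrightarrow> g \<in> carrier S \<Longrightarrow> (\<lambda>m. f m + g m) \<in> carrier S"
  using abelian_monoid.a_closed[of S f g] cring_S unfolding S_simps
  by (simp add: cring_def Ring.ring_def abelian_group_def)

lemma subring_ps: "augmented_subring (ps_carrier S) (\<lambda>c. Ps (const c)) (\<lambda>f. coef f {#})"
proof
  show "1 \<in> ps_carrier S" by (simp add: ps_carrier_def one_ps_def const_carrier)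
  show "a + b \<in> ps_carrier S" "a * b \<in> ps_carrier S" if "a \<in> ps_carrier S" "b \<in> ps_carrier S" for a b
    using that add_carrier mult_carrier by (simp_all add: ps_carrier_def plus_ps_def times_ps_def)
  show "- a \<in> ps_carrier S" if "a \<in> ps_carrier S" for a
    using that uminus_carrier by (simp add: ps_carrier_def uminus_ps_def)
  show "Ps (const c) \<in> ps_carrier S" for c by (simp add: ps_carrier_def const_carrier)
  show "Ps (const (c + d)) = Ps (const c) + Ps (const d)" for c d :: 'k by (rule ps_eqI) (simp add: const_def)
  show "Ps (const (c * d)) = Ps (const c) * Ps (const d)" for c d :: 'k
    by (rule ps_eqI) (simp add: coef_mult mps_mult_const, simp add: const_def)
  show "Ps (const 1) = (1 :: 'k ps)" by (simp add: one_ps_def)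
  show "coef (a * b) {#} = coef a {#} * coef b {#}" for a b :: "'k ps" by (simp add: coef_mult mps_mult_def)
qed (auto simp: const_def)

text \<open>The two ends of the telescoping sum: no variable killed, and all of them killed.\<close>

lemma kill_all:
  assumes "f \<in> carrier S"
  shows "kill_below 1 f = f" "kill_below (Suc n) f = const (f {#})"
proof -
  have supp: "set_mset m \<subseteq> {1..n}" if "f m \<noteq> 0" for m using carrier_supp[OF S assms that] .
  show "kill_below 1 f = f" using supp by (fastforce simp: kill_below_def fun_eq_iff)
  show "kill_below (Suc n) f = const (f {#})"
  proof
    fix m
    have "m = {#}" if "f m \<noteq> 0" "set_mset m \<subseteq> {Suc n..}"
    proof -
      have "set_mset m = {}" using supp[OF that(1)] that(2) by fastforce
      then show ?thesis by simp
    qed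
    then show "kill_below (Suc n) f m = const (f {#}) m" by (auto simp: kill_below_def const_def)
  qed
qed

text \<open>The laws hold for the identity permutation by \<open>dd_var_mult\<close> and
  \<open>var_mult_dd\<close>; conjugation by the automorphism \<open>act \<sigma>\<close> carries
  them over, the variable \<open>r\<close> becoming the variable \<open>\<sigma> r\<close>.\<close>

lemma koszul_ps:
  assumes \<sigma>: "\<sigma> permutes {1..n}"
  shows "koszul (ps_carrier S) (\<lambda>c. Ps (const c)) (\<lambda>f. coef f {#}) n (\<lambda>r. Ps (var (\<sigma> r)))
    (\<lambda>r f. Ps (dd_perm \<sigma> r (coef f))) (\<lambda>r f. Ps (act \<sigma> (kill_below r (act (inv_into UNIV \<sigma>) (coef f)))))"
proof -
  let ?\<tau> = "inv_into UNIV \<sigma>"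
  interpret augmented_subring "ps_carrier S" "\<lambda>c. Ps (const c)" "\<lambda>f. coef f {#}" by (rule subring_ps)
  have \<tau>: "?\<tau> permutes {1..n}" by (rule permutes_inv[OF \<sigma>])
  have bij: "bij \<sigma>" "bij ?\<tau>" using \<sigma> \<tau> permutes_bij by blast+
  have \<sigma>r: "\<sigma> r \<in> {1..n}" if "r \<in> {1..n}" for r using that permutes_in_image[OF \<sigma>] by blast
  have act\<tau>: "act ?\<tau> (mps_mult (var (\<sigma> s)) f) = mps_mult (var s) (act ?\<tau> f)" for s and f :: "nat multiset \<Rightarrow> 'k"
    using bij by (simp add: act_mult act_var bij_is_inj)
  have acta: "act ?\<tau> f \<in> carrier S" if "f \<in> carrier S" for f using act_closed[OF S \<tau> that] .
  have act0: "act \<sigma> (const c) = const c" for c :: 'k by (auto simp: act_def const_def)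
  show ?thesis
  proof
    fix r s :: nat and a b :: "'k ps"
    show "Ps (var (\<sigma> r)) \<in> ps_carrier S" if "r \<in> {1..n}" using var_closed[OF S \<sigma>r[OF that]] by (simp add: ps_carrier_def)
    show "coef (Ps (var (\<sigma> r))) {#} = (0 :: 'k)" by (simp add: var_def)
    show "Ps (dd_perm \<sigma> r (coef a)) \<in> ps_carrier S" if "a \<in> ps_carrier S"
      using that acta dd_closed[OF S] act_closed[OF S \<sigma>] by (simp add: ps_carrier_def dd_perm_def)
    show "Ps (dd_perm \<sigma> r (coef (a + b))) = Ps (dd_perm \<sigma> r (coef a)) + Ps (dd_perm \<sigma> r (coef b))"
      by (simp add: plus_ps_def dd_perm_add)
    show "Ps (var (\<sigma> r)) * Ps (dd_perm \<sigma> r (coef a)) = Ps (act \<sigma> (kill_below r (act ?\<tau> (coef a))))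
        - Ps (act \<sigma> (kill_below (Suc r) (act ?\<tau> (coef a))))"
    proof -
      have "mps_mult (var (\<sigma> r)) (dd_perm \<sigma> r (coef a)) = act \<sigma> (mps_mult (var r) (dd r (act ?\<tau> (coef a))))"
        by (simp add: dd_perm_def act_mult act_var bij)
      then show ?thesis by (simp add: times_ps_def minus_ps_def var_mult_dd act_diff)
    qed
    show "Ps (act \<sigma> (kill_below 1 (act ?\<tau> (coef a)))) = a" if "a \<in> ps_carrier S"
      using kill_all(1)[OF acta, of "coef a"] that
      by (simp add: ps_carrier_def coef_inverse act_inverse(1)[OF bij(1)])
    show "Ps (act \<sigma> (kill_below (Suc n) (act ?\<tau> (coef a)))) = Ps (const (coef a {#}))" if "a \<in> ps_carrier S"
    proof -
      have "kill_below (Suc n) (act ?\<tau> (coef a)) = const (act ?\<tau> (coef a) {#})"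
        using kill_all(2)[OF acta, of "coef a"] that by (simp add: ps_carrier_def)
      also have "act ?\<tau> (coef a) {#} = coef a {#}" by (simp add: act_def)
      finally show ?thesis by (simp add: act0)
    qed
    show "Ps (dd_perm \<sigma> r (coef (Ps (var (\<sigma> s)) * a))) = 0" if "s < r"
      using that by (simp add: dd_perm_def coef_mult act\<tau> dd_var_mult act0 zero_ps_def)
    show "Ps (dd_perm \<sigma> r (coef (Ps (var (\<sigma> r)) * a))) = Ps (act \<sigma> (kill_below r (act ?\<tau> (coef a))))"
      by (simp add: dd_perm_def coef_mult act\<tau> dd_var_mult)
    show "Ps (dd_perm \<sigma> r (coef (Ps (var (\<sigma> s)) * a))) = Ps (var (\<sigma> s)) * Ps (dd_perm \<sigma> r (coef a))" if "r < s"
      using that by (simp add: dd_perm_def coef_mult act\<tau> dd_var_mult act_mult act_var bij times_ps_def)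
  next
    fix I :: "'k ps set"
    assume I: "I \<subseteq> ps_carrier S" "0 \<in> I" "\<And>a b. a \<in> I \<Longrightarrow> b \<in> I \<Longrightarrow> a + b \<in> I"
      "\<And>c a. c \<in> ps_carrier S \<Longrightarrow> a \<in> I \<Longrightarrow> c * a \<in> I"
    have neg: "- a \<in> I" if "a \<in> I" for a using I(4)[OF uminus_C[OF one_C] that] by simp
    from S show "\<exists>G. finite G \<and> G \<subseteq> I \<and> (\<forall>a\<in>I. \<exists>q. (\<forall>g\<in>G. q g \<in> ps_carrier S) \<and> a = (\<Sum>g\<in>G. q g * g))"
    proof
      assume "S = power_series_ring n"
      then have "ps_carrier S = ps_carrier (power_series_ring n)" by simp
      then show ?thesis by (rule power_series_noetherian) (use I neg in auto)
    next
      assume "S = polynomial_ring n"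
      then have "ps_carrier S = ps_carrier (polynomial_ring n)" by simp
      then show ?thesis by (rule polynomial_noetherian) (use I neg zero_C add_C in auto)
    qed
  qed
qed

end

text \<open>A nonzero constant term makes a power series invertible. For polynomials it does not,
  and gradedness steps in: the component of degree 0 is a nonzero constant in
  \<open>I\<close>.\<close>

lemma proper_ideal_constant:
  fixes S :: "(nat multiset \<Rightarrow> 'k::field) ring"
  assumes "S = power_series_ring n \<or> (S = polynomial_ring n \<and> graded_ideal I)"
    and I: "ideal I S" and proper: "I \<noteq> carrier S" and f: "f \<in> I"
  shows "f {#} = 0"
proof (rule ccontr)
  assume nz: "f {#} \<noteq> 0"
  have S: "S = power_series_ring n \<or> S = polynomial_ring n" using assms(1) by blast
  interpret ideal I S by (rule I)
  have "const 1 \<in> I"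
    using assms(1)
  proof
    assume Sp: "S = power_series_ring n"
    let ?f = "Ps f"
    \<comment> \<open>Dividing 1 by \<open>f\<close>, whose least monomial is the empty one, inverts
      \<open>f\<close>: every monomial is a multiple of the empty one.\<close>
    have "\<exists>q. (\<forall>k\<in>{{#} :: nat multiset}. coef (q k) \<in> carrier (power_series_ring n)) \<and> (\<forall>m. set_mset m \<subseteq> {1..n}
        \<longrightarrow> (\<exists>k\<in>{{#}}. k \<subseteq># m) \<longrightarrow> coef (\<Sum>k\<in>{{#}}. q k * ?f) m = coef 1 m)"
      by (rule power_series_division[where M = "{{#}}" and g = "\<lambda>_. Ps f" and f = 1 and n = n]) (use nz in auto)
    then obtain q where q: "coef (q {#}) \<in> carrier S" "\<And>m. set_mset m \<subseteq> {1..n} \<Longrightarrow> mps_mult (coef (q {#})) f m = const 1 m"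
      by (auto simp: Sp coef_mult one_ps_def)
    have fS: "f \<in> carrier S" using f a_subset by blast
    have "mps_mult (coef (q {#})) f = const 1"
    proof
      fix m
      show "mps_mult (coef (q {#})) f m = const 1 m"
      proof (cases "set_mset m \<subseteq> {1..n}")
        case False
        then have "mps_mult (coef (q {#})) f m = 0" "const 1 m = (0 :: 'k)"
          using carrier_supp[OF S mult_carrier[OF S q(1) fS], of m] carrier_supp[OF S const_carrier[OF S, of 1], of m] by blast+
        then show ?thesis by simp
      qed (rule q(2))
    qed
    moreover have "mps_mult (coef (q {#})) f \<in> I" using I_l_closed[OF f q(1)] by (simp add: S_simps[OF S])
    ultimately show ?thesis by simp
  next
    assume Sp: "S = polynomial_ring n \<and> graded_ideal I"
    then have "hom_component 0 f \<in> I" using f by (auto simp: graded_ideal_def)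
    moreover have "hom_component 0 f = const (f {#})" by (auto simp: hom_component_def const_def)
    ultimately have "mps_mult (const (1 / f {#})) (const (f {#})) \<in> I"
      using I_l_closed[OF _ const_carrier[OF S]] by (simp add: S_simps[OF S])
    moreover have "mps_mult (const (1 / f {#})) (const (f {#})) = const 1"
      by (rule ext, subst mps_mult_const) (simp add: const_def nz)
    ultimately show ?thesis by simp
  qed
  then have "I = carrier S" using one_imp_carrier by (simp add: S_simps[OF S])
  then show False using proper by blast
qed

theorem theorem2p3:
  fixes S :: "(nat multiset \<Rightarrow> 'k::field) ring"
    and I :: "(nat multiset \<Rightarrow> 'k) set"
    and n :: nat
  assumes "S = power_series_ring n \<or> (S = polynomial_ring n \<and> graded_ideal I)"
    and "ideal I S" and "I \<noteq> carrier S"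
    and "\<exists>\<sigma>. \<sigma> permutes {1..n} \<and> ideal_prod S (d_ideal S n \<sigma> I) (d_ideal S n \<sigma> I) \<subseteq> I"
  shows "golod_ideal n S I"
proof -
  obtain \<sigma> where \<sigma>: "\<sigma> permutes {1..n}" "ideal_prod S (d_ideal S n \<sigma> I) (d_ideal S n \<sigma> I) \<subseteq> I"
    using assms(4) by blast
  have S: "S = power_series_ring n \<or> S = polynomial_ring n" using assms(1) by blast
  note simps = S_simps[OF S]
  interpret ideal I S by (rule assms(2))
  define C where "C = ps_carrier S"
  define cst :: "'k \<Rightarrow> 'k ps" where "cst c = Ps (const c)" for c
  define ev :: "'k ps \<Rightarrow> 'k" where "ev f = coef f {#}" for f
  define y :: "nat \<Rightarrow> 'k ps" where "y r = Ps (var (\<sigma> r))" for r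
  define D :: "nat \<Rightarrow> 'k ps \<Rightarrow> 'k ps" where "D r f = Ps (dd_perm \<sigma> r (coef f))" for r f
  define kap :: "nat \<Rightarrow> 'k ps \<Rightarrow> 'k ps" where "kap r f = Ps (act \<sigma> (kill_below r (act (inv_into UNIV \<sigma>) (coef f))))" for r f
  interpret K: koszul C cst ev n y D kap
    using koszul_ps[OF S \<sigma>(1)] unfolding C_def cst_def[abs_def] ev_def[abs_def] y_def[abs_def] D_def[abs_def] kap_def[abs_def] .
  have C_iff: "f \<in> C \<longleftrightarrow> coef f \<in> carrier S" for f by (simp add: C_def ps_carrier_def)
  have I_ev: "f {#} = 0" if "f \<in> I" for f by (rule proper_ideal_constant[OF assms(1-3) that])
  define I' where "I' = {f. coef f \<in> I}"
  define J where "J = d_ideal S n \<sigma> I"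
  define J' where "J' = {f. coef f \<in> J}"
  let ?gen = "{dd_perm \<sigma> i f | i f. i \<in> {1..n} \<and> f \<in> I}"
  have gen: "?gen \<subseteq> carrier S"
    using act_closed[OF S \<sigma>(1)] act_closed[OF S permutes_inv[OF \<sigma>(1)]] dd_closed[OF S] a_subset
    by (auto simp: dd_perm_def)
  have idJ: "ideal J S" unfolding J_def d_ideal_def by (rule genideal_ideal[OF gen])
  interpret J: ideal J S by (rule idJ)
  have JJ: "mps_mult p q \<in> I" if "p \<in> J" "q \<in> J" for p q
    using ideal_prod.prod[OF that, of S] \<sigma>(2) unfolding simps J_def by blast
  \<comment> \<open>The constant term of \<open>p * p\<close> is the square of that of
    \<open>p\<close>, and elements of \<open>I\<close> have none.\<close>
  have J_ev: "p {#} = 0" if "p \<in> J" for p using I_ev[OF JJ[OF that that]] by (simp add: mps_mult_def)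
  have idl: "K.idl {f. coef f \<in> A}" if A: "ideal A S" "\<And>p. p \<in> A \<Longrightarrow> p {#} = 0" for A
  proof -
    interpret A: ideal A S by (rule A(1))
    show ?thesis
      using A.a_subset A.zero_closed A.a_closed A.I_l_closed A(2)
      unfolding K.idl_def by (auto simp: C_iff simps coef_mult plus_ps_def zero_ps_def ev_def)
  qed
  have I': "K.idl I'" unfolding I'_def using idl[of I] assms(2) I_ev by blast
  have J': "K.idl J'" unfolding J'_def using idl[of J] idJ J_ev by blast
  have DJ: "D r a \<in> J'" if "r \<in> {1..n}" "a \<in> I'" for r a
    using that genideal_self[OF gen] unfolding J'_def J_def d_ideal_def I'_def D_def by auto
  \<comment> \<open>Bundles the conclusions of \<open>koszul_basis\<close> so that the sets
    \<open>V i\<close> can be chosen for all \<open>i\<close> at once.\<close>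
  define P where "P i V \<longleftrightarrow> finite V \<and> (\<forall>v\<in>V. K.vc v \<and> K.homog (Suc i) v \<and> (\<forall>M. v M \<in> J') \<and> (\<forall>M\<subseteq>{1..n}. K.bd v M \<in> I'))
    \<and> (\<forall>a. K.vc a \<longrightarrow> K.homog (Suc i) a \<longrightarrow> (\<forall>M\<subseteq>{1..n}. K.bd a M \<in> I') \<longrightarrow>
      (\<exists>c g. K.vc g \<and> K.homog (Suc (Suc i)) g \<and> K.eqm I' (Pow {1..n}) a (\<lambda>M. (\<Sum>v\<in>V. cst (c v) * v M) + K.bd g M)))
    \<and> (\<forall>c g v. K.vc g \<longrightarrow> K.homog (Suc (Suc i)) g \<longrightarrow> K.eqm I' (Pow {1..n}) (\<lambda>M. \<Sum>v\<in>V. cst (c v) * v M) (K.bd g) \<longrightarrow> v \<in> V \<longrightarrow> c v = 0)"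
    for i V
  have "\<exists>V. P i V" for i
  proof (rule K.koszul_basis[OF I' K.idlD(2)[OF J'] DJ, of i])
    fix V
    assume V: "finite V"
      "\<And>v. v \<in> V \<Longrightarrow> K.vc v \<and> K.homog (Suc i) v \<and> (\<forall>M. v M \<in> J') \<and> (\<forall>M\<subseteq>{1..n}. K.bd v M \<in> I')"
      "\<And>a. K.vc a \<Longrightarrow> K.homog (Suc i) a \<Longrightarrow> \<forall>M\<subseteq>{1..n}. K.bd a M \<in> I' \<Longrightarrow>
        \<exists>c g. K.vc g \<and> K.homog (Suc (Suc i)) g \<and> K.eqm I' (Pow {1..n}) a (\<lambda>M. (\<Sum>v\<in>V. cst (c v) * v M) + K.bd g M)"
      "\<And>c g v. K.vc g \<Longrightarrow> K.homog (Suc (Suc i)) g \<Longrightarrow> K.eqm I' (Pow {1..n}) (\<lambda>M. \<Sum>v\<in>V. cst (c v) * v M) (K.bd g) \<Longrightarrow> v \<in> V \<Longrightarrow> c v = 0"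
    have "P i V"
      unfolding P_def
    proof (intro conjI)
      show "finite V" by (rule V(1))
      show "\<forall>v\<in>V. K.vc v \<and> K.homog (Suc i) v \<and> (\<forall>M. v M \<in> J') \<and> (\<forall>M\<subseteq>{1..n}. K.bd v M \<in> I')"
        by (intro ballI V(2))
    qed (intro allI impI; rule V(3,4); assumption)+
    then show ?thesis ..
  qed
  then obtain V where V: "\<And>i. P i (V i)" by metis
  interpret G: golod C cst ev n y D kap I' J' V
  proof
    show "K.idl I'" "K.idl J'" by (rule I' J')+
    show "p * q \<in> I'" if "p \<in> J'" "q \<in> J'" for p q using that JJ by (simp add: I'_def J'_def coef_mult)
    fix i
    show "finite (V i)" using V[of i] by (simp add: P_def)
    show "K.vc v \<and> K.homog (Suc i) v \<and> (\<forall>M. v M \<in> J') \<and> (\<forall>M\<subseteq>{1..n}. K.bd v M \<in> I')" if "v \<in> V i" for v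
      using conjunct1[OF conjunct2[OF V[of i, unfolded P_def]]] that by (rule bspec)
    show "\<exists>c g. K.vc g \<and> K.homog (Suc (Suc i)) g \<and> K.eqm I' (Pow {1..n}) a (\<lambda>M. (\<Sum>v\<in>V i. cst (c v) * v M) + K.bd g M)"
      if "K.vc a" "K.homog (Suc i) a" "\<forall>M\<subseteq>{1..n}. K.bd a M \<in> I'" for a
      using V[of i] that by (simp only: P_def)
    show "c v = 0" if "K.vc g" "K.homog (Suc (Suc i)) g" "K.eqm I' (Pow {1..n}) (\<lambda>M. \<Sum>v\<in>V i. cst (c v) * v M) (K.bd g)" "v \<in> V i" for c g v
      using V[of i] that unfolding P_def by blast
  qed
  have carS: "carrier S = coef ` C" by (force simp: C_iff intro: image_eqI[of _ coef "Ps _"])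
  have coef_minus: "coef (p - q) = coef p \<ominus>\<^bsub>S\<^esub> coef q" if "p \<in> C" "q \<in> C" for p q
  proof -
    have c: "coef p \<in> carrier S" "coef q \<in> carrier S" "coef (p - q) \<in> carrier S" using that K.diff_C[OF that] by (simp_all add: C_iff)
    have "coef (p - q) \<oplus>\<^bsub>S\<^esub> coef q = coef p" by (simp add: simps)
    then show ?thesis using c by (metis add.inv_solve_right a_minus_def)
  qed
  \<comment> \<open>Tor over \<open>S\<close> is computed with \<open>S\<close> presented as
    \<open>C\<close> modulo zero; \<open>P2\<close> below presents the quotient ring as
    \<open>C\<close> modulo \<open>I'\<close>.\<close>
  interpret P1: presented_ring C cst ev S coef "{0}"
  proof
    show "K.idl {0}" by (rule K.idl_zero)
    show "carrier S = coef ` C" by (rule carS)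
    show "coef p = coef q \<longleftrightarrow> p - q \<in> {0}" for p q :: "'k ps" by (simp add: coef_inject)
  qed (simp_all add: simps zero_ps_def plus_ps_def times_ps_def)
  let ?\<pi> = "\<lambda>f. I +>\<^bsub>S\<^esub> coef f"
  interpret P2: presented_ring C cst ev "S Quot I" ?\<pi> I'
  proof
    show "K.idl I'" by (rule I')
    have "carrier (S Quot I) = (\<lambda>a. I +>\<^bsub>S\<^esub> a) ` carrier S"
      by (auto simp: FactRing_def A_RCOSETS_def RCOSETS_def a_r_coset_def)
    then show "carrier (S Quot I) = ?\<pi> ` C" by (simp only: carS image_image)
    have "I +>\<^bsub>S\<^esub> \<zero>\<^bsub>S\<^esub> = I" by (rule a_coset_add_zero[OF a_subset])
    then show "\<zero>\<^bsub>S Quot I\<^esub> = ?\<pi> 0" by (simp add: FactRing_def simps zero_ps_def)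
    fix p q assume pq: "p \<in> C" "q \<in> C"
    then have c: "coef p \<in> carrier S" "coef q \<in> carrier S" by (simp_all add: C_iff)
    show "?\<pi> p \<oplus>\<^bsub>S Quot I\<^esub> ?\<pi> q = ?\<pi> (p + q)" using a_rcos_sum[OF c] by (simp add: FactRing_def simps plus_ps_def)
    show "?\<pi> p \<otimes>\<^bsub>S Quot I\<^esub> ?\<pi> q = ?\<pi> (p * q)" using rcoset_mult_add[OF c] by (simp add: FactRing_def simps coef_mult)
    show "?\<pi> p = ?\<pi> q \<longleftrightarrow> p - q \<in> I'"
      using quotient_eq_iff_same_a_r_cos[OF assms(2) c] coef_minus[OF pq] by (simp add: I'_def)
  qed
  have ev_surj: "ev ` C = UNIV"
  proof -
    have "c \<in> ev ` C" for c by (rule image_eqI[of _ ev "cst c"]) (simp_all add: K.ev_cst K.cst_C)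
    then show ?thesis by blast
  qed
  have M1: "P1.cyclic_module residue_module ev {a \<in> C. ev a = 0}"
    using K.idl_kernel K.zero_C
    by (auto simp: P1.cyclic_module_def residue_module_def ring_module_def ev_surj K.ev_add K.ev_mult K.ev_zero K.ev_diff K.diff_C ev_def[symmetric])
  have M2: "P1.cyclic_module (ring_module (\<lambda>f. I +>\<^bsub>S\<^esub> f) (S Quot I)) ?\<pi> I'"
    unfolding P1.cyclic_module_def
    using I' K.idlD(2)[OF I'] P2.carrier_A P2.zero_A P2.\<pi>_add P2.\<pi>_mult P2.\<pi>_eq by (simp add: ring_module_def)
  \<comment> \<open>All members of a coset of \<open>I\<close> share one constant term, so
    \<open>the_elem\<close> in the residue module is meaningful.\<close>
  have the: "the_elem ((\<lambda>f. f {#}) ` ?\<pi> p) = ev p" if p: "p \<in> C" for p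
  proof -
    have "f {#} = ev p" if "f \<in> ?\<pi> p" for f using that I_ev by (auto simp: a_r_coset_def' simps ev_def)
    moreover have "coef p \<in> ?\<pi> p" using a_rcos_self[of "coef p"] p by (simp add: C_iff)
    then have "ev p \<in> (\<lambda>f. f {#}) ` ?\<pi> p" by (rule image_eqI[rotated]) (simp add: ev_def)
    ultimately have "(\<lambda>f. f {#}) ` ?\<pi> p = {ev p}" by (intro equalityI image_subsetI) simp_all
    then show ?thesis by simp
  qed
  have "I' \<subseteq> {a \<in> C. ev a = 0}" using K.idlD(1,5)[OF I'] by blast
  then have M3: "P2.cyclic_module residue_module_quot ev {a \<in> C. ev a = 0}"
    using K.idl_kernel K.zero_C
    by (simp add: P2.cyclic_module_def residue_module_quot_def ring_module_def ev_surj K.ev_add K.ev_mult K.ev_zero K.ev_diff K.diff_C the)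
  \<comment> \<open>The field is resolved over \<open>S\<close> by the Koszul complex and then
    tensored with the quotient ring, where \<open>V\<close> is the basis.\<close>
  have bettis: "poincare_series const S residue_module (ring_module (\<lambda>f. I +>\<^bsub>S\<^esub> f) (S Quot I)) = G.betti_series"
  proof -
    obtain X :: "nat \<Rightarrow> ('k ps word \<times> nat set) set" and d g where X: "K.res {0} X d g"
      "\<forall>i. \<exists>z :: (nat set \<Rightarrow> 'k ps) \<Rightarrow> 'k ps word \<times> nat set \<Rightarrow> 'k ps. K.hbasis I' X d i (if i = 0 then {\<lambda>_. 0} else V (i - 1)) z"
      using G.koszul_resolution by (elim exE conjE)
    have "vectorspace.dim class_ring (restrict_scalars const (tor S residue_module (ring_module (\<lambda>f. I +>\<^bsub>S\<^esub> f) (S Quot I)) i))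
        = (if i = 0 then 1 else card (V (i - 1)))" for i
    proof -
      obtain z :: "(nat set \<Rightarrow> 'k ps) \<Rightarrow> 'k ps word \<times> nat set \<Rightarrow> 'k ps" where z: "K.hbasis I' X d i (if i = 0 then {\<lambda>_. 0} else V (i - 1)) z"
        using X(2) by (elim allE exE)
      have "vectorspace.dim class_ring (restrict_scalars (\<lambda>c. coef (cst c)) (tor S residue_module (ring_module (\<lambda>f. I +>\<^bsub>S\<^esub> f) (S Quot I)) i))
        = card (if i = 0 then {\<lambda>_. 0} else V (i - 1))"
      proof (rule P1.dim_tor)
        show "P1.cyclic_module residue_module ev {a \<in> C. ev a = 0}" by (rule M1)
        show "P1.cyclic_module (ring_module (\<lambda>f. I +>\<^bsub>S\<^esub> f) (S Quot I)) ?\<pi> I'" by (rule M2)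
        show "K.res {0} X d g" by (rule X(1))
        show "K.hbasis I' X d i (if i = 0 then {\<lambda>_. 0} else V (i - 1)) z" by (rule z)
      qed (simp_all add: residue_module_def ring_module_def ev_def)
      moreover have "(\<lambda>c. coef (cst c)) = const" by (simp add: cst_def)
      ultimately show ?thesis by simp
    qed
    then show ?thesis by (simp add: poincare_series_def G.betti_series_def)
  qed
  \<comment> \<open>The field is resolved over the quotient ring by the Golod complex and then
    tensored with the field, where ranks are dimensions.\<close>
  have ranks: "poincare_series (\<lambda>c. I +>\<^bsub>S\<^esub> const c) (S Quot I) residue_module_quot residue_module_quot
      = Abs_fps (\<lambda>N. of_nat (card (G.FX N)))"
  proof -
    have "vectorspace.dim class_ring (restrict_scalars (\<lambda>c. ?\<pi> (cst c)) (tor (S Quot I) residue_module_quot residue_module_quot i))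
        = card (G.FX i)" for i
    proof (rule P2.dim_tor)
      show "P2.cyclic_module residue_module_quot ev {a \<in> C. ev a = 0}" by (rule M3)
      show "P2.cyclic_module residue_module_quot ev {a \<in> C. ev a = 0}" by (rule M3)
      show "K.res I' G.FX G.FA (\<lambda>_. 1)" by (rule G.golod_resolution)
      show "K.hbasis {a \<in> C. ev a = 0} G.FX G.FA i (G.FX i) (\<lambda>k x. if x = k then 1 else 0)" by (rule G.golod_hbasis)
    qed (simp_all add: residue_module_quot_def ring_module_def the)
    then show ?thesis by (simp add: poincare_series_def cst_def)
  qed
  show ?thesis
    unfolding golod_ideal_def Let_def bettis ranks by (rule G.golod_series)
qed

end
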